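(* Let $A$ be a monotone complete C*-algebra, let $\{\mathcal M,\langle\cdot,\cdot\rangle\}$ be a Hilbert $A$-module, and let $B$ be a C*-algebra admitting a $*$-representation in $\mathrm{End}_A^*(\mathcal M)$, so that $\mathcal M$ is a Hilbert $A$-$B$-bimodule. Then $\mathcal M$ is injective in $\mathcal B(A,B)$ if and only if $\mathcal M$ is self-dual as a Hilbert $A$-module.
   Context: Hilbert $A$-modules are left $A$-modules with an $A$-valued inner product that is $A$-linear in the first argument, complete in the norm $\|x\|=\|\langle x,x\rangle\|^{1/2}$. $\mathrm{End}_A^*(\mathcal M)$ is the C*-algebra of adjointable bounded $A$-linear operators on $\mathcal M$. A Hilbert $A$-$B$-bimodule is a Hilbert $A$-module $\mathcal M$ together with a right action of the C*-algebra $B$ by bounded adjointable $A$-linear maps given by a $*$-representation, so that $\langle a m_1 b,m_2\rangle=a\langle m_1,m_2b^*\rangle$. Hilbert $A$-$B$-submodules are norm-closed subspaces invariant under both actions. $\mathcal B(A,B)$ is the category whose objects are Hilbert $A$-$B$-bimodules and whose morphisms are all bounded $A$-$B$-bimodule maps. An object $\mathcal E$ is injective in $\mathcal B(A,B)$ if for every Hilbert $A$-$B$-bimodule $\mathcal L$, every Hilbert $A$-$B$-submodule $\mathcal K\subseteq\mathcal L$ and every bounded bimodule map $\phi:\mathcal K\to\mathcal E$ there is a bounded bimodule map $\psi:\mathcal L\to\mathcal E$ extending $\phi$. $\mathcal M$ is self-dual if every bounded $A$-module map $r:\mathcal M\to A$ is of the form $r=\langle\cdot,x_r\rangle$ for some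 $x_r\in\mathcal M$. A C*-algebra is monotone complete if every norm-bounded increasing net of self-adjoint elements has a least upper bound in its self-adjoint part. *)

theory Defs
  imports "HOL-Analysis.Analysis" "HOL-Algebra.Module"
begin

section \<open>C*-algebras\<close>

text \<open>C*-algebras are not assumed to be unital or non-zero.\<close>

class cstar_algebra = real_normed_algebra + banach +
  fixes cscale :: "complex \<Rightarrow> 'a \<Rightarrow> 'a"
    and cstar :: "'a \<Rightarrow> 'a"
  assumes scaleR_eq_cscale: "scaleR t x = cscale (complex_of_real t) x"
    and cscale_add_left: "cscale (c + d) x = cscale c x + cscale d x"
    and cscale_add_right: "cscale c (x + y) = cscale c x + cscale c y"
    and cscale_cscale: "cscale c (cscale d x) = cscale (c * d) x"
    and cscale_mult_left: "cscale c x * y = cscale c (x * y)"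
    and cscale_mult_right: "x * cscale c y = cscale c (x * y)"
    and norm_cscale: "norm (cscale c x) = cmod c * norm x"
    and cstar_cstar: "cstar (cstar x) = x"
    and cstar_add: "cstar (x + y) = cstar x + cstar y"
    and cstar_cscale: "cstar (cscale c x) = cscale (cnj c) (cstar x)"
    and cstar_mult: "cstar (x * y) = cstar y * cstar x"
    and cstar_identity: "norm (cstar x * x) = (norm x)\<^sup>2"

definition self_adjoint :: "'a::cstar_algebra \<Rightarrow> bool"
  where "self_adjoint a \<longleftrightarrow> cstar a = a"

definition positive :: "'a::cstar_algebra \<Rightarrow> bool"
  where "positive a \<longleftrightarrow> (\<exists>b. a = cstar b * b)"

definition cstar_le :: "'a::cstar_algebra \<Rightarrow> 'a \<Rightarrow> bool"
  where "cstar_le a b \<longleftrightarrow> positive (b - a)"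

text \<open>Index sets of nets are taken inside the type of the algebra. This is no restriction: an
  increasing net has the same upper bounds as its range, which is an increasing net indexed by
  itself.\<close>

definition monotone_complete :: "'a::cstar_algebra itself \<Rightarrow> bool"
  where "monotone_complete (_ :: 'a itself) \<longleftrightarrow>
    (\<forall>(I :: 'a set) r (x :: 'a \<Rightarrow> 'a).
       I \<noteq> {} \<and> preorder_on I r \<and> (\<forall>i\<in>I. \<forall>j\<in>I. \<exists>k\<in>I. (i, k) \<in> r \<and> (j, k) \<in> r) \<and>
       (\<forall>i\<in>I. self_adjoint (x i)) \<and>
       (\<forall>i j. (i, j) \<in> r \<longrightarrow> cstar_le (x i) (x j)) \<and>
       (\<exists>C. \<forall>i\<in>I. norm (x i) \<le> C) \<longrightarrow>
       (\<exists>s. self_adjoint s \<and> (\<forall>i\<in>I. cstar_le (x i) s) \<and>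
         (\<forall>u. self_adjoint u \<and> (\<forall>i\<in>I. cstar_le (x i) u) \<longrightarrow> cstar_le s u)))"

section \<open>Hilbert modules\<close>

definition complex_field :: "complex ring"
  where "complex_field = \<lparr>carrier = UNIV, mult = (*), one = 1, zero = 0, add = (+)\<rparr>"

text \<open>The additive group and the complex scalar multiplication of a Hilbert module are those of
  a module over the complex numbers in the sense of HOL-Algebra. As there, the fields
  \<^const>\<open>mult\<close> and \<^const>\<open>one\<close> inherited from \<^type>\<open>ring\<close> are not used.\<close>

record ('a, 'm) hilbert_mod = "(complex, 'm) module" +
  lact :: "'a \<Rightarrow> 'm \<Rightarrow> 'm" (infixr \<open>\<triangleright>\<index>\<close> 75)
  ip :: "'m \<Rightarrow> 'm \<Rightarrow> 'a"

definition hnorm :: "('a::cstar_algebra, 'm) hilbert_mod \<Rightarrow> 'm \<Rightarrow> real"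
  where "hnorm M x = sqrt (norm (ip M x x))"

text \<open>The guard is needed since \<^locale>\<open>Metric_space\<close> requires symmetry of the distance on the
  whole type.\<close>

definition hdist :: "('a::cstar_algebra, 'm) hilbert_mod \<Rightarrow> 'm \<Rightarrow> 'm \<Rightarrow> real"
  where "hdist M x y =
    (if x \<in> carrier M \<and> y \<in> carrier M then hnorm M (x \<ominus>\<^bsub>M\<^esub> y) else 0)"

locale hilbert_module = Module.module complex_field M
  for M :: "('a::cstar_algebra, 'm) hilbert_mod" (structure) +
  assumes lact_closed: "x \<in> carrier M \<Longrightarrow> a \<triangleright> x \<in> carrier M"
    and lact_add_left: "x \<in> carrier M \<Longrightarrow> (a + b) \<triangleright> x = a \<triangleright> x \<oplus> b \<triangleright> x"
    and lact_add_right: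
      "\<lbrakk>x \<in> carrier M; y \<in> carrier M\<rbrakk> \<Longrightarrow> a \<triangleright> (x \<oplus> y) = a \<triangleright> x \<oplus> a \<triangleright> y"
    and lact_mult: "x \<in> carrier M \<Longrightarrow> (a * b) \<triangleright> x = a \<triangleright> (b \<triangleright> x)"
    and lact_cscale: "x \<in> carrier M \<Longrightarrow> cscale c a \<triangleright> x = c \<odot> (a \<triangleright> x)"
    and lact_smult: "x \<in> carrier M \<Longrightarrow> a \<triangleright> (c \<odot> x) = c \<odot> (a \<triangleright> x)"
    and ip_add: "\<lbrakk>x \<in> carrier M; y \<in> carrier M; z \<in> carrier M\<rbrakk> \<Longrightarrow>
      ip M (x \<oplus> y) z = ip M x z + ip M y z"
    and ip_smult: "\<lbrakk>x \<in> carrier M; y \<in> carrier M\<rbrakk> \<Longrightarrow> ip M (c \<odot> x) y = cscale c (ip M x y)"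
    and ip_lact: "\<lbrakk>x \<in> carrier M; y \<in> carrier M\<rbrakk> \<Longrightarrow> ip M (a \<triangleright> x) y = a * ip M x y"
    and ip_cstar: "\<lbrakk>x \<in> carrier M; y \<in> carrier M\<rbrakk> \<Longrightarrow> ip M y x = cstar (ip M x y)"
    and ip_positive: "x \<in> carrier M \<Longrightarrow> positive (ip M x x)"
    and ip_definite: "\<lbrakk>x \<in> carrier M; ip M x x = 0\<rbrakk> \<Longrightarrow> x = \<zero>"
    and complete: "Metric_space.mcomplete (carrier M) (hdist M)"

definition bounded_module_map ::
  "('a::cstar_algebra, 'm) hilbert_mod \<Rightarrow> ('a, 'n) hilbert_mod \<Rightarrow> ('m \<Rightarrow> 'n) \<Rightarrow> bool"
  where "bounded_module_map M N f \<longleftrightarrow>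
    f \<in> carrier M \<rightarrow> carrier N \<and>
    (\<forall>x\<in>carrier M. \<forall>y\<in>carrier M. f (x \<oplus>\<^bsub>M\<^esub> y) = f x \<oplus>\<^bsub>N\<^esub> f y) \<and>
    (\<forall>c. \<forall>x\<in>carrier M. f (c \<odot>\<^bsub>M\<^esub> x) = c \<odot>\<^bsub>N\<^esub> f x) \<and>
    (\<forall>a. \<forall>x\<in>carrier M. f (a \<triangleright>\<^bsub>M\<^esub> x) = a \<triangleright>\<^bsub>N\<^esub> f x) \<and>
    (\<exists>C. \<forall>x\<in>carrier M. hnorm N (f x) \<le> C * hnorm M x)"

definition bounded_module_functional ::
  "('a::cstar_algebra, 'm) hilbert_mod \<Rightarrow> ('m \<Rightarrow> 'a) \<Rightarrow> bool"
  where "bounded_module_functional M r \<longleftrightarrow>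
    (\<forall>x\<in>carrier M. \<forall>y\<in>carrier M. r (x \<oplus>\<^bsub>M\<^esub> y) = r x + r y) \<and>
    (\<forall>c. \<forall>x\<in>carrier M. r (c \<odot>\<^bsub>M\<^esub> x) = cscale c (r x)) \<and>
    (\<forall>a. \<forall>x\<in>carrier M. r (a \<triangleright>\<^bsub>M\<^esub> x) = a * r x) \<and>
    (\<exists>C. \<forall>x\<in>carrier M. norm (r x) \<le> C * hnorm M x)"

definition self_dual :: "('a::cstar_algebra, 'm) hilbert_mod \<Rightarrow> bool"
  where "self_dual M \<longleftrightarrow>
    (\<forall>r. bounded_module_functional M r \<longrightarrow>
      (\<exists>y\<in>carrier M. \<forall>x\<in>carrier M. r x = ip M x y))"

definition adjointable :: "('a::cstar_algebra, 'm) hilbert_mod \<Rightarrow> ('m \<Rightarrow> 'm) \<Rightarrow> bool"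
  where "adjointable M T \<longleftrightarrow> bounded_module_map M M T \<and>
    (\<exists>S \<in> carrier M \<rightarrow> carrier M.
      \<forall>x\<in>carrier M. \<forall>y\<in>carrier M. ip M (T x) y = ip M x (S y))"

section \<open>Hilbert bimodules\<close>

text \<open>A *-representation of \<open>B\<close> is given by the right action \<open>\<rho>\<close>, where \<open>\<rho> x b\<close> is the product
  \<open>xb\<close>. Operators on a left module are thus written on the right of their argument, and the
  product in \<open>B\<close> corresponds to composition from left to right. The representation may be
  degenerate.\<close>

definition star_representation ::
  "('a::cstar_algebra, 'm) hilbert_mod \<Rightarrow> ('m \<Rightarrow> 'b::cstar_algebra \<Rightarrow> 'm) \<Rightarrow> bool"
  where "star_representation M \<rho> \<longleftrightarrow>
    (\<forall>b. adjointable M (\<lambda>x. \<rho> x b)) \<and>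
    (\<forall>b c. \<forall>x\<in>carrier M. \<rho> x (b + c) = \<rho> x b \<oplus>\<^bsub>M\<^esub> \<rho> x c) \<and>
    (\<forall>z b. \<forall>x\<in>carrier M. \<rho> x (cscale z b) = z \<odot>\<^bsub>M\<^esub> \<rho> x b) \<and>
    (\<forall>b c. \<forall>x\<in>carrier M. \<rho> x (b * c) = \<rho> (\<rho> x b) c) \<and>
    (\<forall>b. \<forall>x\<in>carrier M. \<forall>y\<in>carrier M. ip M (\<rho> x b) y = ip M x (\<rho> y (cstar b)))"

definition hilbert_bimodule ::
  "('a::cstar_algebra, 'm) hilbert_mod \<Rightarrow> ('m \<Rightarrow> 'b::cstar_algebra \<Rightarrow> 'm) \<Rightarrow> bool"
  where "hilbert_bimodule M \<rho> \<longleftrightarrow> hilbert_module M \<and> star_representation M \<rho>"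

definition hilbert_subbimodule ::
  "'m set \<Rightarrow> ('a::cstar_algebra, 'm) hilbert_mod \<Rightarrow> ('m \<Rightarrow> 'b::cstar_algebra \<Rightarrow> 'm) \<Rightarrow> bool"
  where "hilbert_subbimodule K L \<rho> \<longleftrightarrow>
    submodule K complex_field L \<and>
    closedin (Metric_space.mtopology (carrier L) (hdist L)) K \<and>
    (\<forall>a. \<forall>x\<in>K. a \<triangleright>\<^bsub>L\<^esub> x \<in> K) \<and>
    (\<forall>b. \<forall>x\<in>K. \<rho> x b \<in> K)"

definition bounded_bimodule_map ::
  "('a::cstar_algebra, 'm) hilbert_mod \<Rightarrow> ('m \<Rightarrow> 'b::cstar_algebra \<Rightarrow> 'm) \<Rightarrow>
   ('a, 'n) hilbert_mod \<Rightarrow> ('n \<Rightarrow> 'b \<Rightarrow> 'n) \<Rightarrow> ('m \<Rightarrow> 'n) \<Rightarrow> bool"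
  where "bounded_bimodule_map M \<rho> N \<sigma> f \<longleftrightarrow>
    bounded_module_map M N f \<and>
    (\<forall>b. \<forall>x\<in>carrier M. f (\<rho> x b) = \<sigma> (f x) b)"

text \<open>Injectivity of \<open>(E, \<sigma>)\<close>, where the Hilbert bimodules \<open>L\<close> range over all those whose
  carrier is a subset of the type \<open>'l\<close>. A formula cannot quantify over types, so \<open>'l\<close> is a
  parameter; injectivity in the category of all Hilbert bimodules is this property for every
  \<open>'l\<close>. By transport of structure it passes from a type to any type that embeds into it. For small
  types it can hold trivially; a type such as \<open>('m \<Rightarrow> 'a) + 'l\<close>, with \<open>'l\<close> arbitrary, contains
  copies of all bimodules on \<open>'l\<close> and has room for the Banach dual module of \<open>E\<close>, that is, the
  bounded module functionals on \<open>E\<close>.\<close>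

definition injective_bimodule ::
  "'l itself \<Rightarrow> ('a::cstar_algebra, 'm) hilbert_mod \<Rightarrow> ('m \<Rightarrow> 'b::cstar_algebra \<Rightarrow> 'm) \<Rightarrow> bool"
  where "injective_bimodule (_ :: 'l itself) E \<sigma> \<longleftrightarrow>
    (\<forall>(L :: ('a, 'l) hilbert_mod) (\<rho> :: 'l \<Rightarrow> 'b \<Rightarrow> 'l) K \<phi>.
       hilbert_bimodule L \<rho> \<and> hilbert_subbimodule K L \<rho> \<and>
       bounded_bimodule_map (L\<lparr>carrier := K\<rparr>) \<rho> E \<sigma> \<phi> \<longrightarrow>
       (\<exists>\<psi>. bounded_bimodule_map L \<rho> E \<sigma> \<psi> \<and> (\<forall>x\<in>K. \<psi> x = \<phi> x)))"

end

theory Submission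
  imports Defs "HOL-Library.Function_Algebras"
begin

text \<open>
  The set of all \<open>r(x) + r(x)\<^sup>* - \<langle>x, x\<rangle>\<close>, where \<open>r\<close> is a bounded functional on a Hilbert module \<open>M\<close>,
  has the same upper bounds as the bounded increasing net of the maxima of these expressions, with a
  penalty on the coefficients of \<open>x\<close>, over finitely generated submodules. So it has a least upper bound
  \<open>q(r)\<close>. From this definition alone, \<open>q\<close> satisfies the parallelogram law,
  \<open>q(r + \<langle>\<cdot>, y\<rangle>) = q(r) + r(y) + r(y)\<^sup>* + \<langle>y, y\<rangle>\<close> and \<open>q(u r) = u q(r) u\<^sup>*\<close> for invertible \<open>u\<close>. Polarization
  turns the dual \<open>M'\<close> into a Hilbert bimodule that contains \<open>M\<close>, and by Paschke's inequality bounded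
  functionals on \<open>M'\<close> are determined by their values on \<open>M\<close>.

  If \<open>M\<close> is self-dual and \<open>\<phi>\<close> maps \<open>K \<subseteq> L\<close> to \<open>M\<close>, then an extension \<open>\<psi>\<close> is defined by
  \<open>\<langle>m, \<psi>(x)\<rangle> = \<langle>\<langle>\<phi>(\<cdot>), m\<rangle>, \<langle>\<cdot>, x\<rangle>\<rangle>\<close>, the outer inner product being that of \<open>K'\<close>. Conversely, if \<open>M\<close> is
  injective, then there is a retraction of \<open>M'\<close> onto \<open>M\<close>; it differs from the identity by a bounded map
  that vanishes on \<open>M\<close>, hence is the identity.
\<close>

text \<open>The values \<open>gap r x\<close> are not known to be directed, so monotone completeness
  does not apply to them as they stand. Over finitely many generators the maximization is a linear
  system whose Gram matrix may be singular; the penalty \<epsilon> makes every pivot invertible, and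
  shrinking \<epsilon> while enlarging the set of generators gives a directed family. The expression
  \<open>gap r x\<close> is a completed square, so the substitutions x \<mapsto> x + y, x \<mapsto>
  c x and x \<mapsto> (1 + a) x act on it, and hence on its least upper bound, by explicit formulas.
  As A may lack a unit, u has the form 1 + a with norm a < 1, and all formulas are multiplied out
  until the 1 disappears; scaling then reaches every a. Least upper bounds respect order bounds, so
  norm bounds of maps are first converted into order bounds. The required facts on positive elements
  are derived from the C*-identity alone, with the binomial series as the source of square roots and
  a norm estimate in place of the spectrum.\<close>

section \<open>Scalars and the involution\<close>

lemma cscale_zero_left [simp]: "cscale 0 (x :: 'a::cstar_algebra) = 0"
  using norm_cscale[of 0 x] by simp

lemma cscale_zero_right [simp]: "cscale c (0 :: 'a::cstar_algebra) = 0"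
  using norm_cscale[of c "0::'a"] by simp

lemma cscale_one [simp]: "cscale 1 (x :: 'a::cstar_algebra) = x"
  using scaleR_eq_cscale[of 1 x] by simp

lemma cscale_minus_right: "cscale c (- x :: 'a::cstar_algebra) = - cscale c x"
  using cscale_add_right[of c x "- x"] by (simp add: eq_neg_iff_add_eq_0 add.commute)

lemma cscale_minus_left: "cscale (- c) (x :: 'a::cstar_algebra) = - cscale c x"
  using cscale_add_left[of c "- c" x] by (simp add: eq_neg_iff_add_eq_0 add.commute)

lemma cscale_diff_right: "cscale c (x - y :: 'a::cstar_algebra) = cscale c x - cscale c y"
  using cscale_add_right[of c x "- y"] by (simp add: cscale_minus_right)

lemma cscale_scaleR: "cscale c (t *\<^sub>R x) = t *\<^sub>R cscale c (x :: 'a::cstar_algebra)"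
  by (simp add: scaleR_eq_cscale cscale_cscale mult.commute)

lemmas cscale_simps = cscale_add_right cscale_diff_right cscale_minus_right cscale_minus_left
  cscale_mult_left cscale_mult_right cscale_cscale

lemma cstar_zero [simp]: "cstar (0 :: 'a::cstar_algebra) = 0"
  using cstar_add[of "0::'a" 0] by simp

lemma cstar_minus: "cstar (- x :: 'a::cstar_algebra) = - cstar x"
  using cstar_add[of x "- x"] by (simp add: eq_neg_iff_add_eq_0 add.commute)

lemma cstar_diff: "cstar (x - y :: 'a::cstar_algebra) = cstar x - cstar y"
  using cstar_add[of x "- y"] by (simp add: cstar_minus)

lemma cstar_scaleR: "cstar (t *\<^sub>R x :: 'a::cstar_algebra) = t *\<^sub>R cstar x"
  by (simp add: scaleR_eq_cscale cstar_cscale)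

lemma cstar_sum: "cstar (\<Sum>x\<in>F. f x :: 'a::cstar_algebra) = (\<Sum>x\<in>F. cstar (f x))"
  by (induction F rule: infinite_finite_induct) (auto simp: cstar_add)

text \<open>The C*-identity and submultiplicativity bound the square of \<open>norm y\<close> by
  \<open>norm (cstar y) * norm y\<close>, both for x and for its adjoint.\<close>

lemma norm_cstar [simp]: "norm (cstar (x :: 'a::cstar_algebra)) = norm x"
proof -
  have le: "norm y \<le> norm (cstar y)" for y :: 'a
  proof (cases "y = 0")
    case False
    have "norm y * norm y \<le> norm (cstar y) * norm y"
      using cstar_identity[of y] norm_mult_ineq[of "cstar y" y] by (simp add: power2_eq_square)
    with False show ?thesis by simp
  qed simp
  show ?thesis using le[of x] le[of "cstar x"] by (simp add: cstar_cstar)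
qed

lemma bounded_linear_cstar: "bounded_linear (cstar :: 'a::cstar_algebra \<Rightarrow> 'a)"
  by (rule bounded_linear_intro[where K = 1]) (auto simp: cstar_add cstar_scaleR)

lemma bounded_linear_cscale: "bounded_linear (cscale c :: 'a::cstar_algebra \<Rightarrow> 'a)"
  by (rule bounded_linear_intro[where K = "cmod c"])
    (auto simp: cscale_add_right cscale_scaleR norm_cscale)

lemma norm_mult_cstar: "norm (x * cstar x) = (norm (x :: 'a::cstar_algebra))\<^sup>2"
  using cstar_identity[of "cstar x"] by (simp add: cstar_cstar)

lemma cstar_mult_self_eq_0: "cstar x * x = 0 \<Longrightarrow> (x :: 'a::cstar_algebra) = 0"
  using cstar_identity[of x] by simp

lemma mult_cstar_self_eq_0: "x * cstar x = 0 \<Longrightarrow> (x :: 'a::cstar_algebra) = 0"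
  using norm_mult_cstar[of x] by simp

lemma cstar_one [simp]: "cstar (1 :: 'a::{cstar_algebra,real_normed_algebra_1}) = 1"
  by (metis cstar_cstar cstar_mult mult_1_left mult_1_right)

lemma cstar_of_real [simp]:
  "cstar (of_real t :: 'a::{cstar_algebra,real_normed_algebra_1}) = of_real t"
  by (simp add: of_real_def cstar_scaleR)

lemma cstar_power: "cstar (x ^ n) = cstar (x :: 'a::{cstar_algebra,real_normed_algebra_1}) ^ n"
  by (induction n) (auto simp: cstar_mult power_commutes)


section \<open>Square roots and positivity in unital C*-algebras\<close>

text \<open>The Taylor coefficients at 0 of the square root of 1 - x.\<close>

definition sqrt_coeff :: "nat \<Rightarrow> real"
  where "sqrt_coeff n = (1/2 gchoose n) * (-1) ^ n"

lemma sqrt_coeff_0 [simp]: "sqrt_coeff 0 = 1"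
  by (simp add: sqrt_coeff_def)

lemma gbinomial_Suc_mult: "(a gchoose Suc k) = (a gchoose k) * ((a - real k) / (real k + 1))"
  for a :: real
  using gbinomial_absorption[of k a] gbinomial_mult_1[of a k] by (simp add: field_simps)

text \<open>The coefficient with index 1 is -1/2, and the ratio of consecutive later ones is (n +
  1/2) / (n + 2), which is positive.\<close>

lemma sqrt_coeff_neg: "sqrt_coeff (Suc n) \<le> 0"
proof (induction n)
  case 0
  show ?case by (simp add: sqrt_coeff_def gbinomial_Suc_mult)
next
  case (Suc n)
  have "sqrt_coeff (Suc (Suc n)) = sqrt_coeff (Suc n) * ((real n + 1/2) / (real n + 2))"
    unfolding sqrt_coeff_def gbinomial_Suc_mult[of _ "Suc n"]
    by (simp add: divide_simps) (simp add: algebra_simps)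
  with Suc show ?case
    by (smt (verit, best) divide_nonneg_nonneg mult_nonpos_nonneg of_nat_0_le_iff)
qed

text \<open>The partial sums are the coefficients of (1 - x)^(1/2) / (1 - x) = (1 - x)^(-1/2), which
  are all positive.\<close>

lemma sum_sqrt_coeff_nonneg: "(\<Sum>k\<le>m. sqrt_coeff k) \<ge> 0"
proof -
  have "(-1) ^ m * ((-1/2::real) gchoose m) \<ge> 0"
  proof (induction m)
    case (Suc m)
    have "(-1) ^ Suc m * ((-1/2::real) gchoose Suc m) =
        ((-1) ^ m * ((-1/2::real) gchoose m)) * ((real m + 1/2) / (real m + 1))"
      unfolding gbinomial_Suc_mult by (simp add: divide_simps) (simp add: algebra_simps)
    with Suc show ?case by simp
  qed simp
  then show ?thesis
    using gbinomial_sum_lower_neg[of "1/2::real" m] by (simp add: sqrt_coeff_def)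
qed

text \<open>After the constant term 1 all coefficients are nonpositive, so the sum of absolute
  values is 1 minus a partial sum. The series therefore converges on the closed unit ball.\<close>

lemma sum_abs_sqrt_coeff_le: "(\<Sum>k<m. \<bar>sqrt_coeff (Suc k)\<bar>) \<le> 1"
proof -
  have "(\<Sum>k<m. \<bar>sqrt_coeff (Suc k)\<bar>) = - (\<Sum>k<m. sqrt_coeff (Suc k))"
    by (simp add: sum_negf abs_of_nonpos[OF sqrt_coeff_neg])
  also have "\<dots> = 1 - (\<Sum>k\<le>m. sqrt_coeff k)"
    using sum.lessThan_Suc_shift[of sqrt_coeff m] by (simp flip: lessThan_Suc_atMost)
  finally show ?thesis using sum_sqrt_coeff_nonneg[of m] by simp
qed

lemma summable_abs_sqrt_coeff: "summable (\<lambda>k. \<bar>sqrt_coeff (Suc k)\<bar>)"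
  by (rule summableI_nonneg_bounded[of _ 1]) (auto simp: sum_abs_sqrt_coeff_le)

text \<open>Vandermonde's identity for 1/2 + 1/2 = 1: the Cauchy square of the series is 1 -
  x.\<close>

lemma sqrt_coeff_convolution:
  "(\<Sum>i\<le>n. sqrt_coeff i * sqrt_coeff (n - i)) = (if n = 0 then 1 else if n = 1 then -1 else 0)"
proof -
  have "(\<Sum>i\<le>n. sqrt_coeff i * sqrt_coeff (n - i))
      = (\<Sum>i\<le>n. ((1/2 gchoose i) * (1/2 gchoose (n - i))) * (-1) ^ n)"
  proof (rule sum.cong[OF refl])
    fix i assume "i \<in> {..n}"
    then have "(-1::real) ^ n = (-1) ^ i * (-1) ^ (n - i)"
      by (simp flip: power_add)
    then show "sqrt_coeff i * sqrt_coeff (n - i)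
        = ((1/2 gchoose i) * (1/2 gchoose (n - i))) * (-1) ^ n"
      by (simp add: sqrt_coeff_def)
  qed
  also have "\<dots> = (1 gchoose n) * (-1) ^ n"
    using gbinomial_Vandermonde[of "1/2::real" "1/2" n]
    by (simp add: atMost_atLeast0 flip: sum_distrib_right)
  also have "((1::real) gchoose n) = of_nat (1 choose n)"
    using binomial_gbinomial[of 1 n, where ?'a = real] by simp
  finally show ?thesis
    by (cases n) (auto simp: binomial_eq_0 numeral_2_eq_2 less_Suc_eq_0_disj)
qed

text \<open>The root is the binomial series in c. The clause on commuting elements stands in for the
  functional calculus, and the bound on 1 - s makes the root positive again.\<close>

lemma exists_sqrt_one_minus:
  fixes c :: "'a::{cstar_algebra,real_normed_algebra_1}"
  assumes "norm c \<le> 1" "cstar c = c"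
  obtains s where "s * s = 1 - c" "cstar s = s" "norm (1 - s) \<le> 1"
    "\<And>x. x * c = c * x \<Longrightarrow> x * s = s * x"
proof
  define f where "f n = sqrt_coeff n *\<^sub>R c ^ n" for n
  have nf: "norm (f (Suc n)) \<le> \<bar>sqrt_coeff (Suc n)\<bar>" for n
  proof -
    have "norm (c ^ Suc n) \<le> 1"
      using norm_power_ineq[of c "Suc n"] power_le_one[of "norm c" "Suc n"] assms(1)
      by (meson norm_ge_zero order_trans)
    then show ?thesis by (simp add: f_def mult_left_le)
  qed
  have sn': "summable (\<lambda>n. norm (f (Suc n)))"
    by (rule summable_comparison_test[OF _ summable_abs_sqrt_coeff]) (use nf in auto)
  then have sn: "summable (\<lambda>n. norm (f n))"
    by (simp add: summable_Suc_iff[of "\<lambda>n. norm (f n)"])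
  then have sf: "summable f" by (rule summable_norm_cancel)
  define s where "s = (\<Sum>n. f n)"
  have conv: "(\<Sum>i\<le>k. f i * f (k - i)) = (if k = 0 then 1 else if k = 1 then - c else 0)" for k
  proof -
    have "(\<Sum>i\<le>k. f i * f (k - i)) = (\<Sum>i\<le>k. (sqrt_coeff i * sqrt_coeff (k - i)) *\<^sub>R c ^ k)"
      by (rule sum.cong) (auto simp: f_def mult.commute simp flip: power_add)
    also have "\<dots> = (\<Sum>i\<le>k. sqrt_coeff i * sqrt_coeff (k - i)) *\<^sub>R c ^ k"
      by (simp add: scaleR_left.sum)
    finally show ?thesis by (simp add: sqrt_coeff_convolution)
  qed
  have "s * s = (\<Sum>k. \<Sum>i\<le>k. f i * f (k - i))"
    unfolding s_def by (rule Cauchy_product[OF sn sn])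
  also have "\<dots> = (\<Sum>k. (if k = 0 then 1 else if k = 1 then - c else 0))"
    by (simp add: conv)
  also have "\<dots> = (\<Sum>k\<in>{0,1::nat}. (if k = 0 then 1 else if k = 1 then - c else 0))"
    by (rule suminf_finite) (auto split: if_splits)
  finally show "s * s = 1 - c" by simp
  have "cstar s = (\<Sum>n. cstar (f n))"
    unfolding s_def by (rule bounded_linear.suminf[OF bounded_linear_cstar sf])
  also have "\<dots> = s"
    by (simp add: s_def f_def cstar_scaleR cstar_power assms(2))
  finally show "cstar s = s" .
  have "s = 1 + (\<Sum>n. f (Suc n))"
    unfolding s_def using suminf_split_head[OF sf] by (simp add: f_def)
  then have "norm (1 - s) = norm (\<Sum>n. f (Suc n))" by simp
  also have "\<dots> \<le> (\<Sum>n. norm (f (Suc n)))" by (rule summable_norm[OF sn'])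
  also have "\<dots> \<le> (\<Sum>n. \<bar>sqrt_coeff (Suc n)\<bar>)"
    by (rule suminf_le[OF nf sn' summable_abs_sqrt_coeff])
  also have "\<dots> \<le> 1"
    by (rule suminf_le_const[OF summable_abs_sqrt_coeff sum_abs_sqrt_coeff_le])
  finally show "norm (1 - s) \<le> 1" .
  show "x * s = s * x" if "x * c = c * x" for x
  proof -
    have "x * c ^ n = c ^ n * x" for n
      by (induction n) (auto simp: that mult.assoc, metis that mult.assoc)
    then have "x * f n = f n * x" for n by (simp add: f_def)
    then show ?thesis
      using suminf_mult[OF sf, of x] suminf_mult2[OF sf, of x] by (simp add: s_def)
  qed
qed

text \<open>The element \<open>h + ik\<close> is unitary.\<close>

lemma norm_le_1_if_sum_squares_1:
  fixes h k :: "'a::{cstar_algebra,real_normed_algebra_1}"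
  assumes "cstar h = h" "cstar k = k" "h * k = k * h" "h * h + k * k = 1"
  shows "norm h \<le> 1"
proof -
  define u where "u = h + cscale \<i> k"
  have cu: "cstar u = h - cscale \<i> k"
    by (simp add: u_def cstar_add cstar_cscale assms cscale_minus_left)
  have "cstar u * u = h * h + k * k"
    unfolding cu unfolding u_def
    by (simp add: algebra_simps cscale_simps assms(3))
  then have "norm u ^ 2 = 1" using cstar_identity[of u] assms(4) by simp
  then have "norm u = 1" by (metis norm_ge_zero one_power2 power2_eq_imp_eq zero_le_one)
  moreover have "2 *\<^sub>R h = u + cstar u"
    unfolding cu unfolding u_def by (simp add: scaleR_2)
  then have "2 * norm h \<le> norm u + norm (cstar u)"
    using norm_triangle_ineq[of u "cstar u"] by (metis norm_scaleR abs_numeral)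
  ultimately show ?thesis by simp
qed

section \<open>Positivity through a norm estimate\<close>

text \<open>For self-adjoint a the estimate says that the spectrum lies in [0, 2t]. In this form
  sums and nonnegative multiples are handled by norm inequalities alone.\<close>

definition spectrally_nonneg :: "'a::{cstar_algebra,real_normed_algebra_1} \<Rightarrow> bool"
  where "spectrally_nonneg a \<longleftrightarrow> cstar a = a \<and> (\<exists>t\<ge>0. norm (of_real t - a) \<le> t)"

lemma spectrally_nonnegI: "cstar a = a \<Longrightarrow> t \<ge> 0 \<Longrightarrow> norm (of_real t - a) \<le> t \<Longrightarrow> spectrally_nonneg a"
  by (auto simp: spectrally_nonneg_def)

text \<open>The thresholds add up by the triangle inequality. For elements given as
  \<open>cstar b * b\<close>, closure under sums is far from visible.\<close>

lemma spectrally_nonneg_add: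
  assumes "spectrally_nonneg a" "spectrally_nonneg b"
  shows "spectrally_nonneg (a + b)"
proof -
  from assms obtain s t where st: "s \<ge> 0" "norm (of_real s - a) \<le> s" "t \<ge> 0" "norm (of_real t - b) \<le> t"
    by (auto simp: spectrally_nonneg_def)
  have "norm (of_real (s + t) - (a + b)) = norm ((of_real s - a) + (of_real t - b))"
    by (simp add: algebra_simps)
  also have "\<dots> \<le> s + t" using st norm_triangle_ineq[of "of_real s - a" "of_real t - b"] by linarith
  finally show ?thesis
    using st assms by (intro spectrally_nonnegI[of _ "s + t"]) (auto simp: spectrally_nonneg_def cstar_add)
qed

lemma spectrally_nonneg_scaleR:
  assumes "spectrally_nonneg a" "r \<ge> 0"
  shows "spectrally_nonneg (r *\<^sub>R a)"
proof -
  from assms obtain t where t: "t \<ge> 0" "norm (of_real t - a) \<le> t" and a: "cstar a = a"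
    by (auto simp: spectrally_nonneg_def)
  have "of_real (r * t) - r *\<^sub>R a = r *\<^sub>R (of_real t - a)"
    by (simp add: scaleR_diff_right of_real_def)
  then have "norm (of_real (r * t) - r *\<^sub>R a) \<le> r * t"
    using t assms(2) by (simp add: mult_left_mono)
  then show ?thesis
    using t assms(2) a by (intro spectrally_nonnegI[of _ "r * t"]) (auto simp: cstar_scaleR)
qed

text \<open>A threshold t > 0 gives a = t (1 - c) with norm c \<le> 1, so the binomial series
  applies; the threshold 0 forces a = 0.\<close>

lemma spectrally_nonneg_sqrt:
  assumes "spectrally_nonneg a"
  obtains h where "h * h = a" "cstar h = h" "spectrally_nonneg h"
    "\<And>x. x * a = a * x \<Longrightarrow> x * h = h * x"
proof -
  from assms obtain t where t: "t \<ge> 0" "norm (of_real t - a) \<le> t" and a: "cstar a = a"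
    by (auto simp: spectrally_nonneg_def)
  show ?thesis
  proof (cases "t = 0")
    case True
    with t have "a = 0" by simp
    then show ?thesis using that[of 0] assms by simp
  next
    case False
    with t have tp: "t > 0" by simp
    define c where "c = 1 - (1/t) *\<^sub>R a"
    have "c = (1/t) *\<^sub>R (of_real t - a)"
      using tp by (simp add: c_def scaleR_diff_right of_real_def)
    then have "norm c = (1/t) * norm (of_real t - a)" using tp by (simp only: norm_scaleR) simp
    then have "norm c \<le> 1" using tp t by simp
    moreover have "cstar c = c" by (simp add: c_def cstar_diff cstar_scaleR a)
    ultimately obtain s where s: "s * s = 1 - c" "cstar s = s" "norm (1 - s) \<le> 1"
      "\<And>x. x * c = c * x \<Longrightarrow> x * s = s * x"
      using exists_sqrt_one_minus by metis
    have "spectrally_nonneg s" using s(2,3) by (intro spectrally_nonnegI[of _ 1]) simp_all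
    then have "spectrally_nonneg (sqrt t *\<^sub>R s)" using t(1) by (simp add: spectrally_nonneg_scaleR)
    moreover have "(sqrt t *\<^sub>R s) * (sqrt t *\<^sub>R s) = a"
      using s(1) tp by (simp add: c_def del: right_diff_distrib left_diff_distrib)
    moreover have "x * (sqrt t *\<^sub>R s) = (sqrt t *\<^sub>R s) * x" if "x * a = a * x" for x
    proof -
      have "x * c = c * x" unfolding c_def right_diff_distrib left_diff_distrib by (simp add: that)
      then show ?thesis by (simp add: s(4))
    qed
    moreover have "cstar (sqrt t *\<^sub>R s) = sqrt t *\<^sub>R s" by (simp add: cstar_scaleR s(2))
    ultimately show ?thesis using that by blast
  qed
qed

text \<open>The root k of 1 - a a commutes with a, and k k + a a = 1 makes k + i a unitary, whence
  norm k \<le> 1.\<close>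

lemma norm_one_minus_square_le:
  fixes a :: "'a::{cstar_algebra,real_normed_algebra_1}"
  assumes "cstar a = a" "norm a \<le> 1"
  shows "norm (1 - a * a) \<le> 1"
proof -
  have "norm (a * a) \<le> 1"
    using cstar_identity[of a] assms by (simp add: power_le_one)
  then obtain k where k: "k * k = 1 - a * a" "cstar k = k" "\<And>x. x * (a * a) = (a * a) * x \<Longrightarrow> x * k = k * x"
    using exists_sqrt_one_minus[of "a * a"] assms(1) by (metis cstar_mult)
  have "norm k \<le> 1"
    by (rule norm_le_1_if_sum_squares_1[of k a]) (use k assms in \<open>auto simp: k(3) mult.assoc\<close>)
  then show ?thesis
    using k(1,2) cstar_identity[of k] by (simp add: power_le_one)
qed

lemma norm_of_real_minus_square_le:
  fixes a :: "'a::{cstar_algebra,real_normed_algebra_1}"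
  assumes "cstar a = a" "norm a ^ 2 \<le> t"
  shows "norm (of_real t - a * a) \<le> t"
proof (cases "t = 0")
  case False
  with assms(2) have t: "t > 0" by (smt (verit) zero_le_power2)
  define b where "b = (1 / sqrt t) *\<^sub>R a"
  have "norm a \<le> sqrt t" using assms(2) by (rule real_le_rsqrt)
  then have "norm b \<le> 1" using t by (simp add: b_def)
  then have "norm (1 - b * b) \<le> 1"
    by (intro norm_one_minus_square_le) (simp_all add: b_def cstar_scaleR assms(1))
  moreover have "of_real t - a * a = t *\<^sub>R (1 - b * b)"
    using t by (simp add: b_def scaleR_diff_right of_real_def)
  ultimately show ?thesis using t by (simp add: mult_le_cancel_left1)
qed (use assms in simp)

lemma spectrally_nonneg_square: "cstar a = a \<Longrightarrow> spectrally_nonneg (a * a)"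
  by (rule spectrally_nonnegI[of _ "norm a ^ 2"])
    (use norm_of_real_minus_square_le[of a "norm a ^ 2"] in \<open>auto simp: cstar_mult\<close>)

text \<open>The definition only provides some threshold. That every t above the norm is one allows a
  common threshold for the terms of a sequence.\<close>

lemma spectrally_nonneg_norm:
  assumes "spectrally_nonneg a" "norm a \<le> t"
  shows "norm (of_real t - a) \<le> t"
proof -
  obtain h where "h * h = a" "cstar h = h" using spectrally_nonneg_sqrt[OF assms(1)] by metis
  then show ?thesis
    using norm_of_real_minus_square_le[of h t] cstar_identity[of h] assms(2) by simp
qed

text \<open>Let f and g be commuting self-adjoint roots of a and - a. Then f + i g vanishes by the
  C*-identity, and so does its adjoint f - i g.\<close>

lemma spectrally_nonneg_antisym:
  assumes "spectrally_nonneg a" "spectrally_nonneg (- a)"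
  shows "a = 0"
proof -
  obtain f where f: "f * f = a" "cstar f = f" "\<And>x. x * a = a * x \<Longrightarrow> x * f = f * x"
    using spectrally_nonneg_sqrt[OF assms(1)] by metis
  obtain g where g: "g * g = - a" "cstar g = g" "\<And>x. x * (- a) = (- a) * x \<Longrightarrow> x * g = g * x"
    using spectrally_nonneg_sqrt[OF assms(2)] by metis
  have "g * f = f * g"
    by (rule f(3)) (use g(1) in \<open>metis minus_minus mult.assoc mult_minus_left mult_minus_right\<close>)
  then have "cstar (f + cscale \<i> g) * (f + cscale \<i> g) = f * f + g * g"
    by (simp add: algebra_simps cstar_add cstar_cscale f(2) g(2) cscale_simps)
  also have "\<dots> = 0" by (simp add: f(1) g(1))
  finally have "f + cscale \<i> g = 0" by (rule cstar_mult_self_eq_0)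
  then have e: "f = - cscale \<i> g" by (simp add: eq_neg_iff_add_eq_0)
  then have "f = cscale \<i> g"
    using f(2) g(2) by (metis cnj.simps complex_cnj_i cscale_minus_left cstar_cscale cstar_minus minus_minus)
  with e have "f = - f" by simp
  then have "2 *\<^sub>R f = 0" by (simp add: scaleR_2 eq_neg_iff_add_eq_0)
  then show ?thesis using f(1) by simp
qed

text \<open>The growth rate of \<open>(t + d d\<^sup>*)\<^sup>n = t\<^sup>n + d S\<^sub>n d\<^sup>*\<close> is read off from that of \<open>t + d\<^sup>* d\<close>.\<close>

lemma spectrally_nonneg_minus_swap:
  fixes d :: "'a::{cstar_algebra,real_normed_algebra_1}"
  assumes "spectrally_nonneg (- (cstar d * d))"
  shows "spectrally_nonneg (- (d * cstar d))"
proof -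
  \<comment> \<open>The square of \<open>norm d\<close> is the norm of \<open>cstar d * d\<close>,
    so the hypothesis yields norm y \<le> t; the summand 1 keeps t away from 0.\<close>
  define t where "t = (norm d)\<^sup>2 + 1"
  have t1: "t \<ge> 1" by (simp add: t_def)
  define x where "x = of_real t + d * cstar d"
  define y where "y = of_real t + cstar d * d"
  have ny: "norm y \<le> t"
    using spectrally_nonneg_norm[OF assms, of t] by (simp add: y_def t_def cstar_identity)
  \<comment> \<open>Since \<open>cstar d * x = y * cstar d\<close>, multiplication by x replaces S
    by t^n + S y. The norm of S therefore grows like n t^(n-1).\<close>
  have "\<exists>S. x ^ n = of_real (t ^ n) + d * S * cstar d \<and> t * norm S \<le> real n * t ^ n" for n
  proof (induction n)
    case 0
    show ?case by (rule exI[of _ 0]) simp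
  next
    case (Suc n)
    then obtain S where S: "x ^ n = of_real (t ^ n) + d * S * cstar d" "t * norm S \<le> real n * t ^ n"
      by blast
    define S' where "S' = of_real (t ^ n) + S * y"
    have "x ^ Suc n = (of_real (t ^ n) + d * S * cstar d) * x"
      by (simp add: power_Suc2 S(1) del: power_Suc)
    also have "\<dots> = of_real (t ^ Suc n) + d * S' * cstar d"
      by (simp add: x_def S'_def y_def of_real_def algebra_simps)
    finally have "x ^ Suc n = of_real (t ^ Suc n) + d * S' * cstar d" .
    moreover have "t * norm S' \<le> real (Suc n) * t ^ Suc n"
    proof -
      have "norm S' \<le> t ^ n + norm S * t"
      proof -
        have "norm S' \<le> norm (of_real (t ^ n) :: 'a) + norm (S * y)"
          unfolding S'_def by (rule norm_triangle_ineq)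
        moreover have "norm (S * y) \<le> norm S * t"
          using ny by (meson mult_left_mono norm_ge_zero norm_mult_ineq order_trans)
        moreover have "norm (of_real (t ^ n) :: 'a) = t ^ n" using t1 unfolding norm_of_real by simp
        ultimately show ?thesis by linarith
      qed
      then have "t * norm S' \<le> t * (t ^ n + norm S * t)" using t1 by (intro mult_left_mono) auto
      also have "\<dots> = t ^ Suc n + t * (t * norm S)" by (simp add: algebra_simps)
      also have "\<dots> \<le> t ^ Suc n + t * (real n * t ^ n)" using S(2) t1 by (intro add_left_mono mult_left_mono) auto
      finally show ?thesis by (simp add: algebra_simps)
    qed
    ultimately show ?case by blast
  qed
  then have bound: "norm (x ^ n) \<le> t ^ n * (1 + real n * (norm d)\<^sup>2)" for n
  proof -
    from \<open>\<And>n. \<exists>S. _ n S\<close> obtain S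
      where S: "x ^ n = of_real (t ^ n) + d * S * cstar d" "t * norm S \<le> real n * t ^ n" by blast
    have "norm S \<le> t * norm S" using t1 by (simp add: mult_le_cancel_right1)
    then have nS: "norm S \<le> real n * t ^ n" using S(2) by linarith
    have "norm (x ^ n) \<le> norm (of_real (t ^ n) :: 'a) + norm (d * S * cstar d)"
      unfolding S(1) by (rule norm_triangle_ineq)
    also have "norm (of_real (t ^ n) :: 'a) = t ^ n" using t1 unfolding norm_of_real by simp
    also have "norm (d * S * cstar d) \<le> norm d * norm S * norm d"
      by (metis norm_cstar norm_mult_ineq norm_ge_zero mult_right_mono order_trans)
    also have "\<dots> \<le> norm d * (real n * t ^ n) * norm d"
      using nS by (intro mult_right_mono mult_left_mono) auto
    finally show ?thesis by (simp add: algebra_simps power2_eq_square)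
  qed
  have cx: "cstar x = x" by (simp add: x_def cstar_add cstar_mult cstar_cstar)
  \<comment> \<open>For the self-adjoint x these powers have exactly the expected norm, so a factor
    in the upper bound that is linear in the exponent cannot raise the growth rate.\<close>
  have pow2: "norm (x ^ (2 ^ k)) = norm x ^ (2 ^ k)" for k :: nat
  proof (induction k)
    case (Suc k)
    have "x ^ (2 ^ Suc k) = cstar (x ^ (2 ^ k)) * x ^ (2 ^ k)"
      by (simp add: cstar_power cx mult_2 power_add)
    then show ?case using cstar_identity[of "x ^ (2 ^ k)"] Suc
      by (metis power_even_eq power_Suc power_mult mult.commute)
  qed simp
  have "norm x \<le> t"
  proof (rule ccontr)
    assume "\<not> norm x \<le> t"
    define \<delta> where "\<delta> = norm x / t - 1"
    define D where "D = (norm d)\<^sup>2"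
    have \<delta>: "\<delta> > 0" using \<open>\<not> norm x \<le> t\<close> t1 by (simp add: \<delta>_def)
    have nx: "norm x = t * (1 + \<delta>)" using t1 by (simp add: \<delta>_def)
    \<comment> \<open>Exponent 2 m is used because Bernoulli's inequality for m, once squared, is
      quadratic in m, whereas the upper bound for 2 m is linear in m.\<close>
    have key: "2 ^ k * \<delta>\<^sup>2 \<le> 2 * D" for k :: nat
    proof -
      define m :: nat where "m = 2 ^ k"
      have m: "m > 0" by (simp add: m_def)
      have "t ^ (2 * m) * (1 + \<delta>) ^ (2 * m) \<le> t ^ (2 * m) * (1 + real (2 * m) * D)"
        using pow2[of "Suc k"] bound[of "2 ^ Suc k"] by (simp add: nx power_mult_distrib m_def D_def)
      then have "(1 + \<delta>) ^ (2 * m) \<le> 1 + real (2 * m) * D" using t1 by simp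
      moreover have "(1 + \<delta>) ^ (2 * m) = ((1 + \<delta>) ^ m)\<^sup>2" by (simp add: power_even_eq)
      moreover have "1 + real m * \<delta> \<le> (1 + \<delta>) ^ m" using \<delta> by (intro Bernoulli_inequality) auto
      then have "(1 + real m * \<delta>)\<^sup>2 \<le> ((1 + \<delta>) ^ m)\<^sup>2" using \<delta> by (intro power_mono) auto
      ultimately have "(1 + real m * \<delta>)\<^sup>2 \<le> 1 + real (2 * m) * D" by linarith
      moreover have "(1 + real m * \<delta>)\<^sup>2 = 1 + 2 * (real m * \<delta>) + real m * (real m * \<delta>\<^sup>2)"
        by (simp add: power2_eq_square algebra_simps)
      moreover have "real m * \<delta> \<ge> 0" using \<delta> by simp
      ultimately have "real m * (real m * \<delta>\<^sup>2) \<le> real m * (2 * D)" by simp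
      then have "real m * \<delta>\<^sup>2 \<le> 2 * D" using m by simp
      then show ?thesis by (simp add: m_def)
    qed
    obtain k :: nat where "2 * D / \<delta>\<^sup>2 < 2 ^ k"
      using real_arch_pow[of 2 "2 * D / \<delta>\<^sup>2"] by auto
    with key[of k] \<delta> show False by (simp add: field_simps)
  qed
  then show ?thesis
    using t1 by (intro spectrally_nonnegI[of _ t]) (auto simp: x_def cstar_minus cstar_mult cstar_cstar)
qed

text \<open>Kelley and Vaught: with \<open>d = b a\<^sub>-\<close>, both \<open>d\<^sup>* d\<close> and \<open>d d\<^sup>*\<close> are negative, while their sum
  is a sum of squares.\<close>

lemma spectrally_nonneg_cstar_mult_self:
  fixes b :: "'a::{cstar_algebra,real_normed_algebra_1}"
  shows "spectrally_nonneg (cstar b * b)"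
proof -
  define a where "a = cstar b * b"
  have a: "cstar a = a" by (simp add: a_def cstar_mult cstar_cstar)
  \<comment> \<open>h is the absolute value of a, and m = h - a below is twice the negative
    part.\<close>
  obtain h where h: "h * h = a * a" "cstar h = h" "spectrally_nonneg h"
    "\<And>x. x * (a * a) = (a * a) * x \<Longrightarrow> x * h = h * x"
    using spectrally_nonneg_sqrt[OF spectrally_nonneg_square[OF a]] by metis
  have ah: "a * h = h * a" by (rule h(4)) (simp add: mult.assoc)
  \<comment> \<open>The root k of h exhibits m h m as the square e of the self-adjoint element k
    m.\<close>
  obtain k where k: "k * k = h" "cstar k = k" "\<And>x. x * h = h * x \<Longrightarrow> x * k = k * x"
    using spectrally_nonneg_sqrt[OF h(3)] by metis
  have ak: "a * k = k * a" and hk: "h * k = k * h" using k(3) ah by auto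
  define m where "m = h - a"
  have m: "cstar m = m" by (simp add: m_def cstar_diff h a)
  have am: "a * m = - (h * m)" by (simp add: m_def algebra_simps h(1) ah)
  have km: "k * m = m * k" by (simp add: m_def algebra_simps ak hk)
  have hm: "h * m = m * h" by (simp add: m_def algebra_simps ah)
  define d where "d = b * m"
  define e where "e = (k * m) * (k * m)"
  have ckm: "cstar (k * m) = k * m" by (simp add: cstar_mult m k(2) km)
  have dd: "cstar d * d = - e"
  proof -
    have "cstar d * d = m * (a * m)" by (simp add: d_def a_def cstar_mult m mult.assoc)
    also have "\<dots> = - (m * (h * m))" by (simp add: am)
    also have "m * (h * m) = e"
      by (simp add: e_def flip: k(1)) (metis km mult.assoc)
    finally show ?thesis .
  qed
  have e: "spectrally_nonneg e" unfolding e_def by (rule spectrally_nonneg_square[OF ckm])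
  then have "spectrally_nonneg (- (cstar d * d))" by (simp add: dd)
  then have e': "spectrally_nonneg (- (d * cstar d))" by (rule spectrally_nonneg_minus_swap)
  \<comment> \<open>Up to a factor 2 and a sign, these are the real and imaginary parts of
    d.\<close>
  define x y where "x = d + cstar d" and "y = cscale \<i> (d - cstar d)"
  have "cstar x = x" by (simp add: x_def cstar_add cstar_cstar add.commute)
  moreover have "cstar y = y"
    by (simp add: y_def cstar_cscale cstar_diff cstar_cstar cscale_diff_right cscale_minus_left)
  ultimately have "spectrally_nonneg (x * x + y * y)"
    by (intro spectrally_nonneg_add spectrally_nonneg_square)
  moreover have "x * x + y * y = 2 *\<^sub>R (cstar d * d + d * cstar d)"
    by (simp add: x_def y_def cscale_simps algebra_simps scaleR_2)
  ultimately have "spectrally_nonneg (2 *\<^sub>R (cstar d * d + d * cstar d))" by simp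
  then have "spectrally_nonneg ((1/2) *\<^sub>R (2 *\<^sub>R (cstar d * d + d * cstar d)))"
    by (rule spectrally_nonneg_scaleR) simp
  then have "spectrally_nonneg (d * cstar d - e)" by (simp add: dd)
  from spectrally_nonneg_add[OF this e'] have "spectrally_nonneg (- e)" by simp
  with e have "e = 0" by (rule spectrally_nonneg_antisym)
  \<comment> \<open>From k m = 0 follow h m = 0 and a m = - h m = 0, hence m m = (h - a) m =
    0.\<close>
  then have "cstar (k * m) * (k * m) = 0" unfolding ckm by (simp add: e_def)
  then have "k * m = 0" by (rule cstar_mult_self_eq_0)
  then have "h * m = 0" by (metis k(1) mult.assoc mult_zero_right)
  then have "m * m = 0" using am by (simp add: m_def left_diff_distrib)
  then have "m = 0" using cstar_mult_self_eq_0[of m] m by simp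
  then have "a = h" by (simp add: m_def)
  then show ?thesis using h(3) by (simp add: a_def)
qed

lemma positive_iff_spectrally_nonneg: "positive a \<longleftrightarrow> spectrally_nonneg a"
  unfolding positive_def
  using spectrally_nonneg_cstar_mult_self spectrally_nonneg_sqrt by metis

lemma exists_inverse_one_minus:
  fixes c :: "'a::{banach,real_normed_algebra_1}"
  assumes "norm c < 1"
  obtains w where "w * (1 - c) = 1" "(1 - c) * w = 1"
proof
  have "summable (\<lambda>n. norm (c ^ n))"
    by (rule summable_comparison_test[OF _ summable_geometric[of "norm c"]])
      (use assms norm_power_ineq[of c] in auto)
  then have s: "summable (\<lambda>n. c ^ n)" by (rule summable_norm_cancel)
  define w where "w = (\<Sum>n. c ^ n)"
  have "w = 1 + (\<Sum>n. c ^ Suc n)"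
    unfolding w_def using suminf_split_head[OF s] by simp
  moreover have "(\<Sum>n. c ^ Suc n) = c * w"
    unfolding w_def using suminf_mult[OF s, of c] by simp
  moreover have "(\<Sum>n. c ^ Suc n) = w * c"
    unfolding w_def using suminf_mult2[OF s, of c] by (simp add: power_commutes)
  ultimately show "w * (1 - c) = 1" "(1 - c) * w = 1"
    by (simp_all add: algebra_simps)
qed

text \<open>Commuting roots h of x and k of 1 - x satisfy h h + k k = 1, so h + i k is
  unitary.\<close>

lemma spectrally_nonneg_norm_le_1:
  assumes "spectrally_nonneg x" "spectrally_nonneg (1 - x)"
  shows "norm x \<le> 1"
proof -
  obtain h where h: "h * h = x" "cstar h = h" "\<And>y. y * x = x * y \<Longrightarrow> y * h = h * y"
    using spectrally_nonneg_sqrt[OF assms(1)] by metis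
  obtain k where k: "k * k = 1 - x" "cstar k = k" "\<And>y. y * (1 - x) = (1 - x) * y \<Longrightarrow> y * k = k * y"
    using spectrally_nonneg_sqrt[OF assms(2)] by metis
  have "h * k = k * h"
    by (rule k(3)) (simp add: right_diff_distrib left_diff_distrib mult.assoc flip: h(1))
  then have "norm h \<le> 1"
    by (intro norm_le_1_if_sum_squares_1[of h k]) (use h(1,2) k(1,2) in auto)
  then show ?thesis using cstar_identity[of h] h(1,2) by (simp add: power_le_one)
qed

lemma positive_one_minus:
  fixes x :: "'a::{cstar_algebra,real_normed_algebra_1}"
  assumes "cstar x = x" "norm x \<le> t"
  shows "positive (of_real t - x)"
proof -
  have "0 \<le> t" using assms(2) norm_ge_zero order_trans by blast
  then show ?thesis
    unfolding positive_iff_spectrally_nonneg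
    by (intro spectrally_nonnegI[of _ t]) (auto simp: cstar_diff assms)
qed

text \<open>With T = norm p + \<epsilon>, the shifted element is T (1 - c) for some c of norm at
  most norm p / T < 1, so a Neumann series inverts it. The inverse w is positive, and v is a root of
  w.\<close>

lemma exists_inverse_sqrt:
  fixes p :: "'a::{cstar_algebra,real_normed_algebra_1}"
  assumes "positive p" "\<epsilon> > 0"
  obtains v where "cstar v = v" "v * p = p * v"
    "(v * v) * (p + of_real \<epsilon>) = 1" "(p + of_real \<epsilon>) * (v * v) = 1"
proof -
  have p: "spectrally_nonneg p" using assms(1) by (simp add: positive_iff_spectrally_nonneg)
  then have cp: "cstar p = p" by (simp add: spectrally_nonneg_def)
  define P where "P = p + of_real \<epsilon>"
  have "spectrally_nonneg (of_real \<epsilon> :: 'a)"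
    by (rule spectrally_nonnegI[of _ \<epsilon>]) (use assms in auto)
  then have P: "spectrally_nonneg P" unfolding P_def using p by (intro spectrally_nonneg_add)
  obtain g where g: "g * g = P" "cstar g = g" using spectrally_nonneg_sqrt[OF P] by metis
  define T where "T = norm p + \<epsilon>"
  have T: "T > 0" using assms(2) by (simp add: T_def add_nonneg_pos)
  define c where "c = (1/T) *\<^sub>R (of_real (norm p) - p)"
  have "norm (of_real (norm p) - p) \<le> norm p" using spectrally_nonneg_norm[OF p] by simp
  then have "norm c \<le> norm p / T" using T by (simp add: c_def divide_right_mono)
  also have "\<dots> < 1" using T assms(2) by (simp add: T_def)
  finally obtain w0 where w0: "w0 * (1 - c) = 1" "(1 - c) * w0 = 1"
    using exists_inverse_one_minus by metis
  have "P = T *\<^sub>R (1 - c)"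
    using T by (simp add: c_def P_def scaleR_diff_right) (simp add: T_def of_real_def scaleR_add_left)
  then have "(1/T) *\<^sub>R w0 * P = 1" "P * ((1/T) *\<^sub>R w0) = 1"
    using w0 T by simp_all
  then obtain w where w: "w * P = 1" "P * w = 1" by blast
  have cP: "cstar P = P" by (simp add: P_def cstar_add cp)
  have "cstar w * P = 1" by (metis cP cstar_mult cstar_one w(2))
  then have cw: "cstar w = w" by (metis mult.assoc mult_1_left mult_1_right w(2))
  \<comment> \<open>Positivity of the inverse: w = w P w with P = g g.\<close>
  have "w = cstar (g * w) * (g * w)"
  proof -
    have "cstar (g * w) * (g * w) = w * (g * g) * w" by (simp add: cstar_mult cw g(2) mult.assoc)
    then show ?thesis by (simp add: g(1) w)
  qed
  then have "spectrally_nonneg w" using spectrally_nonneg_cstar_mult_self by metis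
  then obtain v where v: "v * v = w" "cstar v = v" "\<And>x. x * w = w * x \<Longrightarrow> x * v = v * x"
    using spectrally_nonneg_sqrt by metis
  have "p * P = P * p" by (simp add: P_def algebra_simps of_real_def)
  then have "p * w = w * p" by (metis mult.assoc mult_1_left mult_1_right w)
  then have "p * v = v * p" by (rule v(3))
  then show ?thesis using that[of v] v(1,2) w by (simp add: P_def)
qed

text \<open>A convergent sequence is bounded, so one threshold serves all of its terms and passes to
  the limit.\<close>

lemma spectrally_nonneg_limit:
  fixes a :: "nat \<Rightarrow> 'a::{cstar_algebra,real_normed_algebra_1}"
  assumes "\<And>n. spectrally_nonneg (a n)" "a \<longlonglongrightarrow> l"
  shows "spectrally_nonneg l"
proof -
  have "Bseq a" using assms(2) by (simp add: convergent_imp_Bseq convergentI)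
  then obtain t where t: "t > 0" "\<And>n. norm (a n) \<le> t" by (auto simp: Bseq_def)
  have "(\<lambda>n. norm (of_real t - a n)) \<longlonglongrightarrow> norm (of_real t - l)"
    by (intro tendsto_intros assms(2))
  then have "norm (of_real t - l) \<le> t"
    by (rule LIMSEQ_le_const2) (use spectrally_nonneg_norm[OF assms(1) t(2)] in auto)
  moreover have "(\<lambda>n. cstar (a n)) \<longlonglongrightarrow> cstar l"
    by (rule bounded_linear.tendsto[OF bounded_linear_cstar assms(2)])
  then have "a \<longlonglongrightarrow> cstar l" using assms(1) by (simp add: spectrally_nonneg_def)
  then have "cstar l = l" using assms(2) LIMSEQ_unique by blast
  ultimately show ?thesis using t(1) by (intro spectrally_nonnegI[of _ t]) auto
qed


section \<open>The unitization\<close>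

datatype 'a unitization = Unitization (scalar_part: complex) (algebra_part: 'a)

text \<open>Left multiplication by the formal sum \<lambda> + a on the algebra, which is an ideal of
  its unitization. Its operator norm is one half of the norm defined below.\<close>

definition unitization_act :: "'a::cstar_algebra unitization \<Rightarrow> 'a \<Rightarrow> 'a"
  where "unitization_act u x = cscale (scalar_part u) x + algebra_part u * x"

lemma bounded_linear_unitization_act: "bounded_linear (unitization_act u)"
proof (rule bounded_linear_intro[where K = "cmod (scalar_part u) + norm (algebra_part u)"])
  show "norm (unitization_act u x) \<le> norm x * (cmod (scalar_part u) + norm (algebra_part u))" for x
    unfolding unitization_act_def distrib_left
    by (intro order.trans[OF norm_triangle_ineq] add_mono)
      (auto simp: norm_cscale mult.commute intro: order.trans[OF norm_mult_ineq])
qed (auto simp: unitization_act_def cscale_add_right cscale_scaleR algebra_simps)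

instantiation unitization :: (cstar_algebra) real_algebra_1
begin

definition zero_unitization :: "'a unitization" where "0 = Unitization 0 0"
definition one_unitization :: "'a unitization" where "1 = Unitization 1 0"
definition plus_unitization :: "'a unitization \<Rightarrow> 'a unitization \<Rightarrow> 'a unitization"
  where "u + v = Unitization (scalar_part u + scalar_part v) (algebra_part u + algebra_part v)"
definition minus_unitization :: "'a unitization \<Rightarrow> 'a unitization \<Rightarrow> 'a unitization"
  where "u - v = Unitization (scalar_part u - scalar_part v) (algebra_part u - algebra_part v)"
definition uminus_unitization :: "'a unitization \<Rightarrow> 'a unitization"
  where "- u = Unitization (- scalar_part u) (- algebra_part u)"
definition times_unitization :: "'a unitization \<Rightarrow> 'a unitization \<Rightarrow> 'a unitization"
  where "u * v = Unitization (scalar_part u * scalar_part v)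
    (cscale (scalar_part u) (algebra_part v) + cscale (scalar_part v) (algebra_part u)
      + algebra_part u * algebra_part v)"
definition scaleR_unitization :: "real \<Rightarrow> 'a unitization \<Rightarrow> 'a unitization"
  where "t *\<^sub>R u = Unitization (t *\<^sub>R scalar_part u) (t *\<^sub>R algebra_part u)"
lemmas unitization_ops = zero_unitization_def one_unitization_def plus_unitization_def
  minus_unitization_def uminus_unitization_def times_unitization_def scaleR_unitization_def

instance
proof
  fix u v w :: "'a unitization" and s t :: real
  show "u + v + w = u + (v + w)" "u + v = v + u" "0 + u = u" "- u + u = 0" "u - v = u + - v"
    "s *\<^sub>R (u + v) = s *\<^sub>R u + s *\<^sub>R v" "(s + t) *\<^sub>R u = s *\<^sub>R u + t *\<^sub>R u" "s *\<^sub>R t *\<^sub>R u = (s * t) *\<^sub>R u"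
    "1 *\<^sub>R u = u" "(0 :: 'a unitization) \<noteq> 1"
    by (simp_all add: unitization_ops algebra_simps)
  show "u * v * w = u * (v * w)" "(u + v) * w = u * w + v * w" "u * (v + w) = u * v + u * w"
    "1 * u = u" "u * 1 = u"
    by (simp_all add: unitization_ops cscale_simps cscale_add_left algebra_simps)
  have "cscale (s *\<^sub>R c) x = s *\<^sub>R cscale c x" for c and x :: 'a
    by (simp add: scaleR_eq_cscale cscale_cscale scaleR_conv_of_real)
  then show "s *\<^sub>R u * v = s *\<^sub>R (u * v)" "u * s *\<^sub>R v = s *\<^sub>R (u * v)"
    by (simp_all add: unitization_ops cscale_scaleR scaleR_add_right)
qed

end

lemma unitization_act_add: "unitization_act (u + v) x = unitization_act u x + unitization_act v x"
  by (simp add: unitization_act_def unitization_ops cscale_add_left algebra_simps)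

lemma unitization_act_mult: "unitization_act (u * v) x = unitization_act u (unitization_act v x)"
  by (simp add: unitization_act_def unitization_ops cscale_simps algebra_simps)

lemma unitization_act_scaleR: "unitization_act (t *\<^sub>R u) x = t *\<^sub>R unitization_act u x"
  by (simp add: unitization_act_def unitization_ops cscale_simps scaleR_eq_cscale
      scaleR_conv_of_real)

lemma norm_unitization_act: "norm (unitization_act u x) \<le> onorm (unitization_act u) * norm x"
  by (rule onorm[OF bounded_linear_unitization_act])

lemma onorm_unitization_act_nonneg: "0 \<le> onorm (unitization_act u)"
  by (rule onorm_pos_le[OF bounded_linear_unitization_act])

lemma onorm_unitization_act_mult:
  "onorm (unitization_act (u * v)) \<le> onorm (unitization_act u) * onorm (unitization_act v)"
  using onorm_compose[OF bounded_linear_unitization_act bounded_linear_unitization_act, of u v]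
  by (simp add: unitization_act_mult[abs_def] comp_def)

text \<open>If \<open>'a\<close> has a unit, then the operator norm alone is only a seminorm.\<close>

instantiation unitization :: (cstar_algebra) real_normed_algebra_1
begin

definition norm_unitization :: "'a unitization \<Rightarrow> real"
  where "norm_unitization u = max (cmod (scalar_part u)) (onorm (unitization_act u))"
definition dist_unitization :: "'a unitization \<Rightarrow> 'a unitization \<Rightarrow> real"
  where "dist_unitization u v = norm (u - v)"
definition sgn_unitization :: "'a unitization \<Rightarrow> 'a unitization"
  where "sgn_unitization u = u /\<^sub>R norm u"
definition uniformity_unitization :: "('a unitization \<times> 'a unitization) filter"
  where "uniformity_unitization = (INF e\<in>{0<..}. principal {(u, v :: 'a unitization). dist u v < e})"
definition open_unitization :: "'a unitization set \<Rightarrow> bool"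
  where "open_unitization U \<longleftrightarrow>
    (\<forall>u\<in>U. eventually (\<lambda>(u', v). u' = u \<longrightarrow> v \<in> U) uniformity)"

text \<open>Evaluate the action of u at the adjoint of its algebra part a. The operator norm and the
  scalar each contribute at most norm u, hence the 2. This gives definiteness of the norm and
  completeness.\<close>

lemma norm_algebra_part_le: "norm (algebra_part u) \<le> 2 * norm u" for u :: "'a unitization"
proof -
  let ?a = "algebra_part u"
  have "(norm ?a)\<^sup>2 = norm (?a * cstar ?a)" by (simp add: norm_mult_cstar)
  also have "?a * cstar ?a = unitization_act u (cstar ?a) - cscale (scalar_part u) (cstar ?a)"
    by (simp add: unitization_act_def)
  also have "norm \<dots> \<le> norm (unitization_act u (cstar ?a)) + norm (cscale (scalar_part u) (cstar ?a))"
    by (rule norm_triangle_ineq4)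
  also have "\<dots> \<le> norm u * norm ?a + norm u * norm ?a"
    unfolding norm_cscale norm_cstar
    by (intro add_mono mult_right_mono order.trans[OF norm_unitization_act])
      (auto simp: norm_unitization_def intro: mult_right_mono)
  finally have "norm ?a * norm ?a \<le> (2 * norm u) * norm ?a" by (simp add: power2_eq_square)
  moreover have "norm u \<ge> 0" by (simp add: norm_unitization_def le_max_iff_disj)
  ultimately show ?thesis by (cases "norm ?a = 0") auto
qed

lemma norm_unitization_le: "norm u \<le> cmod (scalar_part u) + norm (algebra_part u)"
proof -
  have "onorm (unitization_act u) \<le> cmod (scalar_part u) + norm (algebra_part u)"
    by (rule onorm_bound)
      (auto simp: unitization_act_def distrib_right norm_cscale
        intro!: order.trans[OF norm_triangle_ineq] add_mono norm_mult_ineq)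
  then show ?thesis by (simp add: norm_unitization_def)
qed

instance
proof
  fix u v w :: "'a unitization" and s :: real
  show "sgn u = u /\<^sub>R norm u" by (rule sgn_unitization_def)
  show "dist u v = norm (u - v)" by (rule dist_unitization_def)
  show "uniformity = (INF e\<in>{0<..}. principal {(u, v :: 'a unitization). dist u v < e})"
    by (rule uniformity_unitization_def)
  show "open U \<longleftrightarrow> (\<forall>u\<in>U. eventually (\<lambda>(u', v). u' = u \<longrightarrow> v \<in> U) uniformity)"
    for U :: "'a unitization set"
    by (rule open_unitization_def)
  show "norm (s *\<^sub>R u) = \<bar>s\<bar> * norm u"
    using onorm_scaleR[OF bounded_linear_unitization_act, of s u]
    by (simp add: norm_unitization_def unitization_act_scaleR[abs_def] max_mult_distrib_left)
      (simp add: scaleR_unitization_def)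
  show "norm (u + v) \<le> norm u + norm v"
  proof -
    have "onorm (unitization_act (u + v)) \<le> onorm (unitization_act u) + onorm (unitization_act v)"
      using onorm_triangle[OF bounded_linear_unitization_act bounded_linear_unitization_act, of u v]
      by (simp add: unitization_act_add[abs_def])
    moreover have "cmod (scalar_part (u + v)) \<le> cmod (scalar_part u) + cmod (scalar_part v)"
      by (simp add: unitization_ops norm_triangle_ineq)
    ultimately show ?thesis unfolding norm_unitization_def by linarith
  qed
  show "norm u = 0 \<longleftrightarrow> u = 0"
  proof
    assume u: "norm u = 0"
    have "cmod (scalar_part u) \<le> norm u" by (simp add: norm_unitization_def)
    with u have "scalar_part u = 0" "algebra_part u = 0"
      using norm_algebra_part_le[of u] by simp_all
    then show "u = 0" by (simp add: unitization_ops unitization.expand)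
  next
    assume "u = 0"
    then show "norm u = 0"
      by (simp add: norm_unitization_def zero_unitization_def unitization_act_def[abs_def] onorm_zero)
  qed
  show "norm (u * v) \<le> norm u * norm v"
  proof -
    have "onorm (unitization_act (u * v)) \<le> norm u * norm v"
      by (rule order.trans[OF onorm_unitization_act_mult])
        (auto simp: norm_unitization_def onorm_unitization_act_nonneg le_max_iff_disj intro!: mult_mono)
    moreover have "cmod (scalar_part (u * v)) \<le> norm u * norm v"
      by (auto simp: norm_unitization_def times_unitization_def norm_mult le_max_iff_disj intro!: mult_mono)
    ultimately show ?thesis unfolding norm_unitization_def[of "u * v"] by simp
  qed
  show "norm (1 :: 'a unitization) = 1"
  proof -
    have "onorm (unitization_act (1 :: 'a unitization)) \<le> 1"
      by (rule onorm_bound) (auto simp: unitization_act_def one_unitization_def)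
    then show ?thesis by (simp add: norm_unitization_def one_unitization_def)
  qed
qed

end

instance unitization :: (cstar_algebra) banach
proof
  fix X :: "nat \<Rightarrow> 'a unitization"
  assume X: "Cauchy X"
  have diff: "norm (X m - X n) < e \<Longrightarrow> cmod (scalar_part (X m) - scalar_part (X n)) < e"
    "norm (algebra_part (X m) - algebra_part (X n)) \<le> 2 * norm (X m - X n)" for m n e
    using norm_algebra_part_le[of "X m - X n"]
    by (simp_all add: norm_unitization_def minus_unitization_def)
  have "Cauchy (\<lambda>n. scalar_part (X n))"
    using X diff(1) unfolding Cauchy_iff by meson
  then obtain l where l: "(\<lambda>n. scalar_part (X n)) \<longlonglongrightarrow> l"
    using Cauchy_convergent convergent_def by blast
  have "Cauchy (\<lambda>n. algebra_part (X n))"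
    unfolding Cauchy_iff
  proof (intro allI impI)
    fix e :: real assume "e > 0"
    then obtain M where M: "\<forall>m\<ge>M. \<forall>n\<ge>M. norm (X m - X n) < e / 2"
      using X unfolding Cauchy_iff by (meson half_gt_zero)
    have "norm (algebra_part (X m) - algebra_part (X n)) < e" if "m \<ge> M" "n \<ge> M" for m n
      using M[rule_format, OF that] diff(2)[of m n] by linarith
    then show "\<exists>M. \<forall>m\<ge>M. \<forall>n\<ge>M. norm (algebra_part (X m) - algebra_part (X n)) < e"
      by blast
  qed
  then obtain a where a: "(\<lambda>n. algebra_part (X n)) \<longlonglongrightarrow> a"
    using Cauchy_convergent convergent_def by blast
  have lim: "(\<lambda>n. cmod (scalar_part (X n) - l) + norm (algebra_part (X n) - a)) \<longlonglongrightarrow> 0"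
    by (intro tendsto_add_zero tendsto_norm_zero LIM_zero l a)
  have "\<forall>n. norm (X n - Unitization l a)
      \<le> cmod (scalar_part (X n) - l) + norm (algebra_part (X n) - a)"
    using norm_unitization_le[of "X n - Unitization l a" for n] by (simp add: minus_unitization_def)
  then have "(\<lambda>n. X n - Unitization l a) \<longlonglongrightarrow> 0"
    by (rule Lim_null_comparison[OF always_eventually lim])
  then show "convergent X" using LIM_zero_cancel convergentI by blast
qed

instantiation unitization :: (cstar_algebra) cstar_algebra
begin

definition cscale_unitization :: "complex \<Rightarrow> 'a unitization \<Rightarrow> 'a unitization"
  where "cscale c u = Unitization (c * scalar_part u) (cscale c (algebra_part u))"
definition cstar_unitization :: "'a unitization \<Rightarrow> 'a unitization"
  where "cstar u = Unitization (cnj (scalar_part u)) (cstar (algebra_part u))"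

lemmas unitization_defs = unitization_ops cscale_unitization_def cstar_unitization_def

lemma unitization_act_cscale: "unitization_act (cscale c u) x = cscale c (unitization_act u x)"
  by (simp add: unitization_act_def unitization_defs cscale_simps algebra_simps)

lemma unitization_act_cstar:
  "cstar (unitization_act u x) * y = cstar x * unitization_act (cstar u) y"
  by (simp add: unitization_act_def unitization_defs cscale_simps algebra_simps cstar_add cstar_mult
      cstar_cscale)

text \<open>By the C*-identity of the algebra, the square of the norm of
  \<open>unitization_act u x\<close> is the norm of
  \<open>cstar x * unitization_act (cstar u * u) x\<close>.\<close>

lemma onorm_unitization_act_square:
  "(onorm (unitization_act u))\<^sup>2 \<le> onorm (unitization_act (cstar u * u))"
proof -
  let ?k = "onorm (unitization_act (cstar u * u))"
  have "norm (unitization_act u x) \<le> sqrt ?k * norm x" for x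
  proof -
    have "(norm (unitization_act u x))\<^sup>2 = norm (cstar x * unitization_act (cstar u * u) x)"
      by (simp add: unitization_act_cstar unitization_act_mult flip: cstar_identity)
    also have "\<dots> \<le> norm x * (?k * norm x)"
      by (rule order.trans[OF norm_mult_ineq]) (simp add: mult_left_mono norm_unitization_act)
    also have "\<dots> = (sqrt ?k * norm x)\<^sup>2"
      by (simp add: power_mult_distrib onorm_unitization_act_nonneg) (simp add: power2_eq_square)
    finally show ?thesis
      by (rule power2_le_imp_le) (simp add: onorm_unitization_act_nonneg)
  qed
  then have "onorm (unitization_act u) \<le> sqrt ?k"
    by (intro onorm_bound) (auto simp: onorm_unitization_act_nonneg)
  then show ?thesis
    by (metis onorm_unitization_act_nonneg power_mono real_sqrt_pow2)
qed

lemma onorm_unitization_act_cstar: "onorm (unitization_act (cstar u)) = onorm (unitization_act u)"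
proof -
  have le: "onorm (unitization_act v) \<le> onorm (unitization_act (cstar v))" for v :: "'a unitization"
  proof (cases "onorm (unitization_act v) = 0")
    case True
    then show ?thesis by (simp add: onorm_unitization_act_nonneg)
  next
    case False
    have "onorm (unitization_act v) * onorm (unitization_act v)
        \<le> onorm (unitization_act (cstar v)) * onorm (unitization_act v)"
      using onorm_unitization_act_square[of v] onorm_unitization_act_mult[of "cstar v" v]
      by (simp add: power2_eq_square)
    then show ?thesis
      using False onorm_unitization_act_nonneg[of v] by simp
  qed
  have "cstar (cstar u) = u" by (simp add: unitization_defs cstar_cstar)
  then show ?thesis using le[of u] le[of "cstar u"] by simp
qed

instance
proof
  fix u v w :: "'a unitization" and s :: real and c d :: complex
  show "cscale c u * v = cscale c (u * v)" "u * cscale c v = cscale c (u * v)"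
    by (simp_all add: unitization_defs cscale_simps cscale_add_left algebra_simps)
  show "s *\<^sub>R u = cscale (complex_of_real s) u"
    by (simp add: unitization_defs scaleR_eq_cscale scaleR_conv_of_real)
  show "cscale (c + d) u = cscale c u + cscale d u" "cscale c (u + v) = cscale c u + cscale c v"
    "cscale c (cscale d u) = cscale (c * d) u"
    "cstar (cstar u) = u" "cstar (u + v) = cstar u + cstar v"
    "cstar (cscale c u) = cscale (cnj c) (cstar u)"
    by (simp_all add: unitization_defs cscale_simps cscale_add_left algebra_simps cstar_cstar
        cstar_add cstar_cscale)
  show "cstar (u * v) = cstar v * cstar u"
    by (simp add: unitization_defs cstar_cscale cstar_add cstar_mult algebra_simps)
  show "norm (cscale c u) = cmod c * norm u"
  proof -
    have "onorm (unitization_act (cscale c u)) = cmod c * onorm (unitization_act u)"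
    proof (rule antisym)
      have le: "onorm (unitization_act (cscale c u)) \<le> cmod c * onorm (unitization_act u)"
        for c and u :: "'a unitization"
        by (rule onorm_bound)
          (auto simp: unitization_act_cscale norm_cscale onorm_unitization_act_nonneg mult.assoc
            intro!: mult_left_mono norm_unitization_act)
      show "onorm (unitization_act (cscale c u)) \<le> cmod c * onorm (unitization_act u)" by (rule le)
      show "cmod c * onorm (unitization_act u) \<le> onorm (unitization_act (cscale c u))"
      proof (cases "c = 0")
        case False
        have "cscale (1 / c) (cscale c u) = u"
          using False by (simp add: unitization_defs cscale_cscale)
        then have "onorm (unitization_act u) \<le> cmod (1 / c) * onorm (unitization_act (cscale c u))"
          using le[of "1 / c" "cscale c u"] by simp
        then show ?thesis using False by (simp add: norm_divide field_simps)
      qed (simp add: onorm_unitization_act_nonneg)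
    qed
    then show ?thesis
      by (simp add: norm_unitization_def cscale_unitization_def norm_mult max_mult_distrib_left)
  qed
  show "norm (cstar u * u) = (norm u)\<^sup>2"
  proof -
    \<comment> \<open>The operator norm and the modulus of the scalar each satisfy the C*-identity,
      and their maximum inherits it.\<close>
    have "onorm (unitization_act (cstar u * u)) = (onorm (unitization_act u))\<^sup>2"
      using onorm_unitization_act_square[of u] onorm_unitization_act_mult[of "cstar u" u]
      by (simp add: onorm_unitization_act_cstar power2_eq_square)
    moreover have "cmod (scalar_part (cstar u * u)) = (cmod (scalar_part u))\<^sup>2"
      by (simp add: times_unitization_def cstar_unitization_def norm_mult power2_eq_square)
    moreover have "max (a\<^sup>2) (b\<^sup>2) = (max a b)\<^sup>2" if "a \<ge> 0" "b \<ge> 0" for a b :: real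
      using that by (cases "a \<le> b") (auto simp: max_def intro: power2_le_imp_le power_mono)
    ultimately show ?thesis
      by (simp add: norm_unitization_def onorm_unitization_act_nonneg)
  qed
qed

end

section \<open>The order of a C*-algebra\<close>

definition embed :: "'a::cstar_algebra \<Rightarrow> 'a unitization"
  where "embed a = Unitization 0 a"

lemma embed_eq_iff [simp]: "embed a = embed b \<longleftrightarrow> a = b"
  by (simp add: embed_def)

lemma embed_zero: "embed 0 = 0"
  and embed_add: "embed (a + b) = embed a + embed b"
  and embed_diff: "embed (a - b) = embed a - embed b"
  and embed_minus: "embed (- a) = - embed a"
  and embed_mult: "embed (a * b) = embed a * embed b"
  and embed_scaleR: "embed (t *\<^sub>R a) = t *\<^sub>R embed a"
  and embed_cscale: "embed (cscale c a) = cscale c (embed a)"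
  and embed_cstar: "embed (cstar a) = cstar (embed a)"
  by (simp_all add: embed_def unitization_defs)

lemmas embed_simps = embed_zero embed_add embed_diff embed_minus embed_mult embed_scaleR
  embed_cscale embed_cstar

lemma scalar_part_simps:
  "scalar_part (0 :: 'a::cstar_algebra unitization) = 0"
  "scalar_part (1 :: 'a::cstar_algebra unitization) = 1"
  "scalar_part (u + v) = scalar_part u + scalar_part v"
  "scalar_part (u - v) = scalar_part u - scalar_part v"
  "scalar_part (u * v) = scalar_part u * scalar_part v"
  "scalar_part (cstar u) = cnj (scalar_part u)"
  "scalar_part (embed a) = 0"
  for u v :: "'a::cstar_algebra unitization"
  by (simp_all add: embed_def unitization_defs)

text \<open>\<open>scalar_part\<close> is multiplicative with the embedded algebra as kernel, so
  products in the unitization are pulled back to the algebra by computing one scalar.\<close>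

lemma embedE:
  assumes "scalar_part u = 0"
  obtains a where "u = embed a"
  using assms by (cases u) (simp add: embed_def)

lemma norm_embed [simp]: "norm (embed a) = norm a"
proof (rule antisym)
  show "norm (embed a) \<le> norm a"
    using norm_unitization_le[of "embed a"] by (simp add: embed_def)
  have "norm a * norm a \<le> norm (embed a) * norm a"
  proof -
    have "norm a * norm a = norm (unitization_act (embed a) (cstar a))"
      by (simp add: unitization_act_def embed_def norm_mult_cstar power2_eq_square)
    also have "\<dots> \<le> norm (embed a) * norm a"
      by (rule order.trans[OF norm_unitization_act])
        (simp add: norm_unitization_def mult_right_mono)
    finally show ?thesis .
  qed
  then show "norm a \<le> norm (embed a)"
    by (cases "norm a = 0") auto
qed

text \<open>A root of \<open>embed a\<close> has a scalar part with square 0 and so lies in the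
  algebra already. Order questions may thus be settled in the unitization.\<close>

lemma spectrally_nonneg_embed_iff: "spectrally_nonneg (embed a) \<longleftrightarrow> positive a"
proof
  assume "positive a"
  then show "spectrally_nonneg (embed a)"
    by (auto simp: positive_def embed_simps spectrally_nonneg_cstar_mult_self)
next
  assume "spectrally_nonneg (embed a)"
  then obtain h where h: "h * h = embed a" "cstar h = h"
    using spectrally_nonneg_sqrt by metis
  then have "scalar_part (h * h) = 0" by (simp add: scalar_part_simps)
  then have "scalar_part h = 0" by (simp add: scalar_part_simps)
  then obtain b where "h = embed b" by (rule embedE)
  with h have "embed (cstar b * b) = embed a" by (simp add: embed_simps)
  then show "positive a" unfolding embed_eq_iff positive_def by metis
qed

lemma positive_embed_iff: "positive (embed a) \<longleftrightarrow> positive a"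
  by (simp add: spectrally_nonneg_embed_iff positive_iff_spectrally_nonneg)

lemma positive_cstar_mult_self: "positive (cstar b * b)"
  by (auto simp: positive_def)

lemma positive_mult_cstar_self: "positive (b * cstar b)"
  using positive_cstar_mult_self[of "cstar b"] by (simp add: cstar_cstar)

lemma positive_zero [simp]: "positive 0"
  using positive_cstar_mult_self[of 0] by simp

lemma positive_self_adjoint: "positive a \<Longrightarrow> cstar a = a"
  by (auto simp: positive_def cstar_mult cstar_cstar)

lemma positive_add: "positive a \<Longrightarrow> positive b \<Longrightarrow> positive (a + b)"
  unfolding spectrally_nonneg_embed_iff[symmetric] embed_add by (rule spectrally_nonneg_add)

lemma positive_scaleR: "positive a \<Longrightarrow> t \<ge> 0 \<Longrightarrow> positive (t *\<^sub>R a)"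
  unfolding spectrally_nonneg_embed_iff[symmetric] embed_scaleR by (rule spectrally_nonneg_scaleR)

lemma positive_sum: "(\<And>x. x \<in> F \<Longrightarrow> positive (f x)) \<Longrightarrow> positive (\<Sum>x\<in>F. f x)"
  by (induction F rule: infinite_finite_induct) (auto intro: positive_add)

lemma positive_conj: "positive p \<Longrightarrow> positive (a * p * cstar a)"
proof -
  assume "positive p"
  then obtain b where "p = cstar b * b" by (auto simp: positive_def)
  then have "a * p * cstar a = cstar (b * cstar a) * (b * cstar a)"
    by (simp add: cstar_mult cstar_cstar mult.assoc)
  then show ?thesis by (simp add: positive_cstar_mult_self)
qed

lemma positive_antisym: "positive a \<Longrightarrow> positive (- a) \<Longrightarrow> a = 0"
  using spectrally_nonneg_antisym[of "embed a"]
  by (simp add: spectrally_nonneg_embed_iff embed_zero flip: embed_minus) (simp add: embed_zero[symmetric])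

text \<open>After division by t = norm b, both a / t and 1 - a / t are positive in the
  unitization.\<close>

lemma norm_le_if_order_le:
  assumes "positive a" "positive (b - a)"
  shows "norm a \<le> norm b"
proof (cases "norm b = 0")
  case True
  with assms have "a = 0" using positive_antisym[of a] by simp
  then show ?thesis by simp
next
  case False
  define t where "t = norm b"
  have t: "t > 0" using False by (simp add: t_def)
  have b: "positive b" using positive_add[OF assms] by simp
  then have "cstar (embed b) = embed b" by (simp add: positive_self_adjoint flip: embed_cstar)
  then have "spectrally_nonneg (of_real t - embed b)"
    using positive_one_minus[of "embed b" t] by (simp add: t_def positive_iff_spectrally_nonneg)
  from spectrally_nonneg_add[OF this, of "embed (b - a)"]
  have "spectrally_nonneg (of_real t - embed a)"
    using assms(2) by (simp add: spectrally_nonneg_embed_iff) (simp add: embed_diff)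
  then have "spectrally_nonneg ((1/t) *\<^sub>R (of_real t - embed a))"
    by (rule spectrally_nonneg_scaleR) (use t in simp)
  then have "spectrally_nonneg (1 - (1/t) *\<^sub>R embed a)"
    using t by (simp add: scaleR_diff_right of_real_def)
  moreover have "spectrally_nonneg ((1/t) *\<^sub>R embed a)"
    by (rule spectrally_nonneg_scaleR) (use t assms(1) in \<open>auto simp: spectrally_nonneg_embed_iff\<close>)
  ultimately have "norm ((1/t) *\<^sub>R embed a) \<le> 1" by (rule spectrally_nonneg_norm_le_1[rotated])
  then show ?thesis using t by (simp add: t_def field_simps)
qed

lemma positive_if_shifts_positive:
  assumes "\<And>\<epsilon>. \<epsilon> > 0 \<Longrightarrow> spectrally_nonneg (a + of_real \<epsilon>)"
  shows "spectrally_nonneg a"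
proof (rule spectrally_nonneg_limit)
  show "spectrally_nonneg (a + of_real (1 / real (Suc n)))" for n
    by (rule assms) simp
  have "(\<lambda>n. a + of_real (1 / real (Suc n))) \<longlonglongrightarrow> a + of_real 0"
    by (intro tendsto_intros LIMSEQ_Suc lim_1_over_n)
  then show "(\<lambda>n. a + of_real (1 / real (Suc n))) \<longlonglongrightarrow> a" by simp
qed

text \<open>In the unitization p lies below the scalar norm p; conjugate by a.\<close>

lemma positive_norm_conj:
  assumes "positive p"
  shows "positive (norm p *\<^sub>R (a * cstar a) - a * p * cstar a)"
proof -
  have "cstar (embed p) = embed p" using assms by (simp add: positive_self_adjoint flip: embed_cstar)
  then have "positive (of_real (norm p) - embed p)"
    using positive_one_minus[of "embed p" "norm p"] by simp
  from positive_conj[OF this, of "embed a"]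
  have "positive (embed (norm p *\<^sub>R (a * cstar a) - a * p * cstar a))"
    by (simp add: embed_simps algebra_simps of_real_def)
  then show ?thesis by (simp only: positive_embed_iff)
qed

text \<open>The witness is h times the inverse of p + \<epsilon>; it lies in the algebra because h
  does.\<close>

lemma exists_shifted_quotient:
  assumes "positive p" "\<epsilon> > 0"
  shows "\<exists>c. c * p + \<epsilon> *\<^sub>R c = h"
proof -
  obtain v where v: "(v * v) * (embed p + of_real \<epsilon>) = 1"
    using exists_inverse_sqrt[of "embed p" \<epsilon>] assms by (metis positive_embed_iff)
  have "scalar_part (embed h * (v * v)) = 0" by (simp add: scalar_part_simps)
  then obtain c where c: "embed h * (v * v) = embed c" by (rule embedE)
  have "embed (c * p + \<epsilon> *\<^sub>R c) = embed c * (embed p + of_real \<epsilon>)"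
    by (simp add: embed_simps algebra_simps of_real_def)
  also have "\<dots> = embed h" unfolding c[symmetric] mult.assoc v[unfolded mult.assoc] by simp
  finally show ?thesis by auto
qed

text \<open>For \<open>c = h\<^sup>* (p + \<epsilon>)\<^sup>-\<^sup>1\<close>, the difference \<open>c h + \<epsilon> - (h + h\<^sup>* - p)\<close> is the square
  \<open>(h - (p + \<epsilon>))\<^sup>* (p + \<epsilon>)\<^sup>-\<^sup>1 (h - (p + \<epsilon>))\<close>.\<close>

lemma order_le_if_shifted_quotients_le:
  assumes "positive p"
    and "\<And>\<epsilon>. \<epsilon> > 0 \<Longrightarrow> \<exists>c. c * p + \<epsilon> *\<^sub>R c = cstar h \<and> cstar_le (c * h) u"
  shows "cstar_le (h + cstar h - p) u"
proof -
  have "spectrally_nonneg (embed (u - (h + cstar h - p)) + of_real \<epsilon>)" if \<epsilon>: "\<epsilon> > 0" for \<epsilon> :: real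
  proof -
    from assms(2)[OF \<epsilon>] obtain c where c: "c * p + \<epsilon> *\<^sub>R c = cstar h" "positive (u - c * h)"
      by (auto simp: cstar_le_def)
    define P where "P = embed p + of_real \<epsilon>"
    obtain v where v: "cstar v = v" "(v * v) * P = 1" "P * (v * v) = 1"
      using exists_inverse_sqrt[of "embed p" \<epsilon>] assms(1) \<epsilon> unfolding P_def by (metis positive_embed_iff)
    have "embed (cstar h) = embed c * P"
      by (simp add: P_def embed_simps algebra_simps of_real_def flip: c(1))
    then have ec: "embed c = cstar (embed h) * (v * v)" by (simp add: mult.assoc v embed_cstar)
    have cP: "cstar P = P"
      using assms(1) by (simp add: P_def cstar_add positive_self_adjoint flip: embed_cstar)
    define d where "d = v * (embed h - P)"
    have "cstar d * d = (cstar (embed h) - P) * ((v * v) * (embed h - P))"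
      by (simp add: d_def cstar_mult v(1) cP cstar_diff mult.assoc)
    also have "(v * v) * (embed h - P) = v * v * embed h - 1"
      by (simp add: right_diff_distrib v(2))
    also have "(cstar (embed h) - P) * (v * v * embed h - 1)
        = cstar (embed h) * (v * v) * embed h - cstar (embed h) - P * (v * v) * embed h + P"
      by (simp add: algebra_simps)
    also have "\<dots> = embed c * embed h - cstar (embed h) - embed h + P"
      by (simp add: v(3) ec)
    finally have "cstar d * d = embed c * embed h - cstar (embed h) - embed h + P" .
    then have "embed (u - (h + cstar h - p)) + of_real \<epsilon> = embed (u - c * h) + cstar d * d"
      by (simp add: P_def embed_simps algebra_simps)
    moreover have "spectrally_nonneg (embed (u - c * h))"
      using c(2) by (simp add: spectrally_nonneg_embed_iff)
    ultimately show ?thesis using spectrally_nonneg_cstar_mult_self spectrally_nonneg_add by metis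
  qed
  then show ?thesis
    unfolding cstar_le_def spectrally_nonneg_embed_iff[symmetric] by (rule positive_if_shifts_positive)
qed

text \<open>Conjugation by the inverse square root of \<open>q + \<epsilon>\<close> reduces the claim to \<open>p \<le> 1\<close>.\<close>

lemma order_le_if_norm_conj_le:
  assumes p: "positive p" and q: "positive q"
    and le: "\<And>t a. cstar a = a \<Longrightarrow> norm (t\<^sup>2 *\<^sub>R p + t *\<^sub>R (a * p + p * a) + a * p * a)
      \<le> norm (t\<^sup>2 *\<^sub>R q + t *\<^sub>R (a * q + q * a) + a * q * a)"
  shows "cstar_le p q"
proof -
  \<comment> \<open>The expression in the hypothesis is (t + a) x (t + a), multiplied out so that it
    stays in the algebra. It is used with t + a = v.\<close>
  have conj: "embed (t\<^sup>2 *\<^sub>R x + t *\<^sub>R (a * x + x * a) + a * x * a)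
      = Unitization (complex_of_real t) a * embed x * Unitization (complex_of_real t) a" for t a x
    by (simp add: embed_def unitization_defs cscale_simps algebra_simps scaleR_eq_cscale power2_eq_square)
  have "spectrally_nonneg (embed (q - p) + of_real \<epsilon>)" if \<epsilon>: "\<epsilon> > 0" for \<epsilon> :: real
  proof -
    define Q where "Q = embed q + of_real \<epsilon>"
    obtain v where v: "cstar v = v" "v * embed q = embed q * v" "(v * v) * Q = 1" "Q * (v * v) = 1"
      using exists_inverse_sqrt[of "embed q" \<epsilon>] q \<epsilon> unfolding Q_def by (metis positive_embed_iff)
    obtain z a where za: "v = Unitization z a" by (cases v)
    with v(1) have "z = complex_of_real (Re z)" "cstar a = a"
      by (auto simp: unitization_defs complex_eq_iff)
    then have va: "v = Unitization (complex_of_real (Re z)) a" "cstar a = a" using za by auto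
    have le': "norm (v * embed p * v) \<le> norm (v * embed q * v)"
      using le[OF va(2), of "Re z"] unfolding va(1) conj[symmetric] by simp
    have vqv: "v * embed q * v = 1 - \<epsilon> *\<^sub>R (v * v)"
    proof -
      have "v * embed q * v = (v * v) * embed q" using v(2) by (metis mult.assoc)
      also have "\<dots> = (v * v) * Q - \<epsilon> *\<^sub>R (v * v)"
        by (simp add: Q_def distrib_left of_real_def)
      finally show ?thesis by (simp add: v(3))
    qed
    have vpos: "spectrally_nonneg (v * x * v)" if "spectrally_nonneg x" for x
      using that positive_conj[of x v] by (simp add: positive_iff_spectrally_nonneg v(1))
    have "spectrally_nonneg (1 - v * embed q * v)"
      unfolding vqv using \<epsilon> spectrally_nonneg_square[OF v(1)] by (simp add: spectrally_nonneg_scaleR)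
    then have "norm (v * embed q * v) \<le> 1"
      using vpos q by (intro spectrally_nonneg_norm_le_1) (auto simp: spectrally_nonneg_embed_iff)
    with le' have "norm (v * embed p * v) \<le> 1" by simp
    moreover have "cstar (v * embed p * v) = v * embed p * v"
      using p by (simp add: cstar_mult v(1) mult.assoc positive_self_adjoint flip: embed_cstar)
    ultimately have pos: "positive (1 - v * embed p * v)"
      using positive_one_minus[of "v * embed p * v" 1] by simp
    \<comment> \<open>g is the inverse of v. Conjugation by g turns 1 - v p v into q + \<epsilon> -
      p.\<close>
    define g where "g = v * Q"
    have gv: "g * v = 1" "v * g = 1"
    proof -
      show vg: "v * g = 1" using v(3) by (simp add: g_def mult.assoc)
      have "v * Q = Q * v" unfolding Q_def distrib_left distrib_right v(2) by (simp add: of_real_def)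
      then show "g * v = 1" using v(4) by (metis g_def mult.assoc)
    qed
    have "cstar g * v = 1" using gv(2) v(1) by (metis cstar_mult cstar_one)
    then have cg: "cstar g = g" using gv by (metis mult.assoc mult_1_left mult_1_right)
    have "g * (1 - v * embed p * v) * cstar g = g * g - (g * v) * embed p * (v * g)"
      unfolding cg by (simp add: algebra_simps)
    also have "\<dots> = Q - embed p"
    proof -
      have "g * g = (g * v) * Q" by (simp add: g_def mult.assoc)
      then show ?thesis by (simp add: gv)
    qed
    also have "\<dots> = embed (q - p) + of_real \<epsilon>"
      by (simp add: Q_def embed_diff)
    finally show ?thesis
      using positive_conj[OF pos, of g] by (simp only: positive_iff_spectrally_nonneg)
  qed
  then show ?thesis
    unfolding cstar_le_def spectrally_nonneg_embed_iff[symmetric] by (rule positive_if_shifts_positive)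
qed

section \<open>Least upper bounds\<close>

definition is_lub :: "'a::cstar_algebra set \<Rightarrow> 'a \<Rightarrow> bool"
  where "is_lub S s \<longleftrightarrow> self_adjoint s \<and> (\<forall>x\<in>S. cstar_le x s) \<and>
    (\<forall>u. self_adjoint u \<and> (\<forall>x\<in>S. cstar_le x u) \<longrightarrow> cstar_le s u)"

lemma cstar_le_refl [simp]: "cstar_le a a"
  by (simp add: cstar_le_def)

lemma cstar_le_trans: "cstar_le a b \<Longrightarrow> cstar_le b c \<Longrightarrow> cstar_le a c"
  unfolding cstar_le_def using positive_add[of "b - a" "c - b"] by simp

lemma cstar_le_antisym: "cstar_le a b \<Longrightarrow> cstar_le b a \<Longrightarrow> a = b"
  unfolding cstar_le_def using positive_antisym[of "b - a"] by simp

lemma is_lub_unique: "is_lub S s \<Longrightarrow> is_lub S t \<Longrightarrow> s = t"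
  unfolding is_lub_def by (meson cstar_le_antisym)

lemma monotone_complete_is_lub:
  assumes "monotone_complete TYPE('a::cstar_algebra)"
    and "S \<noteq> {}" "\<And>x. x \<in> S \<Longrightarrow> self_adjoint x" "\<And>x. x \<in> S \<Longrightarrow> norm x \<le> C"
    and dir: "\<And>x y. x \<in> S \<Longrightarrow> y \<in> S \<Longrightarrow> \<exists>z\<in>S. cstar_le x z \<and> cstar_le y z"
  shows "\<exists>s :: 'a. is_lub S s"
proof -
  define r where "r = {(x, y). x \<in> S \<and> y \<in> S \<and> cstar_le x y}"
  have "preorder_on S r"
    unfolding preorder_on_def r_def
    by (auto simp: refl_on_def trans_def intro: cstar_le_trans)
  moreover have "\<forall>i\<in>S. \<forall>j\<in>S. \<exists>k\<in>S. (i, k) \<in> r \<and> (j, k) \<in> r"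
    using dir by (auto simp: r_def)
  moreover have "\<forall>i\<in>S. self_adjoint i" "\<forall>i j. (i, j) \<in> r \<longrightarrow> cstar_le i j"
    "\<exists>C. \<forall>i\<in>S. norm i \<le> C"
    using assms(3,4) by (auto simp: r_def)
  ultimately show ?thesis
    using assms(1)[unfolded monotone_complete_def, rule_format, of S r "\<lambda>x. x"] assms(2)
    unfolding is_lub_def by blast
qed

text \<open>The map is conjugation by 1 + a, an order automorphism since 1 + a is invertible in the
  unitization; it is multiplied out to remain in the algebra.\<close>

lemma is_lub_conj:
  assumes "is_lub S s" "norm a < 1"
  shows "is_lub ((\<lambda>g. g + a * g + g * cstar a + a * g * cstar a) ` S)
    (s + a * s + s * cstar a + a * s * cstar a)"
proof -
  define f where "f = (\<lambda>g. g + a * g + g * cstar a + a * g * cstar a)"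
  define b where "b = 1 + embed a"
  have ef: "embed (f g) = b * embed g * cstar b" for g
    by (simp add: f_def b_def embed_simps cstar_add algebra_simps)
  obtain w where w: "w * b = 1" "b * w = 1"
    using exists_inverse_one_minus[of "- embed a"] assms(2) by (auto simp: b_def)
  have cw: "cstar b * cstar w = 1" "cstar w * cstar b = 1"
    using w by (metis cstar_mult cstar_one)+
  have mono: "cstar_le (f x) (f y)" if "cstar_le x y" for x y
  proof -
    have "positive (b * embed (y - x) * cstar b)"
      using that by (intro positive_conj) (simp add: cstar_le_def positive_embed_iff)
    moreover have "b * embed (y - x) * cstar b = embed (f y - f x)"
      by (simp add: ef embed_diff algebra_simps)
    ultimately show ?thesis by (simp only: cstar_le_def positive_embed_iff)
  qed
  have sa: "self_adjoint (f x)" if "self_adjoint x" for x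
    using that by (simp add: self_adjoint_def f_def cstar_add cstar_mult cstar_cstar mult.assoc)
  \<comment> \<open>Conjugation by the inverse w gives a preimage y of u and reflects the order, so
    upper bounds of the image come from upper bounds of S.\<close>
  have "\<exists>y. self_adjoint y \<and> u = f y \<and> (\<forall>x. cstar_le (f x) u \<longrightarrow> cstar_le x y)"
    if "self_adjoint u" for u
  proof -
    have "scalar_part (w * embed u * cstar w) = 0" by (simp add: scalar_part_simps)
    then obtain y where y: "w * embed u * cstar w = embed y" by (rule embedE)
    have "cstar (embed y) = embed y"
      using that by (simp add: cstar_mult cstar_cstar mult.assoc self_adjoint_def flip: y embed_cstar)
    then have "self_adjoint y" by (simp add: self_adjoint_def flip: embed_cstar)
    moreover have "embed (f y) = (b * w) * embed u * (cstar w * cstar b)"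
      by (simp add: ef mult.assoc flip: y)
    then have "u = f y" by (simp add: w cw)
    moreover have "cstar_le x y" if "cstar_le (f x) u" for x
    proof -
      have "positive (w * embed (u - f x) * cstar w)"
        using that by (intro positive_conj) (simp add: cstar_le_def positive_embed_iff)
      moreover have "w * embed (u - f x) * cstar w = embed y - (w * b) * embed x * (cstar b * cstar w)"
        by (simp add: embed_diff ef algebra_simps flip: y)
      ultimately show ?thesis by (simp add: w cw cstar_le_def positive_embed_iff flip: embed_diff)
    qed
    ultimately show ?thesis by blast
  qed
  then have "cstar_le (f s) u" if "self_adjoint u" "\<forall>x\<in>S. cstar_le (f x) u" for u
    using that assms(1) mono unfolding is_lub_def by metis
  then have "is_lub (f ` S) (f s)"
    using assms(1) mono sa unfolding is_lub_def by auto
  then show ?thesis by (simp add: f_def)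
qed

section \<open>Pre-Hilbert modules\<close>

lemma complex_field_simps [simp]:
  "carrier complex_field = UNIV" "mult complex_field = (*)" "one complex_field = 1"
  "zero complex_field = 0" "add complex_field = (+)"
  by (simp_all add: complex_field_def)

text \<open>Completeness is left out so that the same theory serves submodules, and the dual before
  its completeness is proved.\<close>

locale pre_hilbert_module = Module.module complex_field M
  for M :: "('a::cstar_algebra, 'm) hilbert_mod" (structure) +
  assumes lact_closed [simp, intro]: "x \<in> carrier M \<Longrightarrow> a \<triangleright> x \<in> carrier M"
    and lact_add_left: "x \<in> carrier M \<Longrightarrow> (a + b) \<triangleright> x = a \<triangleright> x \<oplus> b \<triangleright> x"
    and lact_add_right:
      "\<lbrakk>x \<in> carrier M; y \<in> carrier M\<rbrakk> \<Longrightarrow> a \<triangleright> (x \<oplus> y) = a \<triangleright> x \<oplus> a \<triangleright> y"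
    and lact_mult: "x \<in> carrier M \<Longrightarrow> (a * b) \<triangleright> x = a \<triangleright> (b \<triangleright> x)"
    and lact_cscale: "x \<in> carrier M \<Longrightarrow> cscale c a \<triangleright> x = c \<odot> (a \<triangleright> x)"
    and lact_smult: "x \<in> carrier M \<Longrightarrow> a \<triangleright> (c \<odot> x) = c \<odot> (a \<triangleright> x)"
    and ip_add: "\<lbrakk>x \<in> carrier M; y \<in> carrier M; z \<in> carrier M\<rbrakk> \<Longrightarrow>
      ip M (x \<oplus> y) z = ip M x z + ip M y z"
    and ip_smult: "\<lbrakk>x \<in> carrier M; y \<in> carrier M\<rbrakk> \<Longrightarrow> ip M (c \<odot> x) y = cscale c (ip M x y)"
    and ip_lact: "\<lbrakk>x \<in> carrier M; y \<in> carrier M\<rbrakk> \<Longrightarrow> ip M (a \<triangleright> x) y = a * ip M x y"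
    and ip_cstar: "\<lbrakk>x \<in> carrier M; y \<in> carrier M\<rbrakk> \<Longrightarrow> ip M y x = cstar (ip M x y)"
    and ip_positive: "x \<in> carrier M \<Longrightarrow> positive (ip M x x)"
    and ip_definite: "\<lbrakk>x \<in> carrier M; ip M x x = 0\<rbrakk> \<Longrightarrow> x = \<zero>"

lemma (in hilbert_module) pre_hilbert_module: "pre_hilbert_module M"
  by unfold_locales
    (fact lact_closed lact_add_left lact_add_right lact_mult lact_cscale lact_smult ip_add ip_smult
      ip_lact ip_cstar ip_positive ip_definite)+

context pre_hilbert_module
begin

lemma smult_closed' [simp, intro]: "x \<in> carrier M \<Longrightarrow> c \<odot> x \<in> carrier M"
  using smult_closed[of c x] by simp

lemma ip_add_right:
  "\<lbrakk>x \<in> carrier M; y \<in> carrier M; z \<in> carrier M\<rbrakk> \<Longrightarrow> ip M z (x \<oplus> y) = ip M z x + ip M z y"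
  using ip_add[of x y z] ip_cstar[of "x \<oplus> y" z] ip_cstar[of x z] ip_cstar[of y z]
  by (simp add: cstar_add)

lemma ip_smult_right:
  "\<lbrakk>x \<in> carrier M; y \<in> carrier M\<rbrakk> \<Longrightarrow> ip M x (c \<odot> y) = cscale (cnj c) (ip M x y)"
  using ip_smult[of y x c] ip_cstar[of "c \<odot> y" x] ip_cstar[of y x] by (simp add: cstar_cscale)

lemma ip_lact_right:
  "\<lbrakk>x \<in> carrier M; y \<in> carrier M\<rbrakk> \<Longrightarrow> ip M x (a \<triangleright> y) = ip M x y * cstar a"
  using ip_lact[of y x a] ip_cstar[of "a \<triangleright> y" x] ip_cstar[of y x] by (simp add: cstar_mult)

lemma ip_zero [simp]: "x \<in> carrier M \<Longrightarrow> ip M \<zero> x = 0"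
  using ip_add[of \<zero> \<zero> x] by simp

lemma ip_zero_right [simp]: "x \<in> carrier M \<Longrightarrow> ip M x \<zero> = 0"
  using ip_add_right[of \<zero> \<zero> x] by simp

lemma ip_minus: "\<lbrakk>x \<in> carrier M; y \<in> carrier M\<rbrakk> \<Longrightarrow> ip M (\<ominus> x) y = - ip M x y"
  using ip_add[of "\<ominus> x" x y] by (simp add: l_neg eq_neg_iff_add_eq_0)

lemma ip_minus_right: "\<lbrakk>x \<in> carrier M; y \<in> carrier M\<rbrakk> \<Longrightarrow> ip M y (\<ominus> x) = - ip M y x"
  using ip_add_right[of "\<ominus> x" x y] by (simp add: l_neg eq_neg_iff_add_eq_0)

lemma ip_diff:
  "\<lbrakk>x \<in> carrier M; y \<in> carrier M; z \<in> carrier M\<rbrakk> \<Longrightarrow> ip M (x \<ominus> y) z = ip M x z - ip M y z"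
  by (simp add: minus_eq ip_add ip_minus)

lemma ip_diff_right:
  "\<lbrakk>x \<in> carrier M; y \<in> carrier M; z \<in> carrier M\<rbrakk> \<Longrightarrow> ip M z (x \<ominus> y) = ip M z x - ip M z y"
  by (simp add: minus_eq ip_add_right ip_minus_right)

lemmas ip_simps = ip_add ip_add_right ip_diff ip_diff_right ip_smult ip_smult_right ip_lact
  ip_lact_right

lemma cstar_ip_self [simp]: "x \<in> carrier M \<Longrightarrow> cstar (ip M x x) = ip M x x"
  by (simp add: ip_positive positive_self_adjoint)

lemma eq_if_ip_eq:
  assumes "x \<in> carrier M" "y \<in> carrier M" "\<And>z. z \<in> carrier M \<Longrightarrow> ip M z x = ip M z y"
  shows "x = y"
proof -
  have "ip M (x \<ominus> y) (x \<ominus> y) = 0" using assms by (simp add: ip_diff_right)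
  then have "x \<ominus> y = \<zero>" using assms by (intro ip_definite) auto
  then have "(x \<ominus> y) \<oplus> y = y" using assms by simp
  then show ?thesis using assms by (simp add: minus_eq a_assoc l_neg)
qed

lemma diff_eq_zero_iff: "x \<in> carrier M \<Longrightarrow> y \<in> carrier M \<Longrightarrow> x \<ominus> y = \<zero> \<longleftrightarrow> x = y"
  using eq_if_ip_eq[of x y] ip_diff_right[of x y] by (auto simp: minus_eq r_neg)

section \<open>The norm and the Cauchy-Schwarz inequality\<close>

lemma hnorm_nonneg [simp]: "hnorm M x \<ge> 0"
  by (simp add: hnorm_def)

lemma hnorm_power2: "(hnorm M x)\<^sup>2 = norm (ip M x x)"
  by (simp add: hnorm_def)

lemma hnorm_eq_0_iff: "x \<in> carrier M \<Longrightarrow> hnorm M x = 0 \<longleftrightarrow> x = \<zero>"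
  using ip_definite by (auto simp: hnorm_def)

text \<open>Expand the square of t x - a y with a = \<langle>x, y\<rangle>. Its norm t replaces
  \<langle>y, y\<rangle>, which need not be invertible, and \<open>positive_norm_conj\<close>
  absorbs the difference.\<close>

lemma Cauchy_Schwarz_order:
  assumes x: "x \<in> carrier M" and y: "y \<in> carrier M"
  shows "cstar_le (ip M x y * cstar (ip M x y)) (norm (ip M y y) *\<^sub>R ip M x x)"
proof (cases "norm (ip M y y) = 0")
  case True
  then have "y = \<zero>" using ip_definite y by simp
  then show ?thesis using x by simp
next
  case False
  define t where "t = norm (ip M y y)"
  define a where "a = ip M x y"
  have t: "t > 0" using False by (simp add: t_def)
  define z where "z = complex_of_real t \<odot> x \<ominus> a \<triangleright> y"
  have "ip M z z = t *\<^sub>R t *\<^sub>R ip M x x - t *\<^sub>R (a * cstar a) - t *\<^sub>R (a * cstar a) + a * ip M y y * cstar a"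
    using x y ip_cstar[OF x y]
    by (simp add: z_def ip_simps a_def algebra_simps cscale_simps flip: scaleR_eq_cscale)
  moreover have "positive (ip M z z)" using x y by (simp add: z_def ip_positive)
  moreover have "positive (t *\<^sub>R (a * cstar a) - a * ip M y y * cstar a)"
    using positive_norm_conj[OF ip_positive[OF y], of a] by (simp add: t_def)
  ultimately have "positive ((t *\<^sub>R t *\<^sub>R ip M x x - t *\<^sub>R (a * cstar a) - t *\<^sub>R (a * cstar a)
      + a * ip M y y * cstar a) + (t *\<^sub>R (a * cstar a) - a * ip M y y * cstar a))"
    using positive_add by metis
  then have "positive (t *\<^sub>R t *\<^sub>R ip M x x - t *\<^sub>R (a * cstar a))" by simp
  then have "positive ((1/t) *\<^sub>R (t *\<^sub>R t *\<^sub>R ip M x x - t *\<^sub>R (a * cstar a)))"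
    by (rule positive_scaleR) (use t in simp)
  then show ?thesis using t by (simp add: scaleR_diff_right cstar_le_def t_def a_def)
qed

lemma Cauchy_Schwarz:
  assumes "x \<in> carrier M" "y \<in> carrier M"
  shows "norm (ip M x y) \<le> hnorm M x * hnorm M y"
proof -
  have "norm (ip M x y * cstar (ip M x y)) \<le> norm (norm (ip M y y) *\<^sub>R ip M x x)"
    using Cauchy_Schwarz_order[OF assms]
    by (intro norm_le_if_order_le) (auto simp: cstar_le_def positive_mult_cstar_self)
  then have "(norm (ip M x y))\<^sup>2 \<le> (hnorm M x * hnorm M y)\<^sup>2"
    by (simp add: norm_mult_cstar power_mult_distrib hnorm_power2 mult.commute)
  then show ?thesis by (rule power2_le_imp_le) simp
qed

lemma hnorm_triangle:
  assumes "x \<in> carrier M" "y \<in> carrier M"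
  shows "hnorm M (x \<oplus> y) \<le> hnorm M x + hnorm M y"
proof -
  have "(hnorm M (x \<oplus> y))\<^sup>2 = norm (ip M x x + ip M x y + (ip M y x + ip M y y))"
    using assms by (simp add: hnorm_power2 ip_simps algebra_simps)
  also have "\<dots> \<le> norm (ip M x x) + norm (ip M x y) + (norm (ip M y x) + norm (ip M y y))"
    by (intro order.trans[OF norm_triangle_ineq] add_mono norm_triangle_ineq)
  also have "\<dots> \<le> (hnorm M x)\<^sup>2 + hnorm M x * hnorm M y + (hnorm M y * hnorm M x + (hnorm M y)\<^sup>2)"
    using Cauchy_Schwarz assms by (intro add_mono) (auto simp: hnorm_power2)
  also have "\<dots> = (hnorm M x + hnorm M y)\<^sup>2" by (simp add: power2_eq_square algebra_simps)
  finally show ?thesis by (rule power2_le_imp_le) simp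
qed

lemma hnorm_minus: "x \<in> carrier M \<Longrightarrow> hnorm M (\<ominus> x) = hnorm M x"
  by (simp add: hnorm_def ip_minus ip_minus_right)

lemma Metric_space: "Metric_space (carrier M) (hdist M)"
proof
  fix x y z
  show "0 \<le> hdist M x y" by (simp add: hdist_def)
  show "hdist M x y = hdist M y x"
  proof (cases "x \<in> carrier M \<and> y \<in> carrier M")
    case True
    then have "x \<ominus> y = \<ominus> (y \<ominus> x)"
      by (simp add: minus_eq minus_add a_comm)
    with True show ?thesis using hnorm_minus[of "y \<ominus> x"] by (simp add: hdist_def)
  qed (auto simp: hdist_def)
  assume xy: "x \<in> carrier M" "y \<in> carrier M"
  then show "hdist M x y = 0 \<longleftrightarrow> x = y"
    by (simp add: hdist_def hnorm_eq_0_iff diff_eq_zero_iff)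
  assume z: "z \<in> carrier M"
  have "x \<ominus> z = (x \<ominus> y) \<oplus> (y \<ominus> z)"
    using xy z by (rule_tac eq_if_ip_eq) (auto simp: ip_simps)
  then show "hdist M x z \<le> hdist M x y + hdist M y z"
    using hnorm_triangle[of "x \<ominus> y" "y \<ominus> z"] xy z by (simp add: hdist_def)
qed

lemma functional_zero: "bounded_module_functional M r \<Longrightarrow> r \<zero> = 0"
  unfolding bounded_module_functional_def
  by (metis add_cancel_right_right r_zero zero_closed)

lemma functional_minus:
  assumes "bounded_module_functional M r" "x \<in> carrier M"
  shows "r (\<ominus> x) = - r x"
proof -
  have "r (\<ominus> x) + r x = r (\<ominus> x \<oplus> x)"
    using assms unfolding bounded_module_functional_def by auto
  then show ?thesis
    using functional_zero[OF assms(1)] assms(2) by (simp add: l_neg eq_neg_iff_add_eq_0)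
qed

lemma functional_diff:
  assumes "bounded_module_functional M r" "x \<in> carrier M" "y \<in> carrier M"
  shows "r (x \<ominus> y) = r x - r y"
proof -
  have "r (x \<oplus> \<ominus> y) = r x + r (\<ominus> y)"
    using assms unfolding bounded_module_functional_def by auto
  then show ?thesis using functional_minus[OF assms(1,3)] by (simp add: minus_eq)
qed

lemma functional_add:
  "bounded_module_functional M r \<Longrightarrow> x \<in> carrier M \<Longrightarrow> y \<in> carrier M \<Longrightarrow> r (x \<oplus> y) = r x + r y"
  and functional_smult: "bounded_module_functional M r \<Longrightarrow> x \<in> carrier M \<Longrightarrow> r (c \<odot> x) = cscale c (r x)"
  and functional_lact: "bounded_module_functional M r \<Longrightarrow> x \<in> carrier M \<Longrightarrow> r (a \<triangleright> x) = a * r x"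
  by (auto simp: bounded_module_functional_def)

lemma functional_bound:
  assumes "bounded_module_functional M r"
  obtains C where "C \<ge> 0" "\<And>x. x \<in> carrier M \<Longrightarrow> norm (r x) \<le> C * hnorm M x"
proof -
  obtain C where C: "\<forall>x\<in>carrier M. norm (r x) \<le> C * hnorm M x"
    using assms by (auto simp: bounded_module_functional_def)
  have "norm (r x) \<le> max C 0 * hnorm M x" if "x \<in> carrier M" for x
    using C[rule_format, OF that] mult_right_mono[of C "max C 0" "hnorm M x"] by simp
  then show ?thesis using that[of "max C 0"] by simp
qed

lemma inner_functional:
  assumes "y \<in> carrier M"
  shows "bounded_module_functional M (\<lambda>x. ip M x y)"
  unfolding bounded_module_functional_def
proof (intro conjI exI[of _ "hnorm M y"])
  show "\<forall>x\<in>carrier M. norm (ip M x y) \<le> hnorm M y * hnorm M x"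
    using Cauchy_Schwarz assms by (simp add: mult.commute)
qed (use assms in \<open>auto simp: ip_simps\<close>)

section \<open>Regularized maximization over finitely many generators\<close>

definition lin_comb :: "'m set \<Rightarrow> ('m \<Rightarrow> 'a) \<Rightarrow> 'm"
  where "lin_comb F a = (\<Oplus>x\<in>F. a x \<triangleright> x)"

lemma lin_comb_closed [simp]: "F \<subseteq> carrier M \<Longrightarrow> lin_comb F a \<in> carrier M"
  unfolding lin_comb_def by (rule finsum_closed) auto

lemma functional_lin_comb:
  assumes "bounded_module_functional M r" "finite F" "F \<subseteq> carrier M"
  shows "r (lin_comb F a) = (\<Sum>x\<in>F. a x * r x)"
  using assms(2,3)
proof (induction F)
  case empty
  then show ?case using functional_zero[OF assms(1)] by (simp add: lin_comb_def)
next
  case (insert y F)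
  have "lin_comb (insert y F) a = a y \<triangleright> y \<oplus> lin_comb F a"
    unfolding lin_comb_def using insert by (intro finsum_insert) auto
  then show ?case
    using insert by (simp add: functional_add[OF assms(1)] functional_lact[OF assms(1)])
qed

lemma ip_lin_comb:
  assumes "finite F" "F \<subseteq> carrier M" "y \<in> carrier M"
  shows "ip M (lin_comb F a) y = (\<Sum>x\<in>F. a x * ip M x y)"
  using functional_lin_comb[OF inner_functional[OF assms(3)] assms(1,2)] .

text \<open>Padding with zeros allows problems over different sets of generators to be compared over
  their union.\<close>

lemma lin_comb_extend:
  assumes "finite F" "F \<subseteq> carrier M" "G \<subseteq> F"
  shows "lin_comb F (\<lambda>x. if x \<in> G then a x else 0) = lin_comb G a"
proof (rule eq_if_ip_eq)
  fix z assume z: "z \<in> carrier M"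
  have "ip M (lin_comb F (\<lambda>x. if x \<in> G then a x else 0)) z = ip M (lin_comb G a) z"
    using assms z finite_subset[OF assms(3,1)]
    by (simp add: ip_lin_comb if_distrib[of "\<lambda>u. u * _"] sum.If_cases Int_absorb1 subset_trans[OF assms(3,2)])
  then show "ip M z (lin_comb F (\<lambda>x. if x \<in> G then a x else 0)) = ip M z (lin_comb G a)"
    using ip_cstar[of _ z] assms z by (metis lin_comb_closed subset_trans)
qed (use assms in auto)

text \<open>The coefficients of the maximizer of
  \<open>r(w) + r(w)\<^sup>* - \<langle>w, w\<rangle> - \<epsilon> \<Sum>x\<in>F. b(x) b(x)\<^sup>*\<close> over the combinations \<open>w = \<Sum>x\<in>F. b(x) x\<close>.\<close>

definition regular_solution :: "'m set \<Rightarrow> real \<Rightarrow> ('m \<Rightarrow> 'a) \<Rightarrow> ('m \<Rightarrow> 'a) \<Rightarrow> bool"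
  where "regular_solution F \<epsilon> r a \<longleftrightarrow>
    (\<forall>y\<in>F. ip M (lin_comb F a) y + \<epsilon> *\<^sub>R a y = cstar (r y))"

text \<open>On the generators the defining equations express r as the inner product with the
  maximizer plus an error proportional to \<epsilon>; this extends to all combinations.\<close>

lemma regular_solution_eval:
  assumes r: "bounded_module_functional M r" and F: "finite F" "F \<subseteq> carrier M"
    and a: "regular_solution F \<epsilon> r a"
  shows "r (lin_comb F b) = ip M (lin_comb F b) (lin_comb F a) + \<epsilon> *\<^sub>R (\<Sum>x\<in>F. b x * cstar (a x))"
proof -
  have ry: "r y = ip M y (lin_comb F a) + \<epsilon> *\<^sub>R cstar (a y)" if "y \<in> F" for y
  proof -
    have "r y = cstar (ip M (lin_comb F a) y + \<epsilon> *\<^sub>R a y)"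
      using a that by (simp add: regular_solution_def cstar_cstar)
    then show ?thesis
      using ip_cstar[of "lin_comb F a" y] F that by (auto simp: cstar_add cstar_scaleR)
  qed
  have "r (lin_comb F b) = (\<Sum>y\<in>F. b y * (ip M y (lin_comb F a) + \<epsilon> *\<^sub>R cstar (a y)))"
    by (simp add: functional_lin_comb[OF r F] ry)
  also have "\<dots> = (\<Sum>y\<in>F. b y * ip M y (lin_comb F a)) + \<epsilon> *\<^sub>R (\<Sum>y\<in>F. b y * cstar (a y))"
    by (simp add: distrib_left sum.distrib scaleR_sum_right)
  finally show ?thesis using F by (simp add: ip_lin_comb)
qed

text \<open>For the maximizer z this identity collapses the regularized expression to r(z), so r(z)
  is the maximum itself.\<close>

lemma regular_solution_value:
  assumes "bounded_module_functional M r" "finite F" "F \<subseteq> carrier M" "regular_solution F \<epsilon> r a"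
  shows "r (lin_comb F a) = ip M (lin_comb F a) (lin_comb F a) + \<epsilon> *\<^sub>R (\<Sum>x\<in>F. a x * cstar (a x))"
    and "cstar (r (lin_comb F a)) = r (lin_comb F a)"
  using regular_solution_eval[OF assms, of a] assms(3)
  by (auto simp: cstar_add cstar_scaleR cstar_sum cstar_mult cstar_cstar)

text \<open>Completing the square: the difference is \<langle>z - w, z - w\<rangle> plus \<epsilon>
  times the squares of the differences of coefficients.\<close>

lemma regular_solution_optimal:
  assumes r: "bounded_module_functional M r" and F: "finite F" "F \<subseteq> carrier M"
    and a: "regular_solution F \<epsilon> r a" and \<epsilon>: "\<epsilon> \<ge> 0"
  shows "cstar_le (r (lin_comb F b) + cstar (r (lin_comb F b)) - ip M (lin_comb F b) (lin_comb F b)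
    - \<epsilon> *\<^sub>R (\<Sum>x\<in>F. b x * cstar (b x))) (r (lin_comb F a))"
proof -
  let ?z = "lin_comb F a" and ?w = "lin_comb F b"
  have zw: "?z \<in> carrier M" "?w \<in> carrier M" using F by auto
  have "r ?z - (r ?w + cstar (r ?w) - ip M ?w ?w - \<epsilon> *\<^sub>R (\<Sum>x\<in>F. b x * cstar (b x)))
      = ip M (?z \<ominus> ?w) (?z \<ominus> ?w) + \<epsilon> *\<^sub>R (\<Sum>x\<in>F. (a x - b x) * cstar (a x - b x))"
    using zw ip_cstar[of ?w ?z]
    by (simp add: regular_solution_eval[OF r F a] ip_simps cstar_add cstar_scaleR cstar_sum cstar_mult
        cstar_cstar cstar_diff algebra_simps sum.distrib sum_subtractf)
  moreover have "positive (ip M (?z \<ominus> ?w) (?z \<ominus> ?w))" using zw by (simp add: ip_positive)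
  moreover have "positive (\<epsilon> *\<^sub>R (\<Sum>x\<in>F. (a x - b x) * cstar (a x - b x)))"
    using \<epsilon> by (intro positive_scaleR positive_sum positive_mult_cstar_self)
  ultimately show ?thesis unfolding cstar_le_def by (simp only: positive_add)
qed

text \<open>Elimination of one unknown at a time; the pivot is \<open>\<epsilon>\<close> plus the positive element \<open>p\<close>.\<close>

lemma exists_regular_solution:
  assumes "finite F" "F \<subseteq> carrier M" "\<epsilon> > 0" "bounded_module_functional M r"
  shows "\<exists>a. regular_solution F \<epsilon> r a"
  using assms(1,2,4)
proof (induction F arbitrary: r)
  case empty
  then show ?case by (simp add: regular_solution_def)
next
  case (insert x0 F)
  have F: "finite F" "F \<subseteq> carrier M" and x0: "x0 \<in> carrier M" "x0 \<notin> F" using insert by auto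
  obtain a where a: "regular_solution F \<epsilon> r a" using insert by blast
  \<comment> \<open>The combination z0 with these coefficients is a regularized projection of x0
    onto the span of F.\<close>
  obtain a0 where a0: "regular_solution F \<epsilon> (\<lambda>x. ip M x x0) a0"
    using insert inner_functional[OF x0(1)] by blast
  define z0 where "z0 = lin_comb F a0"
  have z0: "z0 \<in> carrier M" using F by (simp add: z0_def)
  define N where "N = (\<Sum>x\<in>F. a0 x * cstar (a0 x))"
  have val: "ip M z0 x0 = ip M z0 z0 + \<epsilon> *\<^sub>R N" "cstar (ip M z0 x0) = ip M z0 x0"
    using regular_solution_value[OF inner_functional[OF x0(1)] F a0] by (simp_all add: z0_def N_def)
  \<comment> \<open>p is the regularized squared distance of x0 from that span, and p + \<epsilon>
    is the Schur complement of the elimination.\<close>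
  define p where "p = ip M x0 x0 - ip M z0 x0"
  have "p = ip M (x0 \<ominus> z0) (x0 \<ominus> z0) + \<epsilon> *\<^sub>R N"
    using ip_cstar[OF z0 x0(1)] x0 z0 val by (simp add: p_def ip_simps)
  moreover have "positive (\<epsilon> *\<^sub>R N)"
    unfolding N_def using assms(3) by (intro positive_scaleR positive_sum positive_mult_cstar_self) auto
  moreover have "positive (ip M (x0 \<ominus> z0) (x0 \<ominus> z0))" using x0 z0 by (intro ip_positive) simp
  ultimately have "positive p" by (simp only: positive_add)
  then obtain c where c: "c * p + \<epsilon> *\<^sub>R c = cstar (r x0) - ip M (lin_comb F a) x0"
    using exists_shifted_quotient assms(3) by blast
  \<comment> \<open>Back substitution: x0 receives c, and the old coefficients are reduced by the
    part of c x0 that z0 accounts for.\<close>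
  define b where "b x = (if x = x0 then c else a x - c * a0 x)" for x
  have lb: "ip M (lin_comb (insert x0 F) b) y
      = c * ip M x0 y + ip M (lin_comb F a) y - c * ip M z0 y" if "y \<in> carrier M" for y
  proof -
    have "ip M (lin_comb (insert x0 F) b) y = c * ip M x0 y + (\<Sum>x\<in>F. b x * ip M x y)"
      using F x0 that by (subst ip_lin_comb) (auto simp: b_def)
    also have "(\<Sum>x\<in>F. b x * ip M x y) = (\<Sum>x\<in>F. a x * ip M x y - c * (a0 x * ip M x y))"
      using x0(2) by (intro sum.cong) (auto simp: b_def algebra_simps)
    also have "\<dots> = ip M (lin_comb F a) y - c * ip M z0 y"
      using F that by (simp add: z0_def ip_lin_comb sum_subtractf sum_distrib_left)
    finally show ?thesis by simp
  qed
  have "ip M (lin_comb (insert x0 F) b) y + \<epsilon> *\<^sub>R b y = cstar (r y)" if "y \<in> insert x0 F" for y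
  proof (cases "y = x0")
    case True
    have "c * ip M x0 x0 - c * ip M z0 x0 + \<epsilon> *\<^sub>R c = cstar (r x0) - ip M (lin_comb F a) x0"
      using c by (simp add: p_def algebra_simps)
    then show ?thesis using True x0 by (simp add: lb b_def algebra_simps)
  next
    case False
    then have y: "y \<in> F" "y \<in> carrier M" using that F by auto
    have 1: "ip M (lin_comb F a) y + \<epsilon> *\<^sub>R a y = cstar (r y)"
      using a y(1) by (simp add: regular_solution_def)
    have "ip M z0 y + \<epsilon> *\<^sub>R a0 y = ip M x0 y"
      using a0 y ip_cstar[of y x0] x0(1) by (simp add: regular_solution_def z0_def)
    then have "c * ip M x0 y = c * ip M z0 y + \<epsilon> *\<^sub>R (c * a0 y)"
      by (metis distrib_left mult_scaleR_right)
    then show ?thesis using False y 1 by (simp add: lb b_def scaleR_diff_right)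
  qed
  then show ?case by (auto simp: regular_solution_def)
qed

end

lemma cstar_le_add: "cstar_le a b \<Longrightarrow> cstar_le c d \<Longrightarrow> cstar_le (a + c) (b + d)"
  unfolding cstar_le_def using positive_add[of "b - a" "d - c"] by (simp add: algebra_simps)

lemma cstar_le_scaleR: "cstar_le a b \<Longrightarrow> t \<ge> 0 \<Longrightarrow> cstar_le (t *\<^sub>R a) (t *\<^sub>R b)"
  unfolding cstar_le_def using positive_scaleR[of "b - a" t] by (simp add: scaleR_diff_right)

text \<open>In the unitization 1 + b is the inverse of 1 + a. It makes x \<mapsto> x + a x
  surjective on modules over an algebra without unit.\<close>

lemma exists_quasi_inverse:
  assumes "norm (a :: 'a::cstar_algebra) < 1"
  shows "\<exists>b. a + b + a * b = 0"
proof -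
  obtain w where w: "(1 + embed a) * w = 1"
    using exists_inverse_one_minus[of "- embed a"] assms by auto
  then have "scalar_part ((1 + embed a) * w) = 1" by (simp add: scalar_part_simps)
  then have "scalar_part (w - 1) = 0" by (simp add: scalar_part_simps)
  then obtain b where "w - 1 = embed b" by (rule embedE)
  then have "w = 1 + embed b" by (simp add: algebra_simps)
  with w have "embed (a + b + a * b) = embed 0" by (simp add: embed_simps algebra_simps)
  then show ?thesis unfolding embed_eq_iff by blast
qed

text \<open>The deviation h(t) = f(t) - t f(1) is additive and vanishes at integers, so it is
  periodic and bounded everywhere. Then h(n t) = n h(t) forces h = 0.\<close>

lemma additive_bounded_imp_scaleR:
  fixes f :: "real \<Rightarrow> 'b::real_normed_vector"
  assumes add: "\<And>s t. f (s + t) = f s + f t"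
    and bound: "\<And>t. 0 \<le> t \<Longrightarrow> t \<le> 1 \<Longrightarrow> norm (f t) \<le> B"
  shows "f t = t *\<^sub>R f 1"
proof -
  define h where "h t = f t - t *\<^sub>R f 1" for t
  have hadd: "h (s + t) = h s + h t" for s t by (simp add: h_def add algebra_simps)
  have h0: "h 0 = 0" using hadd[of 0 0] by simp
  have hminus: "h (- t) = - h t" for t using hadd[of t "- t"] by (simp add: h0 eq_neg_iff_add_eq_0 add.commute)
  have hnat: "h (real n * t) = real n *\<^sub>R h t" for n t
    by (induction n) (simp_all add: h0 distrib_right hadd scaleR_add_left)
  have hn1: "h (real n) = 0" for n using hnat[of n 1] by (simp add: h_def)
  have hint: "h (of_int k) = 0" for k
    using hn1[of "nat k"] hn1[of "nat (- k)"] hminus[of "of_int k"] by (cases "k \<ge> 0") auto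
  have hB: "norm (h t) \<le> B + norm (f 1)" for t
  proof -
    have "h t = h (frac t)" using hadd[of "frac t" "of_int \<lfloor>t\<rfloor>"] by (simp add: hint frac_def)
    also have "norm \<dots> \<le> norm (f (frac t)) + norm (frac t *\<^sub>R f 1)"
      unfolding h_def by (rule norm_triangle_ineq4)
    also have "\<dots> \<le> B + norm (f 1)"
      using bound[of "frac t"] frac_lt_1[of t] by (intro add_mono) (auto simp: mult_left_le_one_le)
    finally show ?thesis .
  qed
  have "norm (h t) = 0"
  proof (rule ccontr)
    assume "norm (h t) \<noteq> 0"
    then obtain n where "B + norm (f 1) < real n * norm (h t)"
      using reals_Archimedean3[of "norm (h t)"] by auto
    then show False using hB[of "real n * t"] by (simp add: hnat)
  qed
  then show ?thesis by (simp add: h_def)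
qed


section \<open>The inner product of the dual module\<close>

text \<open>These operations turn \<open>y \<mapsto> \<langle>\<cdot>, y\<rangle>\<close> into a module map.\<close>

definition dual_smult :: "complex \<Rightarrow> ('m \<Rightarrow> 'a::cstar_algebra) \<Rightarrow> 'm \<Rightarrow> 'a"
  where "dual_smult c r = (\<lambda>x. cscale (cnj c) (r x))"

definition dual_lact :: "'a::cstar_algebra \<Rightarrow> ('m \<Rightarrow> 'a) \<Rightarrow> 'm \<Rightarrow> 'a"
  where "dual_lact a r = (\<lambda>x. r x * cstar a)"

lemma dual_smult_add: "dual_smult c (r + s) = dual_smult c r + dual_smult c s"
  and dual_smult_diff: "dual_smult c (r - s) = dual_smult c r - dual_smult c s"
  and dual_smult_add_left: "dual_smult (c + d) r = dual_smult c r + dual_smult d r"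
  and dual_smult_mult: "dual_smult (c * d) r = dual_smult c (dual_smult d r)"
  and dual_smult_one: "dual_smult 1 r = r"
  and dual_smult_zero: "dual_smult 0 r = 0"
  and dual_smult_minus_one: "dual_smult (- 1) r = - r"
  and dual_lact_add: "dual_lact a (r + s) = dual_lact a r + dual_lact a s"
  and dual_lact_add_left: "dual_lact (a + b) r = dual_lact a r + dual_lact b r"
  and dual_lact_minus_left: "dual_lact (- a) r = - dual_lact a r"
  and dual_lact_diff: "dual_lact a (r - s) = dual_lact a r - dual_lact a s"
  and dual_lact_smult: "dual_lact a (dual_smult c r) = dual_smult c (dual_lact a r)"
  and dual_lact_cscale: "dual_lact (cscale c a) r = dual_smult c (dual_lact a r)"
  and dual_lact_mult: "dual_lact (a * b) r = dual_lact a (dual_lact b r)"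
  by (auto simp: dual_smult_def dual_lact_def fun_eq_iff cscale_simps cscale_add_left algebra_simps
      cstar_add cstar_minus cstar_cscale cstar_mult)

locale monotone_complete_module = pre_hilbert_module M
  for M :: "('a::cstar_algebra, 'm) hilbert_mod" (structure) +
  assumes monotone_complete: "monotone_complete TYPE('a)"
begin

abbreviation functional :: "('m \<Rightarrow> 'a) \<Rightarrow> bool"
  where "functional r \<equiv> bounded_module_functional M r"

lemma functional_add_fun [simp]:
  assumes "functional r" "functional s"
  shows "functional (r + s)"
proof -
  obtain C D where "\<And>x. x \<in> carrier M \<Longrightarrow> norm (r x) \<le> C * hnorm M x"
    "\<And>x. x \<in> carrier M \<Longrightarrow> norm (s x) \<le> D * hnorm M x"
    using functional_bound assms by metis
  then have "norm (r x + s x) \<le> (C + D) * hnorm M x" if "x \<in> carrier M" for x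
    unfolding distrib_right using that by (intro order.trans[OF norm_triangle_ineq] add_mono)
  then have "\<exists>C. \<forall>x\<in>carrier M. norm (r x + s x) \<le> C * hnorm M x" by blast
  then show ?thesis
    using assms unfolding bounded_module_functional_def by (simp add: cscale_simps algebra_simps)
qed

lemma functional_dual_smult [simp]:
  assumes "functional r"
  shows "functional (dual_smult c r)"
proof -
  obtain C where C: "\<And>x. x \<in> carrier M \<Longrightarrow> norm (r x) \<le> C * hnorm M x"
    using functional_bound assms by metis
  have "norm (dual_smult c r x) \<le> (cmod c * C) * hnorm M x" if "x \<in> carrier M" for x
    using C[OF that] by (simp add: dual_smult_def norm_cscale mult.assoc mult_left_mono)
  then have "\<exists>C. \<forall>x\<in>carrier M. norm (dual_smult c r x) \<le> C * hnorm M x" by blast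
  then show ?thesis
    using assms unfolding bounded_module_functional_def
    by (simp add: dual_smult_def cscale_simps algebra_simps)
qed

lemma functional_dual_lact [simp]:
  assumes "functional r"
  shows "functional (dual_lact a r)"
proof -
  obtain C where C: "\<And>x. x \<in> carrier M \<Longrightarrow> norm (r x) \<le> C * hnorm M x"
    using functional_bound assms by metis
  have "norm (dual_lact a r x) \<le> (C * norm a) * hnorm M x" if "x \<in> carrier M" for x
  proof -
    have "norm (r x * cstar a) \<le> norm (r x) * norm a" using norm_mult_ineq[of "r x" "cstar a"] by simp
    also have "\<dots> \<le> (C * hnorm M x) * norm a" using C[OF that] by (intro mult_right_mono) auto
    finally show ?thesis by (simp add: dual_lact_def algebra_simps)
  qed
  then have "\<exists>C. \<forall>x\<in>carrier M. norm (dual_lact a r x) \<le> C * hnorm M x" by blast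
  then show ?thesis
    using assms unfolding bounded_module_functional_def
    by (simp add: dual_lact_def cscale_simps algebra_simps)
qed

lemma functional_minus_fun [simp]: "functional r \<Longrightarrow> functional (- r)"
  using functional_dual_smult[of r "- 1"] by (simp add: dual_smult_minus_one)

lemma functional_diff_fun [simp]: "functional r \<Longrightarrow> functional s \<Longrightarrow> functional (r - s)"
  using functional_add_fun[of r "- s"] by simp

lemma functional_zero_fun [simp]: "functional 0"
  using functional_dual_smult[OF inner_functional[OF zero_closed], of 0] by (simp add: dual_smult_zero)

section \<open>The square of a functional as a least upper bound\<close>

definition gap :: "('m \<Rightarrow> 'a) \<Rightarrow> 'm \<Rightarrow> 'a"
  where "gap r x = r x + cstar (r x) - ip M x x"

text \<open>For \<open>r = \<langle>\<cdot>, y\<rangle>\<close> the value is \<open>\<langle>y, y\<rangle>\<close>, as \<open>gap r x = \<langle>y, y\<rangle> - \<langle>x - y, x - y\<rangle>\<close>.\<close>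

definition dual_sq :: "('m \<Rightarrow> 'a) \<Rightarrow> 'a"
  where "dual_sq r = (THE s. is_lub (gap r ` carrier M) s)"

text \<open>The values of the regularized maximization problems over finitely generated submodules form
  an increasing net with the same upper bounds as the values of \<open>gap r\<close>.\<close>

lemma exists_lub_gap:
  assumes r: "functional r"
  shows "\<exists>s. is_lub (gap r ` carrier M) s"
proof -
  define V where "V = {r (lin_comb F a) |F \<epsilon> a.
    finite F \<and> F \<subseteq> carrier M \<and> \<epsilon> > 0 \<and> regular_solution F \<epsilon> r a}"
  obtain C where C: "C \<ge> 0" "\<And>x. x \<in> carrier M \<Longrightarrow> norm (r x) \<le> C * hnorm M x"
    using functional_bound[OF r] by metis
  have ip_le: "cstar_le (ip M (lin_comb F a) (lin_comb F a)) (r (lin_comb F a))"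
    if "finite F" "F \<subseteq> carrier M" "\<epsilon> > 0" "regular_solution F \<epsilon> r a" for F \<epsilon> a
  proof -
    have "positive (\<epsilon> *\<^sub>R (\<Sum>x\<in>F. a x * cstar (a x)))"
      using that(3) by (intro positive_scaleR positive_sum positive_mult_cstar_self) auto
    then show ?thesis
      using regular_solution_value(1)[OF r that(1,2,4)] by (simp add: cstar_le_def)
  qed
  have "\<exists>s. is_lub V s"
  proof (rule monotone_complete_is_lub[OF monotone_complete])
    have "regular_solution {} 1 r (\<lambda>_. 0)" by (simp add: regular_solution_def)
    then have "r (lin_comb {} (\<lambda>_. 0)) \<in> V"
      unfolding V_def by (auto intro!: exI[of _ "{}"] exI[of _ "1::real"] exI[of _ "\<lambda>_. 0"])
    then show "V \<noteq> {}" by auto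
  next
    fix v assume "v \<in> V"
    then show "self_adjoint v"
      unfolding V_def self_adjoint_def using regular_solution_value(2)[OF r] by auto
  next
    fix v assume "v \<in> V"
    then obtain F \<epsilon> a where v: "v = r (lin_comb F a)" and F: "finite F" "F \<subseteq> carrier M" "\<epsilon> > 0"
      "regular_solution F \<epsilon> r a"
      unfolding V_def by auto
    define h where "h = hnorm M (lin_comb F a)"
    \<comment> \<open>At the maximizer z, \<langle>z, z\<rangle> \<le> r(z) forces the norm of z
      below C. The resulting bound C C depends neither on F nor on \<epsilon>.\<close>
    have "norm (ip M (lin_comb F a) (lin_comb F a)) \<le> norm v"
      using ip_le[OF F] F(2) by (intro norm_le_if_order_le) (auto simp: v cstar_le_def ip_positive)
    moreover have nv: "norm v \<le> C * h" using C(2) F(2) by (simp add: v h_def)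
    ultimately have "h * h \<le> C * h"
      using hnorm_power2[of "lin_comb F a"] by (simp add: h_def power2_eq_square)
    moreover have "h \<ge> 0" by (simp add: h_def)
    ultimately have "h \<le> C" using C(1) by (cases "h = 0") auto
    then show "norm v \<le> C * C" using nv C(1) by (meson mult_left_mono order_trans)
  next
    fix v1 v2 assume "v1 \<in> V" "v2 \<in> V"
    then obtain F1 e1 a1 F2 e2 a2 where v: "v1 = r (lin_comb F1 a1)" "v2 = r (lin_comb F2 a2)"
      and F1: "finite F1" "F1 \<subseteq> carrier M" "e1 > 0" "regular_solution F1 e1 r a1"
      and F2: "finite F2" "F2 \<subseteq> carrier M" "e2 > 0" "regular_solution F2 e2 r a2"
      unfolding V_def by auto
    define F where "F = F1 \<union> F2"
    define e where "e = min e1 e2"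
    have F: "finite F" "F \<subseteq> carrier M" "e > 0" using F1 F2 by (auto simp: F_def e_def)
    obtain a where a: "regular_solution F e r a" using exists_regular_solution[OF F r] by blast
    \<comment> \<open>Adding generators and lowering the penalty both raise the maximum; the
      solution over G competes over F after padding with zeros.\<close>
    have le: "cstar_le (r (lin_comb G b)) (r (lin_comb F a))"
      if G: "finite G" "G \<subseteq> F" "e \<le> d" "regular_solution G d r b" for G b d
    proof -
      let ?b = "\<lambda>x. if x \<in> G then b x else 0"
      let ?N = "\<Sum>x\<in>G. b x * cstar (b x)"
      have GM: "G \<subseteq> carrier M" using G F by auto
      have "(\<Sum>x\<in>F. ?b x * cstar (?b x)) = ?N"
        using G(2) by (intro sum.mono_neutral_cong_right[OF F(1)]) auto
      moreover have "lin_comb F ?b = lin_comb G b" by (rule lin_comb_extend[OF F(1,2) G(2)])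
      ultimately have "cstar_le (r (lin_comb G b) + cstar (r (lin_comb G b))
          - ip M (lin_comb G b) (lin_comb G b) - e *\<^sub>R ?N) (r (lin_comb F a))"
        using regular_solution_optimal[OF r F(1,2) a, of ?b] F(3) by simp
      moreover have "r (lin_comb G b) + cstar (r (lin_comb G b))
          - ip M (lin_comb G b) (lin_comb G b) - e *\<^sub>R ?N = r (lin_comb G b) + (d - e) *\<^sub>R ?N"
        using regular_solution_value[OF r G(1) GM G(4)] by (simp add: algebra_simps)
      moreover have "positive ((d - e) *\<^sub>R ?N)"
        using G(3) by (intro positive_scaleR positive_sum positive_mult_cstar_self) auto
      then have "cstar_le (r (lin_comb G b)) (r (lin_comb G b) + (d - e) *\<^sub>R ?N)"
        by (simp add: cstar_le_def)
      ultimately show ?thesis using cstar_le_trans by metis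
    qed
    have "r (lin_comb F a) \<in> V" unfolding V_def using F a by blast
    moreover have "cstar_le v1 (r (lin_comb F a))" "cstar_le v2 (r (lin_comb F a))"
      unfolding v
      using le[OF F1(1) _ _ F1(4)] le[OF F2(1) _ _ F2(4)] by (simp_all add: F_def e_def)
    ultimately show "\<exists>z\<in>V. cstar_le v1 z \<and> cstar_le v2 z" by blast
  qed
  then obtain s where s: "is_lub V s" by blast
  have "is_lub (gap r ` carrier M) s"
    unfolding is_lub_def
  proof (intro conjI ballI allI impI)
    show "self_adjoint s" using s by (simp add: is_lub_def)
  next
    fix g assume "g \<in> gap r ` carrier M"
    then obtain x where x: "x \<in> carrier M" "g = gap r x" by auto
    \<comment> \<open>One generator suffices for one value of the gap: the maximum c r(x) over the
      multiples of x dominates it up to \<epsilon>.\<close>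
    have "cstar_le (r x + cstar (r x) - ip M x x) s"
    proof (rule order_le_if_shifted_quotients_le[OF ip_positive[OF x(1)]])
      fix \<epsilon> :: real assume \<epsilon>: "\<epsilon> > 0"
      then obtain a where a: "regular_solution {x} \<epsilon> r a"
        using exists_regular_solution[of "{x}" \<epsilon> r] r x(1) by auto
      have "a x * ip M x x + \<epsilon> *\<^sub>R a x = cstar (r x)"
        using a x(1) by (simp add: regular_solution_def ip_lin_comb)
      moreover have "r (lin_comb {x} a) \<in> V" unfolding V_def using \<epsilon> a x(1) by blast
      then have "cstar_le (a x * r x) s"
        using s x(1) functional_lin_comb[OF r, of "{x}" a] by (simp add: is_lub_def)
      ultimately show "\<exists>c. c * ip M x x + \<epsilon> *\<^sub>R c = cstar (r x) \<and> cstar_le (c * r x) s" by blast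
    qed
    then show "cstar_le g s" by (simp add: x(2) gap_def)
  next
    fix u assume u: "self_adjoint u \<and> (\<forall>g\<in>gap r ` carrier M. cstar_le g u)"
    have "cstar_le v u" if "v \<in> V" for v
    proof -
      from that obtain F \<epsilon> a where v: "v = r (lin_comb F a)"
        and F: "finite F" "F \<subseteq> carrier M" "\<epsilon> > 0" "regular_solution F \<epsilon> r a"
        unfolding V_def by auto
      \<comment> \<open>Removing the penalty at its own maximizer only raises the value.\<close>
      have "cstar_le v (gap r (lin_comb F a))"
        using ip_le[OF F] regular_solution_value(2)[OF r F(1,2,4)]
        by (simp add: v gap_def cstar_le_def)
      moreover have "cstar_le (gap r (lin_comb F a)) u" using u F(2) by simp
      ultimately show ?thesis by (rule cstar_le_trans)
    qed
    then show "cstar_le s u" using s u by (simp add: is_lub_def)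
  qed
  then show ?thesis by blast
qed

lemma is_lub_dual_sq: "functional r \<Longrightarrow> is_lub (gap r ` carrier M) (dual_sq r)"
  unfolding dual_sq_def using exists_lub_gap is_lub_unique by (metis theI)

lemma gap_le_dual_sq: "functional r \<Longrightarrow> x \<in> carrier M \<Longrightarrow> cstar_le (gap r x) (dual_sq r)"
  using is_lub_dual_sq by (auto simp: is_lub_def)

lemma dual_sq_le:
  "functional r \<Longrightarrow> self_adjoint u \<Longrightarrow> (\<And>x. x \<in> carrier M \<Longrightarrow> cstar_le (gap r x) u)
    \<Longrightarrow> cstar_le (dual_sq r) u"
  using is_lub_dual_sq by (auto simp: is_lub_def)

lemma cstar_dual_sq [simp]: "functional r \<Longrightarrow> cstar (dual_sq r) = dual_sq r"
  using is_lub_dual_sq by (auto simp: is_lub_def self_adjoint_def)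

lemma cstar_gap [simp]: "x \<in> carrier M \<Longrightarrow> cstar (gap r x) = gap r x"
  by (simp add: gap_def cstar_diff cstar_add cstar_cstar add.commute)

lemma positive_dual_sq: "functional r \<Longrightarrow> positive (dual_sq r)"
  using gap_le_dual_sq[of r \<zero>] functional_zero[of r] by (simp add: gap_def cstar_le_def)

lemma gap_dual_smult:
  "functional r \<Longrightarrow> x \<in> carrier M \<Longrightarrow> gap (dual_smult c r) (c \<odot> x) = (cmod c)\<^sup>2 *\<^sub>R gap r x"
  by (simp add: gap_def dual_smult_def functional_smult ip_smult ip_smult_right cscale_cscale
      cstar_cscale scaleR_eq_cscale cscale_add_right cscale_diff_right complex_norm_square mult.commute
      flip: of_real_power)

lemma dual_sq_zero [simp]: "dual_sq 0 = 0"
proof (rule cstar_le_antisym)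
  show "cstar_le (dual_sq 0) 0"
    by (rule dual_sq_le) (auto simp: gap_def self_adjoint_def cstar_le_def ip_positive)
  show "cstar_le 0 (dual_sq 0)" using positive_dual_sq[of 0] by (simp add: cstar_le_def)
qed

lemma dual_sq_smult:
  assumes "functional r"
  shows "dual_sq (dual_smult c r) = (cmod c)\<^sup>2 *\<^sub>R dual_sq r"
proof (cases "c = 0")
  case True
  then show ?thesis by (simp add: dual_smult_zero)
next
  case False
  have le: "cstar_le ((cmod c)\<^sup>2 *\<^sub>R dual_sq r) (dual_sq (dual_smult c r))"
    if r: "functional r" and c: "c \<noteq> 0" for c r
  proof -
    let ?k = "inverse ((cmod c)\<^sup>2)"
    have k: "?k > 0" using c by simp
    have "cstar_le (dual_sq r) (?k *\<^sub>R dual_sq (dual_smult c r))"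
    proof (rule dual_sq_le[OF r])
      show "self_adjoint (?k *\<^sub>R dual_sq (dual_smult c r))"
        using r by (simp add: self_adjoint_def cstar_scaleR)
      fix x assume x: "x \<in> carrier M"
      have "cstar_le (?k *\<^sub>R gap (dual_smult c r) (c \<odot> x)) (?k *\<^sub>R dual_sq (dual_smult c r))"
        using r x k by (intro cstar_le_scaleR gap_le_dual_sq) auto
      then show "cstar_le (gap r x) (?k *\<^sub>R dual_sq (dual_smult c r))"
        using gap_dual_smult[OF r x, of c] c by simp
    qed
    from cstar_le_scaleR[OF this, of "(cmod c)\<^sup>2"] show ?thesis using c by simp
  qed
  have "cstar_le (dual_sq (dual_smult c r)) ((cmod c)\<^sup>2 *\<^sub>R dual_sq r)"
  proof -
    have "dual_smult (1 / c) (dual_smult c r) = r"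
      using False by (simp add: dual_smult_one flip: dual_smult_mult)
    then have "cstar_le ((cmod (1 / c))\<^sup>2 *\<^sub>R dual_sq (dual_smult c r)) (dual_sq r)"
      using le[of "dual_smult c r" "1 / c"] False assms by simp
    from cstar_le_scaleR[OF this, of "(cmod c)\<^sup>2"] show ?thesis
      using False by (simp add: norm_divide power_divide)
  qed
  then show ?thesis using le[OF assms False] cstar_le_antisym by blast
qed

lemma dual_sq_minus: "functional r \<Longrightarrow> dual_sq (- r) = dual_sq r"
  using dual_sq_smult[of r "- 1"] by (simp add: dual_smult_minus_one)

text \<open>The gaps of r + s at x + y and of r - s at x - y add up to twice those of r at x and s
  at y. Least upper bounds taken in x and then in y give one inequality.\<close>

lemma dual_sq_parallelogram:
  assumes "functional r" "functional s"
  shows "dual_sq (r + s) + dual_sq (r - s) = 2 *\<^sub>R dual_sq r + 2 *\<^sub>R dual_sq s"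
proof (rule cstar_le_antisym)
  have le: "cstar_le (2 *\<^sub>R dual_sq r + 2 *\<^sub>R dual_sq s) (dual_sq (r + s) + dual_sq (r - s))"
    if r: "functional r" and s: "functional s" for r s
  proof -
    define W where "W = (1/2) *\<^sub>R (dual_sq (r + s) + dual_sq (r - s))"
    have W: "cstar W = W" using r s by (simp add: W_def cstar_scaleR cstar_add)
    have 1: "cstar_le (gap r x) (W - gap s y)" if x: "x \<in> carrier M" and y: "y \<in> carrier M" for x y
    proof -
      have "gap (r + s) (x \<oplus> y) + gap (r - s) (x \<ominus> y) = 2 *\<^sub>R gap r x + 2 *\<^sub>R gap s y"
        using x y by (simp add: gap_def functional_add[OF r] functional_add[OF s]
            functional_diff[OF r] functional_diff[OF s] ip_simps cstar_add cstar_diff scaleR_2 algebra_simps)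
      moreover have "cstar_le (gap (r + s) (x \<oplus> y) + gap (r - s) (x \<ominus> y))
          (dual_sq (r + s) + dual_sq (r - s))"
        using r s x y by (intro cstar_le_add gap_le_dual_sq) auto
      ultimately have "cstar_le ((1/2) *\<^sub>R (2 *\<^sub>R gap r x + 2 *\<^sub>R gap s y)) W"
        unfolding W_def by (intro cstar_le_scaleR) auto
      then show ?thesis by (simp add: cstar_le_def scaleR_add_right algebra_simps)
    qed
    have "cstar_le (dual_sq r) (W - gap s y)" if y: "y \<in> carrier M" for y
      using 1 y by (intro dual_sq_le[OF r]) (auto simp: self_adjoint_def cstar_diff W)
    then have "cstar_le (gap s y) (W - dual_sq r)" if y: "y \<in> carrier M" for y
      using y by (simp add: cstar_le_def algebra_simps)
    then have "cstar_le (dual_sq s) (W - dual_sq r)"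
      using r by (intro dual_sq_le[OF s]) (auto simp: self_adjoint_def cstar_diff W)
    then have "cstar_le (2 *\<^sub>R dual_sq s) (2 *\<^sub>R (W - dual_sq r))" by (rule cstar_le_scaleR) simp
    then show ?thesis by (simp add: W_def cstar_le_def scaleR_diff_right algebra_simps)
  qed
  show "cstar_le (2 *\<^sub>R dual_sq r + 2 *\<^sub>R dual_sq s) (dual_sq (r + s) + dual_sq (r - s))"
    by (rule le[OF assms])
  have two: "dual_sq (r + r) = 4 *\<^sub>R dual_sq r" if "functional r" for r
  proof -
    have "dual_smult 2 r = r + r" using dual_smult_add_left[of 1 1 r] by (simp add: dual_smult_one)
    then show ?thesis using dual_sq_smult[OF that, of 2] by simp
  qed
  \<comment> \<open>The reverse inequality is the first one for r + s and r - s, whose sum and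
    difference are 2 r and 2 s.\<close>
  have "(r + s) + (r - s) = r + r" "(r + s) - (r - s) = s + s" by (simp_all add: algebra_simps)
  then have "cstar_le (2 *\<^sub>R dual_sq (r + s) + 2 *\<^sub>R dual_sq (r - s)) (4 *\<^sub>R dual_sq r + 4 *\<^sub>R dual_sq s)"
    using le[of "r + s" "r - s"] assms by (simp add: two)
  then have "cstar_le ((1/2) *\<^sub>R (2 *\<^sub>R dual_sq (r + s) + 2 *\<^sub>R dual_sq (r - s)))
      ((1/2) *\<^sub>R (4 *\<^sub>R dual_sq r + 4 *\<^sub>R dual_sq s))"
    by (rule cstar_le_scaleR) simp
  then show "cstar_le (dual_sq (r + s) + dual_sq (r - s)) (2 *\<^sub>R dual_sq r + 2 *\<^sub>R dual_sq s)"
    by (simp add: scaleR_add_right)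
qed

text \<open>The translation x \<mapsto> x + y is a bijection of M under which the gap changes by a
  constant.\<close>

lemma dual_sq_shift:
  assumes s: "functional s" and y: "y \<in> carrier M"
  shows "dual_sq (s + (\<lambda>x. ip M x y)) = dual_sq s + s y + cstar (s y) + ip M y y"
proof -
  have sy: "functional (s + (\<lambda>x. ip M x y))" using s y by (simp add: inner_functional)
  have shift: "gap (s + (\<lambda>x. ip M x y)) (x \<oplus> y) = gap s x + (s y + cstar (s y) + ip M y y)"
    if "x \<in> carrier M" for x
    using that y ip_cstar[of x y]
    by (simp add: gap_def functional_add[OF s] ip_simps cstar_add algebra_simps)
  show ?thesis
  proof (rule cstar_le_antisym)
    show "cstar_le (dual_sq (s + (\<lambda>x. ip M x y))) (dual_sq s + s y + cstar (s y) + ip M y y)"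
    proof (rule dual_sq_le[OF sy])
      show "self_adjoint (dual_sq s + s y + cstar (s y) + ip M y y)"
        using s y by (simp add: self_adjoint_def cstar_add cstar_cstar algebra_simps)
      fix x assume x: "x \<in> carrier M"
      have "(x \<ominus> y) \<oplus> y = x" using x y by (simp add: minus_eq a_assoc l_neg)
      then have "gap (s + (\<lambda>x. ip M x y)) x = gap s (x \<ominus> y) + (s y + cstar (s y) + ip M y y)"
        using shift[of "x \<ominus> y"] x y by simp
      then show "cstar_le (gap (s + (\<lambda>x. ip M x y)) x) (dual_sq s + s y + cstar (s y) + ip M y y)"
        using cstar_le_add[OF gap_le_dual_sq[OF s, of "x \<ominus> y"] cstar_le_refl, of "s y + cstar (s y) + ip M y y"]
          x y by (simp add: add.assoc)
    qed
    have "cstar_le (dual_sq s) (dual_sq (s + (\<lambda>x. ip M x y)) - (s y + cstar (s y) + ip M y y))"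
    proof (rule dual_sq_le[OF s])
      show "self_adjoint (dual_sq (s + (\<lambda>x. ip M x y)) - (s y + cstar (s y) + ip M y y))"
        using sy y by (simp add: self_adjoint_def cstar_add cstar_diff cstar_cstar algebra_simps)
      fix x assume x: "x \<in> carrier M"
      show "cstar_le (gap s x) (dual_sq (s + (\<lambda>x. ip M x y)) - (s y + cstar (s y) + ip M y y))"
        using gap_le_dual_sq[OF sy, of "x \<oplus> y"] x y
        by (simp add: shift cstar_le_def algebra_simps)
    qed
    then show "cstar_le (dual_sq s + s y + cstar (s y) + ip M y y) (dual_sq (s + (\<lambda>x. ip M x y)))"
      by (simp add: cstar_le_def algebra_simps)
  qed
qed

text \<open>The substitution x \<mapsto> (1 + a) x conjugates the gap by 1 + a, and conjugation
  commutes with least upper bounds. The quasi-inverse of a makes the substitution onto.\<close>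

lemma dual_sq_lact_perturbation:
  assumes r: "functional r" and a: "norm a < 1"
  shows "dual_sq (r + dual_lact a r)
    = dual_sq r + a * dual_sq r + dual_sq r * cstar a + a * dual_sq r * cstar a"
proof -
  let ?f = "\<lambda>g. g + a * g + g * cstar a + a * g * cstar a"
  obtain b where b: "a + b + a * b = 0" using exists_quasi_inverse[OF a] by blast
  have "gap (r + dual_lact a r) (x \<oplus> a \<triangleright> x) = ?f (gap r x)" if "x \<in> carrier M" for x
    using that by (simp add: gap_def dual_lact_def functional_add[OF r] functional_lact[OF r] ip_simps
        cstar_add cstar_mult cstar_cstar algebra_simps)
  then have "gap (r + dual_lact a r) ` (\<lambda>x. x \<oplus> a \<triangleright> x) ` carrier M = ?f ` gap r ` carrier M"
    by (simp add: image_image cong: image_cong)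
  moreover have "(\<lambda>x. x \<oplus> a \<triangleright> x) ` carrier M = carrier M"
  proof
    show "carrier M \<subseteq> (\<lambda>x. x \<oplus> a \<triangleright> x) ` carrier M"
    proof
      fix x assume x: "x \<in> carrier M"
      define x' where "x' = x \<oplus> b \<triangleright> x"
      have x': "x' \<in> carrier M" using x by (simp add: x'_def)
      have "x = x' \<oplus> a \<triangleright> x'"
      proof (rule eq_if_ip_eq)
        fix z assume z: "z \<in> carrier M"
        have "ip M z (x' \<oplus> a \<triangleright> x') = ip M z x + ip M z x * cstar (a + b + a * b)"
          using x z by (simp add: x'_def ip_simps cstar_add cstar_mult algebra_simps)
        then show "ip M z x = ip M z (x' \<oplus> a \<triangleright> x')" by (simp add: b)
      qed (use x x' in auto)
      with x' show "x \<in> (\<lambda>x. x \<oplus> a \<triangleright> x) ` carrier M" by blast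
    qed
  qed auto
  ultimately have "is_lub (gap (r + dual_lact a r) ` carrier M) (?f (dual_sq r))"
    using is_lub_conj[OF is_lub_dual_sq[OF r] a] by simp
  then show ?thesis
    using is_lub_dual_sq[of "r + dual_lact a r"] r is_lub_unique by auto
qed

section \<open>Polarization\<close>

text \<open>This will be twice the sum of \<open>dual_ip r s\<close> and its adjoint; the term with
  \<i> in \<open>dual_ip\<close> supplies the remaining skew part.\<close>

definition dual_polar :: "('m \<Rightarrow> 'a) \<Rightarrow> ('m \<Rightarrow> 'a) \<Rightarrow> 'a"
  where "dual_polar r s = dual_sq (r + s) - dual_sq (r - s)"

definition dual_ip :: "('m \<Rightarrow> 'a) \<Rightarrow> ('m \<Rightarrow> 'a) \<Rightarrow> 'a"
  where "dual_ip r s = (1/4) *\<^sub>R (dual_polar r s + cscale \<i> (dual_polar r (dual_smult \<i> s)))"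

lemma dual_polar_commute: "functional r \<Longrightarrow> functional s \<Longrightarrow> dual_polar r s = dual_polar s r"
  using dual_sq_minus[of "r - s"] by (simp add: dual_polar_def add.commute)

lemma dual_polar_zero [simp]: "functional s \<Longrightarrow> dual_polar 0 s = 0"
  using dual_sq_minus[of s] by (simp add: dual_polar_def)

text \<open>The argument of Jordan and von Neumann: subtract the parallelogram laws for the pairs r
  + s, r' + s and r - s, r' - s.\<close>

lemma dual_polar_add:
  assumes "functional r" "functional r'" "functional s"
  shows "dual_polar (r + r') s = dual_polar r s + dual_polar r' s"
proof -
  have sum: "dual_polar (r + r') (s + s) = 2 *\<^sub>R (dual_polar r s + dual_polar r' s)"
    if "functional r" "functional r'" "functional s" for r r' s
  proof -
    have "dual_sq ((r + s) + (r' + s)) + dual_sq ((r + s) - (r' + s))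
        = 2 *\<^sub>R dual_sq (r + s) + 2 *\<^sub>R dual_sq (r' + s)"
      using that by (intro dual_sq_parallelogram) auto
    moreover have "dual_sq ((r - s) + (r' - s)) + dual_sq ((r - s) - (r' - s))
        = 2 *\<^sub>R dual_sq (r - s) + 2 *\<^sub>R dual_sq (r' - s)"
      using that by (intro dual_sq_parallelogram) auto
    moreover have "(r + s) + (r' + s) = (r + r') + (s + s)" "(r + s) - (r' + s) = r - r'"
      "(r - s) + (r' - s) = (r + r') - (s + s)" "(r - s) - (r' - s) = r - r'"
      by (simp_all add: algebra_simps)
    ultimately have "dual_sq ((r + r') + (s + s)) + dual_sq (r - r')
        - (dual_sq ((r + r') - (s + s)) + dual_sq (r - r'))
        = (2 *\<^sub>R dual_sq (r + s) + 2 *\<^sub>R dual_sq (r' + s))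
        - (2 *\<^sub>R dual_sq (r - s) + 2 *\<^sub>R dual_sq (r' - s))" by (simp only:)
    then show ?thesis
      unfolding dual_polar_def scaleR_diff_right scaleR_add_right by (simp only: add_diff_add) simp
  qed
  \<comment> \<open>The case of a zero second functional converts the doubled argument into a factor
    2.\<close>
  have "dual_polar (r + r') (s + s) = 2 *\<^sub>R dual_polar (r + r') s"
    using sum[of "r + r'" 0 s] assms by simp
  then have "2 *\<^sub>R dual_polar (r + r') s = 2 *\<^sub>R (dual_polar r s + dual_polar r' s)"
    using sum[OF assms] by simp
  then show ?thesis by (simp only: scaleR_cancel_left) simp
qed

text \<open>The map is additive in t. For t in [0, 1] it is bounded, since the two squares in the
  parallelogram law are positive and their sum is bounded.\<close>

lemma dual_polar_scaleR:
  assumes r: "functional r" and s: "functional s"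
  shows "dual_polar (dual_smult (complex_of_real t) r) s = t *\<^sub>R dual_polar r s"
proof -
  let ?f = "\<lambda>t. dual_polar (dual_smult (complex_of_real t) r) s"
  let ?B = "2 * norm (dual_sq r) + 2 * norm (dual_sq s)"
  have "?f t = t *\<^sub>R ?f 1"
  proof (rule additive_bounded_imp_scaleR)
    show "?f (u + v) = ?f u + ?f v" for u v
      using r s by (simp add: dual_smult_add_left dual_polar_add)
    fix t :: real assume t: "0 \<le> t" "t \<le> 1"
    let ?r = "dual_smult (complex_of_real t) r"
    have tr: "functional ?r" using r by simp
    have par: "dual_sq (?r + s) + dual_sq (?r - s) = 2 *\<^sub>R dual_sq ?r + 2 *\<^sub>R dual_sq s"
      by (rule dual_sq_parallelogram[OF tr s])
    have "norm (2 *\<^sub>R dual_sq ?r + 2 *\<^sub>R dual_sq s) \<le> ?B"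
    proof -
      have "norm (dual_sq ?r) \<le> norm (dual_sq r)"
        using t by (simp add: dual_sq_smult[OF r] mult_left_le_one_le power_le_one)
      then show ?thesis
        using norm_triangle_ineq[of "2 *\<^sub>R dual_sq ?r" "2 *\<^sub>R dual_sq s"] by simp
    qed
    moreover have "norm (dual_sq (?r + s)) \<le> norm (dual_sq (?r + s) + dual_sq (?r - s))"
      "norm (dual_sq (?r - s)) \<le> norm (dual_sq (?r + s) + dual_sq (?r - s))"
      using tr s by (auto intro!: norm_le_if_order_le positive_dual_sq)
    ultimately have "norm (dual_sq (?r + s)) \<le> ?B" "norm (dual_sq (?r - s)) \<le> ?B"
      unfolding par by linarith+
    then show "norm (?f t) \<le> 2 * ?B"
      unfolding dual_polar_def mult_2 by (intro order.trans[OF norm_triangle_ineq4] add_mono)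
  qed
  then show ?thesis by (simp add: dual_smult_one)
qed

lemma dual_polar_i_i:
  assumes "functional r" "functional s"
  shows "dual_polar (dual_smult \<i> r) (dual_smult \<i> s) = dual_polar r s"
  using assms by (simp add: dual_polar_def dual_sq_smult flip: dual_smult_add dual_smult_diff)

lemma dual_polar_i_left:
  assumes "functional r" "functional s"
  shows "dual_polar (dual_smult \<i> r) s = - dual_polar r (dual_smult \<i> s)"
proof -
  have ii: "dual_smult \<i> (dual_smult \<i> r) = dual_smult (complex_of_real (-1)) r"
    by (simp flip: dual_smult_mult)
  have "dual_polar (dual_smult \<i> r) s = dual_polar (dual_smult \<i> (dual_smult \<i> r)) (dual_smult \<i> s)"
    using assms by (intro dual_polar_i_i[symmetric]) auto
  then show ?thesis using dual_polar_scaleR[OF assms(1), of "dual_smult \<i> s" "-1"] assms(2)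
    unfolding ii by simp
qed

lemma dual_ip_add:
  "functional r \<Longrightarrow> functional r' \<Longrightarrow> functional s \<Longrightarrow> dual_ip (r + r') s = dual_ip r s + dual_ip r' s"
  by (simp add: dual_ip_def dual_polar_add cscale_add_right scaleR_add_right algebra_simps)

lemma dual_ip_smult:
  assumes r: "functional r" and s: "functional s"
  shows "dual_ip (dual_smult c r) s = cscale c (dual_ip r s)"
proof -
  have re: "dual_ip (dual_smult (complex_of_real t) r) s = t *\<^sub>R dual_ip r s" if "functional r" for t r
    using that s by (simp add: dual_ip_def dual_polar_scaleR cscale_scaleR scaleR_add_right)
  have im: "dual_ip (dual_smult \<i> r) s = cscale \<i> (dual_ip r s)"
  proof -
    have "dual_polar (dual_smult \<i> r) (dual_smult \<i> s) = dual_polar r s"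
      by (rule dual_polar_i_i[OF r s])
    then show ?thesis
      unfolding dual_ip_def
      by (simp add: dual_polar_i_left[OF r s] cscale_scaleR cscale_simps cscale_minus_left)
  qed
  have "dual_smult c r = dual_smult (complex_of_real (Re c)) r
      + dual_smult (complex_of_real (Im c)) (dual_smult \<i> r)"
  proof -
    have "dual_smult c r = dual_smult (complex_of_real (Re c) + complex_of_real (Im c) * \<i>) r"
      using complex_eq[of c] by (simp add: mult.commute)
    then show ?thesis by (simp add: dual_smult_add_left dual_smult_mult)
  qed
  then have "dual_ip (dual_smult c r) s = Re c *\<^sub>R dual_ip r s + Im c *\<^sub>R cscale \<i> (dual_ip r s)"
    using r s by (simp add: dual_ip_add re im)
  also have "\<dots> = cscale (complex_of_real (Re c) + complex_of_real (Im c) * \<i>) (dual_ip r s)"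
    by (simp add: scaleR_eq_cscale cscale_cscale cscale_add_left)
  also have "complex_of_real (Re c) + complex_of_real (Im c) * \<i> = c"
    using complex_eq[of c] by (simp add: mult.commute)
  finally show ?thesis .
qed

lemma dual_ip_cstar:
  assumes "functional r" "functional s"
  shows "dual_ip s r = cstar (dual_ip r s)"
proof -
  have "dual_polar s (dual_smult \<i> r) = - dual_polar r (dual_smult \<i> s)"
    using dual_polar_i_left[of r s] dual_polar_commute[of s "dual_smult \<i> r"] assms by simp
  moreover have "cstar (dual_polar r s) = dual_polar r s" if "functional r" "functional s" for r s
    using that by (simp add: dual_polar_def cstar_diff)
  ultimately show ?thesis
    using assms dual_polar_commute[of s r]
    by (simp add: dual_ip_def cstar_scaleR cstar_add cstar_cscale cscale_minus_left cscale_minus_right)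
qed

lemma dual_ip_self:
  assumes r: "functional r"
  shows "dual_ip r r = dual_sq r"
proof -
  let ?p = "dual_polar r (dual_smult \<i> r)"
  have "?p = - ?p"
    using dual_polar_i_left[OF r r] dual_polar_commute[of "dual_smult \<i> r" r] r by simp
  then have "2 *\<^sub>R ?p = 0" by (simp add: scaleR_2 eq_neg_iff_add_eq_0)
  then have "?p = 0" by simp
  moreover have "dual_smult 2 r = r + r" using dual_smult_add_left[of 1 1 r] by (simp add: dual_smult_one)
  then have "dual_polar r r = 4 *\<^sub>R dual_sq r"
    using dual_sq_smult[OF r, of 2] by (simp add: dual_polar_def)
  ultimately show ?thesis by (simp add: dual_ip_def)
qed

lemma dual_ip_add_right:
  "functional r \<Longrightarrow> functional r' \<Longrightarrow> functional s \<Longrightarrow> dual_ip s (r + r') = dual_ip s r + dual_ip s r'"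
  using dual_ip_add[of r r' s] dual_ip_cstar[of "r + r'" s] dual_ip_cstar[of r s] dual_ip_cstar[of r' s]
  by (simp add: cstar_add)

lemma dual_ip_smult_right:
  "functional r \<Longrightarrow> functional s \<Longrightarrow> dual_ip s (dual_smult c r) = cscale (cnj c) (dual_ip s r)"
  using dual_ip_smult[of r s c] dual_ip_cstar[of "dual_smult c r" s] dual_ip_cstar[of r s]
  by (simp add: cstar_cscale)

text \<open>The identity for \<open>dual_sq (r + a r)\<close> is polarized in the functional, and then in \<open>a\<close> by
  comparing \<open>a\<close>, \<open>-a\<close> and \<open>ia\<close>.\<close>

lemma dual_ip_lact:
  assumes r: "functional r" and s: "functional s"
  shows "dual_ip (dual_lact a r) s = a * dual_ip r s"
proof -
  have polar: "dual_ip (r + dual_lact a r) (s + dual_lact a s)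
      = dual_ip r s + a * dual_ip r s + dual_ip r s * cstar a + a * dual_ip r s * cstar a"
    if a: "norm a < 1" for a
  proof -
    have pp: "dual_polar (r + dual_lact a r) (s + dual_lact a s)
      = dual_polar r s + a * dual_polar r s + dual_polar r s * cstar a + a * dual_polar r s * cstar a"
      if s: "functional s" for s
    proof -
      have "(r + dual_lact a r) + (s + dual_lact a s) = (r + s) + dual_lact a (r + s)"
        "(r + dual_lact a r) - (s + dual_lact a s) = (r - s) + dual_lact a (r - s)"
        by (simp_all add: dual_lact_add dual_lact_diff algebra_simps)
      then have "dual_polar (r + dual_lact a r) (s + dual_lact a s)
          = dual_sq ((r + s) + dual_lact a (r + s)) - dual_sq ((r - s) + dual_lact a (r - s))"
        by (simp only: dual_polar_def)
      also have "\<dots> = dual_polar r s + a * dual_polar r s + dual_polar r s * cstar a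
          + a * dual_polar r s * cstar a"
        using r s by (simp only: dual_sq_lact_perturbation[OF functional_add_fun a]
            dual_sq_lact_perturbation[OF functional_diff_fun a] dual_polar_def) (simp add: algebra_simps)
      finally show ?thesis .
    qed
    have "dual_smult \<i> (s + dual_lact a s) = dual_smult \<i> s + dual_lact a (dual_smult \<i> s)"
      by (simp add: dual_smult_add dual_lact_smult)
    then show ?thesis
      using s by (simp add: dual_ip_def pp cscale_simps scaleR_add_right algebra_simps)
  qed
  have quad: "dual_ip (dual_lact a r) s + dual_ip r (dual_lact a s) + dual_ip (dual_lact a r) (dual_lact a s)
      = a * dual_ip r s + dual_ip r s * cstar a + a * dual_ip r s * cstar a" if "norm a < 1" for a
    using polar[OF that] r s by (simp add: dual_ip_add dual_ip_add_right algebra_simps)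
  have smult_neg: "dual_ip (- r) s = - dual_ip r s" "dual_ip r (- s) = - dual_ip r s"
    if "functional r" "functional s" for r s
    using dual_ip_smult[OF that, of "-1"] dual_ip_smult_right[OF that(2,1), of "-1"]
    by (simp_all add: dual_smult_minus_one cscale_minus_left)
  have lin: "dual_ip (dual_lact a r) s + dual_ip r (dual_lact a s) = a * dual_ip r s + dual_ip r s * cstar a"
    if a: "norm a < 1" for a
  proof -
    let ?u = "dual_ip (dual_lact a r) s + dual_ip r (dual_lact a s)"
    let ?v = "a * dual_ip r s + dual_ip r s * cstar a"
    let ?z = "dual_ip (dual_lact a r) (dual_lact a s)" and ?w = "a * dual_ip r s * cstar a"
    have "?u + ?z = ?v + ?w" using quad[OF a] .
    moreover have "- ?u + ?z = - ?v + ?w"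
      using quad[of "- a"] a r s by (simp add: dual_lact_minus_left smult_neg cstar_minus)
    moreover have "2 *\<^sub>R u = 2 *\<^sub>R v" if "u + z = v + w" "- u + z = - v + w" for u v z w :: 'a
    proof -
      from that have "(u + z) - (- u + z) = (v + w) - (- v + w)" by (simp only:)
      then show ?thesis by (simp add: scaleR_2)
    qed
    ultimately have "2 *\<^sub>R ?u = 2 *\<^sub>R ?v" by blast
    then show ?thesis by (simp only: scaleR_cancel_left) simp
  qed
  have small: "dual_ip (dual_lact a r) s = a * dual_ip r s" if a: "norm a < 1" for a
  proof -
    let ?X = "dual_ip (dual_lact a r) s" and ?Y = "dual_ip r (dual_lact a s)"
    let ?P = "a * dual_ip r s" and ?Q = "dual_ip r s * cstar a"
    \<comment> \<open>Replacing a by i a multiplies the first term by i and the second, which is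
      conjugate linear in a, by -i.\<close>
    have "cscale \<i> ?X - cscale \<i> ?Y = cscale \<i> ?P - cscale \<i> ?Q"
      using lin[of "cscale \<i> a"] a r s
      by (simp add: norm_cscale dual_lact_cscale dual_ip_smult dual_ip_smult_right cstar_cscale
          cscale_simps cscale_minus_left)
    then have "cscale (- \<i>) (cscale \<i> (?X - ?Y)) = cscale (- \<i>) (cscale \<i> (?P - ?Q))"
      by (simp only: cscale_diff_right)
    then have "?X - ?Y = ?P - ?Q" by (simp add: cscale_cscale)
    moreover have "?X + ?Y = ?P + ?Q" by (rule lin[OF a])
    ultimately have "(?X - ?Y) + (?X + ?Y) = (?P - ?Q) + (?P + ?Q)" by simp
    then have "2 *\<^sub>R ?X = 2 *\<^sub>R ?P" by (simp add: scaleR_2)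
    then show ?thesis by (simp only: scaleR_cancel_left) simp
  qed
  \<comment> \<open>Both sides are linear in a, so division by t > norm a brings a into the range
    treated above.\<close>
  define t where "t = norm a + 1"
  have t: "t > 0" by (simp add: t_def add_nonneg_pos)
  have "norm ((1/t) *\<^sub>R a) < 1" using t by (simp add: t_def)
  from small[OF this] have "dual_ip (dual_lact ((1/t) *\<^sub>R a) r) s = (1/t) *\<^sub>R (a * dual_ip r s)" by simp
  moreover have "dual_ip (dual_lact ((1/t) *\<^sub>R a) r) s = (1/t) *\<^sub>R dual_ip (dual_lact a r) s"
    using r s by (simp add: scaleR_eq_cscale dual_lact_cscale dual_ip_smult)
  ultimately show ?thesis using t by simp
qed

text \<open>By \<open>dual_sq_shift\<close> the two polarization terms contribute the self-adjoint
  and the skew part of s(y). Evaluation at y thereby becomes an inner product.\<close>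

lemma dual_ip_inner_left:
  assumes s: "functional s" and y: "y \<in> carrier M"
  shows "dual_ip (\<lambda>x. ip M x y) s = s y"
proof -
  have polar: "dual_polar (\<lambda>x. ip M x y) s = 2 *\<^sub>R (s y + cstar (s y))" if s: "functional s" for s
  proof -
    have "s - (\<lambda>x. ip M x y) = - ((- s) + (\<lambda>x. ip M x y))" by simp
    then have "dual_sq (s - (\<lambda>x. ip M x y)) = dual_sq ((- s) + (\<lambda>x. ip M x y))"
      using s y dual_sq_minus[of "(- s) + (\<lambda>x. ip M x y)"] by (simp add: inner_functional)
    also have "\<dots> = dual_sq s - s y - cstar (s y) + ip M y y"
      using s y dual_sq_shift[of "- s" y] by (simp add: dual_sq_minus cstar_minus)
    finally have "dual_polar s (\<lambda>x. ip M x y) = 2 *\<^sub>R (s y + cstar (s y))"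
      using s y by (simp add: dual_polar_def dual_sq_shift scaleR_2)
    then show ?thesis using s y by (simp add: dual_polar_commute inner_functional)
  qed
  show ?thesis
  proof -
    have "cscale \<i> (dual_polar (\<lambda>x. ip M x y) (dual_smult \<i> s)) = 2 *\<^sub>R (s y - cstar (s y))"
      using s by (simp only: polar functional_dual_smult)
        (simp add: dual_smult_def cstar_cscale cstar_minus cscale_simps cscale_scaleR)
    then have "dual_ip (\<lambda>x. ip M x y) s
        = (1/4) *\<^sub>R (2 *\<^sub>R (s y + cstar (s y)) + 2 *\<^sub>R (s y - cstar (s y)))"
      by (simp only: dual_ip_def polar[OF s])
    also have "\<dots> = (1/4) *\<^sub>R (4 *\<^sub>R s y)"
      by (simp add: scaleR_add_right scaleR_diff_right flip: scaleR_add_left)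
    finally show ?thesis by simp
  qed
qed

end

section \<open>Order limits and Paschke's inequality\<close>

lemma cstar_le_limit:
  assumes "\<And>n. cstar_le (a n) (b n)" "a \<longlonglongrightarrow> l" "b \<longlonglongrightarrow> m"
  shows "cstar_le l m"
proof -
  have "spectrally_nonneg (embed (m - l))"
  proof (rule spectrally_nonneg_limit)
    show "spectrally_nonneg (embed (b n - a n))" for n
      using assms(1) by (simp add: cstar_le_def spectrally_nonneg_embed_iff)
    have "(\<lambda>n. norm ((b n - a n) - (m - l))) \<longlonglongrightarrow> 0"
      by (intro tendsto_norm_zero LIM_zero tendsto_diff assms)
    then have "(\<lambda>n. norm (embed (b n - a n) - embed (m - l))) \<longlonglongrightarrow> 0"
      by (simp flip: embed_diff)
    then have "(\<lambda>n. embed (b n - a n) - embed (m - l)) \<longlonglongrightarrow> 0" by (rule tendsto_norm_zero_cancel)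
    then show "(\<lambda>n. embed (b n - a n)) \<longlonglongrightarrow> embed (m - l)" by (rule LIM_zero_cancel)
  qed
  then show ?thesis by (simp add: cstar_le_def spectrally_nonneg_embed_iff)
qed

context pre_hilbert_module
begin

text \<open>Paschke's inequality for a quadratic map \<open>P\<close>, such as \<open>r(x) r(x)\<^sup>*\<close> or \<open>\<langle>T x, T x\<rangle>\<close>.\<close>

lemma Paschke_inequality:
  assumes x: "x \<in> carrier M" and K: "K \<ge> 0"
    and pos: "positive (P x)"
    and quad: "\<And>t a. cstar a = a \<Longrightarrow> P (complex_of_real t \<odot> x \<oplus> a \<triangleright> x)
      = t\<^sup>2 *\<^sub>R P x + t *\<^sub>R (a * P x + P x * a) + a * P x * a"
    and bound: "\<And>y. y \<in> carrier M \<Longrightarrow> norm (P y) \<le> K * norm (ip M y y)"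
  shows "cstar_le (P x) (K *\<^sub>R ip M x x)"
proof (rule order_le_if_norm_conj_le[OF pos])
  show "positive (K *\<^sub>R ip M x x)" using x K by (intro positive_scaleR ip_positive)
  fix t :: real and a :: 'a assume a: "cstar a = a"
  let ?y = "complex_of_real t \<odot> x \<oplus> a \<triangleright> x"
  have "t\<^sup>2 *\<^sub>R (K *\<^sub>R ip M x x) + t *\<^sub>R (a * K *\<^sub>R ip M x x + K *\<^sub>R ip M x x * a) + a * K *\<^sub>R ip M x x * a
      = K *\<^sub>R ip M ?y ?y"
    using x a by (simp add: ip_simps cscale_simps algebra_simps power2_eq_square flip: scaleR_eq_cscale)
  then show "norm (t\<^sup>2 *\<^sub>R P x + t *\<^sub>R (a * P x + P x * a) + a * P x * a)
      \<le> norm (t\<^sup>2 *\<^sub>R (K *\<^sub>R ip M x x) + t *\<^sub>R (a * K *\<^sub>R ip M x x + K *\<^sub>R ip M x x * a) + a * K *\<^sub>R ip M x x * a)"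
    using bound[of ?y] quad[OF a, of t] x K by simp
qed

text \<open>Upgrades a norm bound to an order bound, which can be compared with values of the
  gap.\<close>

lemma functional_order_bound:
  assumes r: "bounded_module_functional M r"
    and C: "\<And>x. x \<in> carrier M \<Longrightarrow> norm (r x) \<le> C * hnorm M x" and x: "x \<in> carrier M"
  shows "cstar_le (r x * cstar (r x)) (C\<^sup>2 *\<^sub>R ip M x x)"
proof (rule Paschke_inequality[where P = "\<lambda>x. r x * cstar (r x)", OF x])
  show "positive (r x * cstar (r x))" by (rule positive_mult_cstar_self)
  fix t :: real and a :: 'a assume "cstar a = a"
  then show "r (complex_of_real t \<odot> x \<oplus> a \<triangleright> x) * cstar (r (complex_of_real t \<odot> x \<oplus> a \<triangleright> x))
      = t\<^sup>2 *\<^sub>R (r x * cstar (r x)) + t *\<^sub>R (a * (r x * cstar (r x)) + r x * cstar (r x) * a)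
        + a * (r x * cstar (r x)) * a"
    using x by (simp add: functional_add[OF r] functional_smult[OF r] functional_lact[OF r] cstar_add
        cstar_scaleR cstar_mult cscale_simps algebra_simps power2_eq_square flip: scaleR_eq_cscale)
next
  fix y assume "y \<in> carrier M"
  then have "(norm (r y))\<^sup>2 \<le> (C * hnorm M y)\<^sup>2" using C by (intro power_mono) auto
  then show "norm (r y * cstar (r y)) \<le> C\<^sup>2 * norm (ip M y y)"
    by (simp add: norm_mult_cstar power_mult_distrib hnorm_power2)
qed simp

end

lemma module_map_order_bound:
  fixes M :: "('a::cstar_algebra, 'm) hilbert_mod" and N :: "('a, 'n) hilbert_mod"
  assumes M: "pre_hilbert_module M" and N: "pre_hilbert_module N"
    and T: "bounded_module_map M N T"
    and C: "\<And>x. x \<in> carrier M \<Longrightarrow> hnorm N (T x) \<le> C * hnorm M x" and x: "x \<in> carrier M"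
  shows "cstar_le (ip N (T x) (T x)) (C\<^sup>2 *\<^sub>R ip M x x)"
proof -
  interpret M: pre_hilbert_module M by (rule M)
  interpret N: pre_hilbert_module N by (rule N)
  have Tc: "T y \<in> carrier N" if "y \<in> carrier M" for y
    using T that by (auto simp: bounded_module_map_def)
  show ?thesis
  proof (rule M.Paschke_inequality[where P = "\<lambda>x. ip N (T x) (T x)", OF x])
    show "positive (ip N (T x) (T x))" using Tc x by (simp add: N.ip_positive)
    fix t :: real and a :: 'a assume a: "cstar a = a"
    have "T (complex_of_real t \<odot>\<^bsub>M\<^esub> x \<oplus>\<^bsub>M\<^esub> a \<triangleright>\<^bsub>M\<^esub> x) = complex_of_real t \<odot>\<^bsub>N\<^esub> T x \<oplus>\<^bsub>N\<^esub> a \<triangleright>\<^bsub>N\<^esub> T x"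
      using T x by (simp add: bounded_module_map_def)
    then show "ip N (T (complex_of_real t \<odot>\<^bsub>M\<^esub> x \<oplus>\<^bsub>M\<^esub> a \<triangleright>\<^bsub>M\<^esub> x)) (T (complex_of_real t \<odot>\<^bsub>M\<^esub> x \<oplus>\<^bsub>M\<^esub> a \<triangleright>\<^bsub>M\<^esub> x))
        = t\<^sup>2 *\<^sub>R ip N (T x) (T x) + t *\<^sub>R (a * ip N (T x) (T x) + ip N (T x) (T x) * a)
          + a * ip N (T x) (T x) * a"
      using Tc[OF x] a by (simp add: N.ip_simps cscale_simps algebra_simps power2_eq_square flip: scaleR_eq_cscale)
  next
    fix y assume y: "y \<in> carrier M"
    then have "(hnorm N (T y))\<^sup>2 \<le> (C * hnorm M y)\<^sup>2" using C by (intro power_mono) auto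
    then show "norm (ip N (T y) (T y)) \<le> C\<^sup>2 * norm (ip M y y)"
      by (simp add: power_mult_distrib M.hnorm_power2 N.hnorm_power2)
  qed simp
qed

text \<open>The constant is made strictly positive because later arguments divide by it.\<close>

lemma bounded_module_map_bound:
  assumes "bounded_module_map M N T"
  obtains C where "C > 0" "\<And>x. x \<in> carrier M \<Longrightarrow> hnorm N (T x) \<le> C * hnorm M x"
proof -
  obtain C where C: "\<forall>x\<in>carrier M. hnorm N (T x) \<le> C * hnorm M x"
    using assms by (auto simp: bounded_module_map_def)
  have "hnorm N (T x) \<le> max C 1 * hnorm M x" if "x \<in> carrier M" for x
    using C[rule_format, OF that] mult_right_mono[of C "max C 1" "hnorm M x"] by (simp add: hnorm_def)
  then show ?thesis using that[of "max C 1"] by simp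
qed


section \<open>The dual module\<close>

context monotone_complete_module
begin

text \<open>Requiring the functionals to vanish off the carrier makes the inner product definite.\<close>

definition dual_carrier :: "('m \<Rightarrow> 'a) set"
  where "dual_carrier = {r. functional r \<and> (\<forall>x. x \<notin> carrier M \<longrightarrow> r x = 0)}"

definition on_carrier :: "('m \<Rightarrow> 'a) \<Rightarrow> 'm \<Rightarrow> 'a"
  where "on_carrier r = (\<lambda>x. if x \<in> carrier M then r x else 0)"

text \<open>The left summand of the sum type holds the dual, so that it lives on a type over which
  injectivity is tested, for arbitrary \<open>'l\<close>. The two undefined fields are the ring
  operations, which have no meaning in a module.\<close>

definition dual_module :: "('a, ('m \<Rightarrow> 'a) + 'l) hilbert_mod"
  where "dual_module =
    \<lparr>carrier = Inl ` dual_carrier, mult = undefined, one = undefined,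
     zero = Inl 0, add = (\<lambda>u v. Inl (projl u + projl v)),
     smult = (\<lambda>c u. Inl (dual_smult c (projl u))),
     lact = (\<lambda>a u. Inl (dual_lact a (projl u))),
     ip = (\<lambda>u v. dual_ip (projl u) (projl v))\<rparr>"

lemma dual_carrier_functional: "r \<in> dual_carrier \<Longrightarrow> functional r"
  by (simp add: dual_carrier_def)

lemma functional_cong:
  assumes "functional r" "\<And>x. x \<in> carrier M \<Longrightarrow> s x = r x"
  shows "functional s"
  using assms unfolding bounded_module_functional_def by (auto simp: assms(2))

lemma on_carrier_in [simp]: "functional r \<Longrightarrow> on_carrier r \<in> dual_carrier"
  using functional_cong[of r "on_carrier r"] by (simp add: dual_carrier_def on_carrier_def)

lemma on_carrier_apply [simp]: "x \<in> carrier M \<Longrightarrow> on_carrier r x = r x"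
  by (simp add: on_carrier_def)

lemma dual_carrier_eqI:
  assumes "r \<in> dual_carrier" "s \<in> dual_carrier" "\<And>x. x \<in> carrier M \<Longrightarrow> r x = s x"
  shows "r = s"
proof
  show "r x = s x" for x using assms by (cases "x \<in> carrier M") (auto simp: dual_carrier_def)
qed

lemma dual_carrier_closed:
  "r \<in> dual_carrier \<Longrightarrow> s \<in> dual_carrier \<Longrightarrow> r + s \<in> dual_carrier"
  "r \<in> dual_carrier \<Longrightarrow> - r \<in> dual_carrier"
  "0 \<in> dual_carrier"
  "r \<in> dual_carrier \<Longrightarrow> dual_smult c r \<in> dual_carrier"
  "r \<in> dual_carrier \<Longrightarrow> dual_lact a r \<in> dual_carrier"
  by (auto simp: dual_carrier_def) (simp_all add: dual_smult_def dual_lact_def)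

text \<open>At \<epsilon> times the multiple of x by the adjoint of r(x), the gap is \<epsilon> (2 p
  - \<epsilon> q). If no gap exceeds 0, then 2 norm p \<le> \<epsilon> norm q for every \<epsilon> >
  0.\<close>

lemma dual_sq_eq_0D:
  assumes r: "functional r" and 0: "dual_sq r = 0" and x: "x \<in> carrier M"
  shows "r x = 0"
proof (rule ccontr)
  assume "r x \<noteq> 0"
  let ?p = "cstar (r x) * r x" and ?q = "cstar (r x) * ip M x x * r x"
  have le: "2 * norm ?p \<le> \<epsilon> * norm ?q" if \<epsilon>: "\<epsilon> > 0" for \<epsilon> :: real
  proof -
    let ?y = "(\<epsilon> *\<^sub>R cstar (r x)) \<triangleright> x"
    have "gap r ?y = \<epsilon> *\<^sub>R (2 *\<^sub>R ?p - \<epsilon> *\<^sub>R ?q)"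
      using x by (simp add: gap_def functional_lact[OF r] ip_simps cstar_mult cstar_cstar cstar_scaleR
          scaleR_2 algebra_simps)
    moreover have "cstar_le (gap r ?y) 0" using gap_le_dual_sq[OF r, of ?y] x 0 by simp
    ultimately have "cstar_le ((1/\<epsilon>) *\<^sub>R \<epsilon> *\<^sub>R (2 *\<^sub>R ?p - \<epsilon> *\<^sub>R ?q)) ((1/\<epsilon>) *\<^sub>R 0)"
      using \<epsilon> by (intro cstar_le_scaleR) auto
    then have "positive (\<epsilon> *\<^sub>R ?q - 2 *\<^sub>R ?p)" using \<epsilon> by (simp add: cstar_le_def)
    then have "norm (2 *\<^sub>R ?p) \<le> norm (\<epsilon> *\<^sub>R ?q)"
      by (intro norm_le_if_order_le positive_scaleR positive_cstar_mult_self) auto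
    then show ?thesis using \<epsilon> by simp
  qed
  have p: "norm ?p > 0" using \<open>r x \<noteq> 0\<close> by (simp add: cstar_identity)
  \<comment> \<open>Small enough that \<epsilon> norm q \<le> norm p; the 1 covers the case q =
    0.\<close>
  define \<epsilon> where "\<epsilon> = norm ?p / (norm ?q + 1)"
  have "\<epsilon> > 0" using p by (simp add: \<epsilon>_def add_nonneg_pos)
  from le[OF this] have "2 * norm ?p \<le> \<epsilon> * norm ?q" .
  also have "\<dots> \<le> \<epsilon> * (norm ?q + 1)" using \<open>\<epsilon> > 0\<close> by simp
  also have "\<dots> = norm ?p" by (simp add: \<epsilon>_def add_nonneg_eq_0_iff)
  finally show False using p by simp
qed

lemma dual_module_simps:
  "u \<in> carrier dual_module \<longleftrightarrow> (\<exists>r\<in>dual_carrier. u = Inl r)"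
  "\<zero>\<^bsub>dual_module\<^esub> = Inl 0"
  "Inl r \<oplus>\<^bsub>dual_module\<^esub> Inl s = Inl (r + s)"
  "c \<odot>\<^bsub>dual_module\<^esub> Inl r = Inl (dual_smult c r)"
  "a \<triangleright>\<^bsub>dual_module\<^esub> Inl r = Inl (dual_lact a r)"
  "ip dual_module (Inl r) (Inl s) = dual_ip r s"
  by (auto simp: dual_module_def)

sublocale dual: pre_hilbert_module "dual_module :: ('a, ('m \<Rightarrow> 'a) + 'l) hilbert_mod"
proof (intro pre_hilbert_module.intro pre_hilbert_module_axioms.intro moduleI)
  show "cring complex_field" by (rule R.is_cring)
  show "abelian_group (dual_module :: ('a, ('m \<Rightarrow> 'a) + 'l) hilbert_mod)"
  proof (rule abelian_groupI)
    fix u :: "('m \<Rightarrow> 'a) + 'l" assume "u \<in> carrier dual_module"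
    then obtain r where r: "r \<in> dual_carrier" "u = Inl r" by (auto simp: dual_module_simps)
    then show "\<exists>v\<in>carrier dual_module. v \<oplus>\<^bsub>dual_module\<^esub> u = \<zero>\<^bsub>dual_module\<^esub>"
      by (intro bexI[of _ "Inl (- r)"]) (auto simp: dual_module_simps dual_carrier_closed)
  next
    show "\<zero>\<^bsub>dual_module\<^esub> \<in> carrier (dual_module :: ('a, ('m \<Rightarrow> 'a) + 'l) hilbert_mod)"
      by (simp add: dual_module_simps dual_carrier_def)
  qed (auto simp: dual_module_simps dual_carrier_closed add_ac)
next
  fix u :: "('m \<Rightarrow> 'a) + 'l" assume "u \<in> carrier dual_module" "ip dual_module u u = 0"
  then obtain r where r: "r \<in> dual_carrier" "u = Inl r" "dual_sq r = 0"
    by (auto simp: dual_module_simps dual_ip_self dual_carrier_functional)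
  then have "r = 0"
    using dual_sq_eq_0D dual_carrier_functional dual_carrier_closed(3)
    by (intro dual_carrier_eqI) auto
  with r show "u = \<zero>\<^bsub>dual_module\<^esub>" by (simp add: dual_module_simps)
next
  fix u v :: "('m \<Rightarrow> 'a) + 'l" assume "u \<in> carrier dual_module" "v \<in> carrier dual_module"
  then obtain r s where "r \<in> dual_carrier" "u = Inl r" "s \<in> dual_carrier" "v = Inl s"
    by (auto simp: dual_module_simps)
  then show "ip dual_module v u = cstar (ip dual_module u v)"
    by (simp only: dual_module_simps dual_ip_cstar[of r s] dual_carrier_functional)
qed (auto simp: dual_module_simps dual_carrier_closed dual_smult_add_left dual_smult_add dual_smult_mult
    dual_smult_one dual_lact_add dual_lact_add_left dual_lact_mult dual_lact_cscale dual_lact_smult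
    dual_ip_add dual_ip_smult dual_ip_lact dual_ip_self positive_dual_sq dual_carrier_functional)

section \<open>The embedding of a module into its dual\<close>

definition canonical :: "'m \<Rightarrow> ('m \<Rightarrow> 'a) + 'l"
  where "canonical y = Inl (on_carrier (\<lambda>x. ip M x y))"

lemma canonical_closed [simp]: "y \<in> carrier M \<Longrightarrow> canonical y \<in> carrier dual_module"
  by (auto simp: canonical_def dual_module_simps inner_functional)

lemma dual_sq_cong:
  assumes "\<And>x. x \<in> carrier M \<Longrightarrow> r x = s x"
  shows "dual_sq r = dual_sq s"
proof -
  have "gap r ` carrier M = gap s ` carrier M"
    by (intro image_cong) (auto simp: gap_def assms)
  then show ?thesis by (simp add: dual_sq_def)
qed

lemma dual_ip_cong:
  assumes "\<And>x. x \<in> carrier M \<Longrightarrow> r x = r' x" "\<And>x. x \<in> carrier M \<Longrightarrow> s x = s' x"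
  shows "dual_ip r s = dual_ip r' s'"
proof -
  have "dual_polar r u = dual_polar r' u'" if "\<And>x. x \<in> carrier M \<Longrightarrow> u x = u' x" for u u'
    unfolding dual_polar_def using assms(1) that
    by (intro arg_cong2[of _ _ _ _ "(-)"] dual_sq_cong) auto
  from this[of s s'] this[of "dual_smult \<i> s" "dual_smult \<i> s'"] assms(2)
  show ?thesis unfolding dual_ip_def by (simp add: dual_smult_def)
qed

lemma ip_canonical:
  assumes "y \<in> carrier M" "r \<in> dual_carrier"
  shows "ip dual_module (canonical y) (Inl r) = r y"
proof -
  have "dual_ip (on_carrier (\<lambda>x. ip M x y)) r = dual_ip (\<lambda>x. ip M x y) r"
    by (rule dual_ip_cong) auto
  then show ?thesis
    using assms by (simp add: canonical_def dual_module_simps dual_ip_inner_left dual_carrier_functional)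
qed

lemma ip_canonical_canonical:
  "x \<in> carrier M \<Longrightarrow> y \<in> carrier M \<Longrightarrow> ip dual_module (canonical x) (canonical y) = ip M x y"
  using ip_canonical[of x "on_carrier (\<lambda>x. ip M x y)"]
  by (simp add: canonical_def[of y] inner_functional)

lemma hnorm_canonical: "y \<in> carrier M \<Longrightarrow> hnorm dual_module (canonical y) = hnorm M y"
  by (simp add: hnorm_def ip_canonical_canonical)

lemma canonical_eqI:
  assumes "u \<in> carrier dual_module" "y \<in> carrier M" "\<And>x. x \<in> carrier M \<Longrightarrow> projl u x = ip M x y"
  shows "u = canonical y"
  using assms dual_carrier_eqI[of "projl u" "on_carrier (\<lambda>x. ip M x y)"]
  by (auto simp: canonical_def dual_module_simps inner_functional)

lemma dual_smult_apply: "dual_smult c r x = cscale (cnj c) (r x)"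
  and dual_lact_apply: "dual_lact a r x = r x * cstar a"
  by (simp_all add: dual_smult_def dual_lact_def)

lemma canonical_add:
  assumes "x \<in> carrier M" "y \<in> carrier M"
  shows "canonical (x \<oplus> y) = canonical x \<oplus>\<^bsub>dual_module\<^esub> canonical y"
  by (rule sym, rule canonical_eqI) (use assms in \<open>auto simp: canonical_def dual_module_simps inner_functional
    dual_carrier_closed ip_simps\<close>)

lemma canonical_smult:
  assumes "y \<in> carrier M"
  shows "canonical (c \<odot> y) = c \<odot>\<^bsub>dual_module\<^esub> canonical y"
  by (rule sym, rule canonical_eqI) (use assms in \<open>auto simp: canonical_def dual_module_simps inner_functional
    dual_carrier_closed ip_simps dual_smult_apply\<close>)

lemma canonical_lact:
  assumes "y \<in> carrier M"
  shows "canonical (a \<triangleright> y) = a \<triangleright>\<^bsub>dual_module\<^esub> canonical y"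
  by (rule sym, rule canonical_eqI) (use assms in \<open>auto simp: canonical_def dual_module_simps inner_functional
    dual_carrier_closed ip_simps dual_lact_apply\<close>)

lemma canonical_inj:
  assumes "x \<in> carrier M" "y \<in> carrier M" "canonical x = canonical y"
  shows "x = y"
proof (rule eq_if_ip_eq[OF assms(1,2)])
  fix z assume z: "z \<in> carrier M"
  have "on_carrier (\<lambda>z. ip M z x) = on_carrier (\<lambda>z. ip M z y)" using assms(3) by (simp add: canonical_def)
  then have "on_carrier (\<lambda>z. ip M z x) z = on_carrier (\<lambda>z. ip M z y) z" by simp
  then show "ip M z x = ip M z y" using z by simp
qed

lemma norm_functional_le:
  assumes "r \<in> dual_carrier" "x \<in> carrier M"
  shows "norm (r x) \<le> hnorm dual_module (Inl r) * hnorm M x"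
  using dual.Cauchy_Schwarz[of "canonical x" "Inl r"] assms
  by (simp add: ip_canonical hnorm_canonical mult.commute) (simp add: dual_module_simps)

text \<open>The infimum of \<open>dual_sq (r - \<langle>\<cdot>, y\<rangle>) = dual_sq r - gap r y\<close> over \<open>y\<close> is \<open>0\<close>, so that \<open>M\<close> is dense
  in its dual with respect to the order.\<close>

lemma functional_zero_if_vanishes_on_canonical:
  assumes F: "bounded_module_functional dual_module F"
    and van: "\<And>y. y \<in> carrier M \<Longrightarrow> F (canonical y) = 0"
    and u: "u \<in> carrier dual_module"
  shows "F u = 0"
proof -
  obtain C0 where C0: "C0 \<ge> 0" "\<And>u. u \<in> carrier dual_module \<Longrightarrow> norm (F u) \<le> C0 * hnorm dual_module u"
    using dual.functional_bound[OF F] by metis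
  define C where "C = C0 + 1"
  have C: "C > 0" using C0 by (simp add: C_def)
  have CF: "norm (F u) \<le> C * hnorm dual_module u" if "u \<in> carrier dual_module" for u
    using C0(2)[OF that] dual.hnorm_nonneg[of u] unfolding C_def distrib_right mult_1_left by linarith
  obtain r where r: "r \<in> dual_carrier" "u = Inl r" using u by (auto simp: dual_module_simps)
  have fr: "functional r" using r by (simp add: dual_carrier_functional)
  let ?P = "F u * cstar (F u)"
  have "cstar_le (gap r y) (dual_sq r - inverse (C\<^sup>2) *\<^sub>R ?P)" if y: "y \<in> carrier M" for y
  proof -
    \<comment> \<open>F takes the same value at u and at v, the difference of u and the image of y;
      the order bound at v is therefore a bound for F(u).\<close>
    define v where "v = u \<oplus>\<^bsub>dual_module\<^esub> canonical (\<ominus> y)"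
    have v: "v \<in> carrier dual_module" using u y by (simp add: v_def)
    have "F v = F u" using dual.functional_add[OF F u, of "canonical (\<ominus> y)"] van[of "\<ominus> y"] y by (simp add: v_def)
    then have "cstar_le ?P (C\<^sup>2 *\<^sub>R ip dual_module v v)"
      using dual.functional_order_bound[OF F CF v] by simp
    then have "cstar_le (inverse (C\<^sup>2) *\<^sub>R ?P) (inverse (C\<^sup>2) *\<^sub>R C\<^sup>2 *\<^sub>R ip dual_module v v)"
      by (rule cstar_le_scaleR) simp
    moreover have "ip dual_module v v = dual_sq r - gap r y"
    proof -
      have "ip dual_module v v = dual_sq (r + on_carrier (\<lambda>x. ip M x (\<ominus> y)))"
        using r y by (simp add: v_def canonical_def dual_module_simps dual_ip_self dual_carrier_functional
            inner_functional)
      also have "\<dots> = dual_sq (r + (\<lambda>x. ip M x (\<ominus> y)))" by (rule dual_sq_cong) simp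
      also have "\<dots> = dual_sq r - gap r y"
        using fr y by (simp add: dual_sq_shift functional_minus gap_def cstar_minus ip_minus ip_minus_right)
      finally show ?thesis .
    qed
    ultimately show ?thesis using C by (simp add: cstar_le_def algebra_simps)
  qed
  \<comment> \<open>The upper bound lies below the least one by a positive multiple of
    \<open>?P\<close>, which must therefore vanish.\<close>
  then have "cstar_le (dual_sq r) (dual_sq r - inverse (C\<^sup>2) *\<^sub>R ?P)"
    using fr by (intro dual_sq_le) (auto simp: self_adjoint_def cstar_diff cstar_scaleR cstar_mult cstar_cstar)
  then have "positive (- (inverse (C\<^sup>2) *\<^sub>R ?P))" by (simp add: cstar_le_def)
  moreover have "positive (inverse (C\<^sup>2) *\<^sub>R ?P)" by (intro positive_scaleR positive_mult_cstar_self) simp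
  ultimately have "inverse (C\<^sup>2) *\<^sub>R ?P = 0" using positive_antisym by blast
  then have "?P = 0" using C by simp
  then show ?thesis by (rule mult_cstar_self_eq_0)
qed

end

section \<open>The right action on the dual\<close>

locale monotone_complete_bimodule = monotone_complete_module M
  for M :: "('a::cstar_algebra, 'm) hilbert_mod" (structure) +
  fixes \<rho> :: "'m \<Rightarrow> 'b::cstar_algebra \<Rightarrow> 'm"
  assumes star_representation: "star_representation M \<rho>"
begin

lemma ract_map: "bounded_module_map M M (\<lambda>x. \<rho> x b)"
  using star_representation by (simp add: star_representation_def adjointable_def)

lemma ract_closed [simp]: "x \<in> carrier M \<Longrightarrow> \<rho> x b \<in> carrier M"
  using ract_map[of b] by (auto simp: bounded_module_map_def)

lemma ract_module:
  assumes "x \<in> carrier M" "y \<in> carrier M"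
  shows "\<rho> (x \<oplus> y) b = \<rho> x b \<oplus> \<rho> y b" "\<rho> (c \<odot> x) b = c \<odot> \<rho> x b" "\<rho> (a \<triangleright> x) b = a \<triangleright> \<rho> x b"
  using ract_map[of b] assms by (auto simp: bounded_module_map_def)

lemma ract_algebra:
  assumes "x \<in> carrier M"
  shows "\<rho> x (b + d) = \<rho> x b \<oplus> \<rho> x d" "\<rho> x (cscale z b) = z \<odot> \<rho> x b" "\<rho> x (b * d) = \<rho> (\<rho> x b) d"
  using star_representation assms by (auto simp: star_representation_def)

lemma ip_ract: "x \<in> carrier M \<Longrightarrow> y \<in> carrier M \<Longrightarrow> ip M (\<rho> x b) y = ip M x (\<rho> y (cstar b))"
  using star_representation by (auto simp: star_representation_def)

text \<open>The adjoint of b enters because \<langle>x, y b\<rangle> is the inner product of x acted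
  on by \<open>cstar b\<close> with y; the action thus extends that of M.\<close>

definition dual_ract :: "('m \<Rightarrow> 'a) + 'l \<Rightarrow> 'b \<Rightarrow> ('m \<Rightarrow> 'a) + 'l"
  where "dual_ract u b = Inl (on_carrier (\<lambda>x. projl u (\<rho> x (cstar b))))"

lemma functional_ract:
  assumes r: "functional r"
  shows "functional (\<lambda>x. r (\<rho> x b))"
proof -
  obtain C where C: "C \<ge> 0" "\<And>x. x \<in> carrier M \<Longrightarrow> norm (r x) \<le> C * hnorm M x"
    using functional_bound[OF r] by metis
  obtain D where D: "\<And>x. x \<in> carrier M \<Longrightarrow> hnorm M (\<rho> x b) \<le> D * hnorm M x"
    using bounded_module_map_bound[OF ract_map[of b]] by metis
  have "norm (r (\<rho> x b)) \<le> (C * D) * hnorm M x" if "x \<in> carrier M" for x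
    using C(2)[of "\<rho> x b"] mult_left_mono[OF D[OF that] C(1)] that by simp
  then have "\<exists>C. \<forall>x\<in>carrier M. norm (r (\<rho> x b)) \<le> C * hnorm M x" by blast
  then show ?thesis
    using r unfolding bounded_module_functional_def by (simp add: ract_module)
qed

lemma dual_ract_Inl: "dual_ract (Inl r) b = Inl (on_carrier (\<lambda>x. r (\<rho> x (cstar b))))"
  by (simp add: dual_ract_def)

lemma dual_ract_closed [simp]: "u \<in> carrier dual_module \<Longrightarrow> dual_ract u b \<in> carrier dual_module"
  by (auto simp: dual_module_simps dual_ract_Inl functional_ract dual_carrier_functional)

lemma dual_ract_canonical:
  assumes "y \<in> carrier M"
  shows "dual_ract (canonical y) b = canonical (\<rho> y b)"
proof (rule canonical_eqI)
  fix x assume "x \<in> carrier M"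
  then show "projl (dual_ract (canonical y) b) x = ip M x (\<rho> y b)"
    using assms by (simp add: canonical_def dual_ract_Inl ip_ract cstar_cstar)
qed (use assms in auto)

text \<open>The gap at x is compared with that of r at k (x b), where k is the inverse of C^2: this
  scaling matches the linear terms, and the order bound for the action compares the quadratic
  ones.\<close>

lemma dual_sq_ract_le:
  assumes r: "functional r" and C: "C > 0" "\<And>x. x \<in> carrier M \<Longrightarrow> hnorm M (\<rho> x b) \<le> C * hnorm M x"
  shows "cstar_le (dual_sq (\<lambda>x. r (\<rho> x b))) (C\<^sup>2 *\<^sub>R dual_sq r)"
proof (rule dual_sq_le[OF functional_ract[OF r]])
  show "self_adjoint (C\<^sup>2 *\<^sub>R dual_sq r)" using r by (simp add: self_adjoint_def cstar_scaleR)
  fix x assume x: "x \<in> carrier M"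
  define k where "k = inverse (C\<^sup>2)"
  have k: "k > 0" "C\<^sup>2 * k = 1" using C(1) by (simp_all add: k_def)
  let ?y = "complex_of_real k \<odot> \<rho> x b"
  have "C\<^sup>2 *\<^sub>R gap r ?y = r (\<rho> x b) + cstar (r (\<rho> x b)) - k *\<^sub>R ip M (\<rho> x b) (\<rho> x b)"
    using x k by (simp add: gap_def functional_smult[OF r] ip_simps cscale_simps scaleR_add_right
        scaleR_diff_right cstar_scaleR flip: scaleR_eq_cscale)
  then have "C\<^sup>2 *\<^sub>R gap r ?y - gap (\<lambda>x. r (\<rho> x b)) x = ip M x x - k *\<^sub>R ip M (\<rho> x b) (\<rho> x b)"
    by (simp add: gap_def)
  moreover have "positive (ip M x x - k *\<^sub>R ip M (\<rho> x b) (\<rho> x b))"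
  proof -
    have "cstar_le (ip M (\<rho> x b) (\<rho> x b)) (C\<^sup>2 *\<^sub>R ip M x x)"
      by (rule module_map_order_bound[OF pre_hilbert_module_axioms pre_hilbert_module_axioms ract_map C(2) x])
    from cstar_le_scaleR[OF this, of k] show ?thesis
      using k by (simp add: cstar_le_def mult.commute)
  qed
  ultimately have "cstar_le (gap (\<lambda>x. r (\<rho> x b)) x) (C\<^sup>2 *\<^sub>R gap r ?y)" by (simp add: cstar_le_def)
  moreover have "cstar_le (C\<^sup>2 *\<^sub>R gap r ?y) (C\<^sup>2 *\<^sub>R dual_sq r)"
    using r x by (intro cstar_le_scaleR gap_le_dual_sq) auto
  ultimately show "cstar_le (gap (\<lambda>x. r (\<rho> x b)) x) (C\<^sup>2 *\<^sub>R dual_sq r)" by (rule cstar_le_trans)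
qed

lemma dual_ract_map: "bounded_module_map dual_module dual_module (\<lambda>u :: ('m \<Rightarrow> 'a) + 'l. dual_ract u b)"
proof -
  obtain C where C: "C > 0" "\<And>x. x \<in> carrier M \<Longrightarrow> hnorm M (\<rho> x (cstar b)) \<le> C * hnorm M x"
    using bounded_module_map_bound[OF ract_map[of "cstar b"]] by metis
  have "hnorm dual_module (dual_ract u b) \<le> C * hnorm dual_module u" if "u \<in> carrier dual_module"
    for u :: "('m \<Rightarrow> 'a) + 'l"
  proof -
    obtain r where r: "r \<in> dual_carrier" "u = Inl r" using \<open>u \<in> _\<close> by (auto simp: dual_module_simps)
    have fr: "functional r" using r by (simp add: dual_carrier_functional)
    have "dual_sq (on_carrier (\<lambda>x. r (\<rho> x (cstar b)))) = dual_sq (\<lambda>x. r (\<rho> x (cstar b)))"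
      by (rule dual_sq_cong) simp
    then have "cstar_le (dual_sq (on_carrier (\<lambda>x. r (\<rho> x (cstar b))))) (C\<^sup>2 *\<^sub>R dual_sq r)"
      using dual_sq_ract_le[OF fr C] by simp
    then have "norm (dual_sq (on_carrier (\<lambda>x. r (\<rho> x (cstar b))))) \<le> norm (C\<^sup>2 *\<^sub>R dual_sq r)"
      using fr by (intro norm_le_if_order_le positive_dual_sq dual_carrier_functional[OF on_carrier_in]
          functional_ract) (auto simp: cstar_le_def)
    then have "(hnorm dual_module (dual_ract u b))\<^sup>2 \<le> (C * hnorm dual_module u)\<^sup>2"
      using fr by (simp add: dual.hnorm_power2 r(2) dual_ract_Inl dual_module_simps dual_ip_self
          power_mult_distrib functional_ract dual_carrier_functional)
    then show ?thesis by (rule power2_le_imp_le) (use C in simp)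
  qed
  moreover have "dual_ract (u \<oplus>\<^bsub>dual_module\<^esub> v) b = dual_ract u b \<oplus>\<^bsub>dual_module\<^esub> dual_ract v b"
    "dual_ract (c \<odot>\<^bsub>dual_module\<^esub> u) b = c \<odot>\<^bsub>dual_module\<^esub> dual_ract u b"
    "dual_ract (a \<triangleright>\<^bsub>dual_module\<^esub> u) b = a \<triangleright>\<^bsub>dual_module\<^esub> dual_ract u b"
    if "u \<in> carrier dual_module" "v \<in> carrier dual_module" for u v :: "('m \<Rightarrow> 'a) + 'l" and a c
    using that by (auto simp: dual_module_simps dual_ract_Inl on_carrier_def fun_eq_iff dual_smult_def dual_lact_def)
  ultimately show ?thesis by (auto simp: bounded_module_map_def)
qed

text \<open>The difference of the two sides is a bounded functional of u. On the image of y both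
  sides are the value of v at y b, so the difference vanishes there and hence everywhere.\<close>

lemma ip_dual_ract:
  fixes u v :: "('m \<Rightarrow> 'a) + 'l"
  assumes u: "u \<in> carrier dual_module" and v: "v \<in> carrier dual_module"
  shows "ip dual_module (dual_ract u b) v = ip dual_module u (dual_ract v (cstar b))"
proof -
  let ?F = "\<lambda>u :: ('m \<Rightarrow> 'a) + 'l. ip dual_module (dual_ract u b) v - ip dual_module u (dual_ract v (cstar b))"
  have v': "dual_ract v (cstar b) \<in> carrier dual_module" using v by simp
  obtain C where C: "C > 0" "\<And>u. u \<in> carrier dual_module \<Longrightarrow>
      hnorm dual_module (dual_ract u b) \<le> C * hnorm dual_module (u :: ('m \<Rightarrow> 'a) + 'l)"
    using bounded_module_map_bound[OF dual_ract_map[of b]] by metis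
  have "bounded_module_functional dual_module ?F"
    unfolding bounded_module_functional_def
  proof (intro conjI exI ballI allI)
    fix u :: "('m \<Rightarrow> 'a) + 'l" assume u: "u \<in> carrier dual_module"
    have "norm (?F u) \<le> norm (ip dual_module (dual_ract u b) v) + norm (ip dual_module u (dual_ract v (cstar b)))"
      by (rule norm_triangle_ineq4)
    also have "\<dots> \<le> (C * hnorm dual_module u) * hnorm dual_module v
        + hnorm dual_module u * hnorm dual_module (dual_ract v (cstar b))"
      using u v v' C(2) dual.Cauchy_Schwarz
      by (intro add_mono order.trans[OF dual.Cauchy_Schwarz mult_right_mono]) auto
    also have "\<dots> = (C * hnorm dual_module v + hnorm dual_module (dual_ract v (cstar b))) * hnorm dual_module u"
      by (simp add: algebra_simps)
    finally show "norm (?F u) \<le> (C * hnorm dual_module v + hnorm dual_module (dual_ract v (cstar b)))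
      * hnorm dual_module u" .
  qed (use dual_ract_map[of b] v v' in \<open>auto simp: bounded_module_map_def dual.ip_simps cscale_diff_right
      right_diff_distrib\<close>)
  moreover have "?F (canonical y) = 0" if y: "y \<in> carrier M" for y
  proof -
    obtain s where s: "s \<in> dual_carrier" "v = Inl s" using v by (auto simp: dual_module_simps)
    have "functional (\<lambda>x. s (\<rho> x b))" using s by (simp add: functional_ract dual_carrier_functional)
    then show ?thesis
      using y s by (simp add: dual_ract_canonical dual_ract_Inl ip_canonical cstar_cstar)
  qed
  ultimately have "?F u = 0" by (rule functional_zero_if_vanishes_on_canonical[OF _ _ u])
  then show ?thesis by simp
qed

lemma star_representation_dual:
  "star_representation (dual_module :: ('a, ('m \<Rightarrow> 'a) + 'l) hilbert_mod) dual_ract"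
  unfolding star_representation_def
proof (intro conjI allI ballI)
  fix b
  show "adjointable dual_module (\<lambda>u :: ('m \<Rightarrow> 'a) + 'l. dual_ract u b)"
    unfolding adjointable_def
    by (intro conjI dual_ract_map bexI[of _ "\<lambda>u. dual_ract u (cstar b)"]) (auto simp: ip_dual_ract)
next
  fix u v :: "('m \<Rightarrow> 'a) + 'l" and b
  assume "u \<in> carrier dual_module" "v \<in> carrier dual_module"
  then show "ip dual_module (dual_ract u b) v = ip dual_module u (dual_ract v (cstar b))"
    by (rule ip_dual_ract)
next
  fix u :: "('m \<Rightarrow> 'a) + 'l" and b c z
  assume "u \<in> carrier dual_module"
  then obtain r where r: "r \<in> dual_carrier" "u = Inl r" by (auto simp: dual_module_simps)
  then have fr: "functional r" by (simp add: dual_carrier_functional)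
  show "dual_ract u (b + c) = dual_ract u b \<oplus>\<^bsub>dual_module\<^esub> dual_ract u c"
    using fr by (auto simp: r(2) dual_ract_Inl dual_module_simps on_carrier_def fun_eq_iff cstar_add
        ract_algebra functional_add)
  show "dual_ract u (cscale z b) = z \<odot>\<^bsub>dual_module\<^esub> dual_ract u b"
    using fr by (auto simp: r(2) dual_ract_Inl dual_module_simps on_carrier_def fun_eq_iff cstar_cscale
        ract_algebra functional_smult dual_smult_def)
  show "dual_ract u (b * c) = dual_ract (dual_ract u b) c"
    by (auto simp: r(2) dual_ract_Inl on_carrier_def fun_eq_iff cstar_mult ract_algebra)
qed

end

section \<open>Completeness of the dual\<close>

context monotone_complete_module
begin

lemma hnorm_dual: "r \<in> dual_carrier \<Longrightarrow> hnorm dual_module (Inl r) = sqrt (norm (dual_sq r))"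
  by (simp add: hnorm_def dual_module_simps dual_ip_self dual_carrier_functional)

lemma norm_functional_le_dual_sq:
  assumes "r \<in> dual_carrier" "x \<in> carrier M"
  shows "norm (r x) \<le> sqrt (norm (dual_sq r)) * hnorm M x"
  using norm_functional_le[OF assms] by (simp only: hnorm_dual[OF assms(1)])

lemma dual_minus:
  assumes "r \<in> dual_carrier" "s \<in> dual_carrier"
  shows "Inl r \<ominus>\<^bsub>dual_module\<^esub> Inl s = (Inl (r - s) :: ('m \<Rightarrow> 'a) + 'l)"
proof -
  have s: "Inl (- s) \<in> carrier (dual_module :: ('a, ('m \<Rightarrow> 'a) + 'l) hilbert_mod)"
    using assms by (simp add: dual_module_simps dual_carrier_closed)
  have "\<ominus>\<^bsub>dual_module\<^esub> Inl s = (Inl (- s) :: ('m \<Rightarrow> 'a) + 'l)"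
    using assms s by (intro dual.minus_equality) (auto simp: dual_module_simps)
  then show ?thesis by (simp add: a_minus_def dual_module_simps)
qed

lemma dual_carrier_diff: "r \<in> dual_carrier \<Longrightarrow> s \<in> dual_carrier \<Longrightarrow> r - s \<in> dual_carrier"
  by (auto simp: dual_carrier_def)

lemma hdist_dual:
  assumes "r \<in> dual_carrier" "s \<in> dual_carrier"
  shows "hdist dual_module (Inl r) (Inl s :: ('m \<Rightarrow> 'a) + 'l) = sqrt (norm (dual_sq (r - s)))"
proof -
  have "Inl r \<in> carrier (dual_module :: ('a, ('m \<Rightarrow> 'a) + 'l) hilbert_mod)"
    "Inl s \<in> carrier (dual_module :: ('a, ('m \<Rightarrow> 'a) + 'l) hilbert_mod)"
    using assms by (simp_all add: dual_module_simps)
  then show ?thesis using assms by (simp add: hdist_def dual_minus hnorm_dual dual_carrier_diff)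
qed

text \<open>Write the difference as \<langle>r - s, r\<rangle> + \<langle>s, r - s\<rangle> and
  apply Cauchy-Schwarz. This is the continuity of \<open>dual_sq\<close> used for limits.\<close>

lemma norm_dual_sq_diff_le:
  assumes "r \<in> dual_carrier" "s \<in> dual_carrier"
  shows "norm (dual_sq r - dual_sq s)
    \<le> sqrt (norm (dual_sq (r - s))) * (sqrt (norm (dual_sq r)) + sqrt (norm (dual_sq s)))"
proof -
  have CS: "norm (dual_ip p q) \<le> sqrt (norm (dual_sq p)) * sqrt (norm (dual_sq q))"
    if "p \<in> dual_carrier" "q \<in> dual_carrier" for p q
  proof -
    \<comment> \<open>The type \<open>unit\<close> is an arbitrary choice of right summand;
      \<open>dual_ip\<close> does not involve it.\<close>
    have "Inl p \<in> carrier (dual_module :: ('a, ('m \<Rightarrow> 'a) + unit) hilbert_mod)"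
      "Inl q \<in> carrier (dual_module :: ('a, ('m \<Rightarrow> 'a) + unit) hilbert_mod)"
      using that by (simp_all add: dual_module_simps)
    from dual.Cauchy_Schwarz[OF this] show ?thesis
      using that by (simp add: hnorm_dual) (simp add: dual_module_simps)
  qed
  have f: "functional r" "functional s" "functional (r - s)" using assms by (simp_all add: dual_carrier_functional)
  have "dual_ip r r = dual_ip (r - s) r + dual_ip s r" "dual_ip s r = dual_ip s (r - s) + dual_ip s s"
    using dual_ip_add[of "r - s" s r] dual_ip_add_right[of "r - s" s s] f by simp_all
  then have "dual_sq r - dual_sq s = dual_ip (r - s) r + dual_ip s (r - s)"
    using f by (simp add: dual_ip_self)
  then have "norm (dual_sq r - dual_sq s) \<le> norm (dual_ip (r - s) r) + norm (dual_ip s (r - s))"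
    by (simp add: norm_triangle_ineq)
  also have "\<dots> \<le> sqrt (norm (dual_sq (r - s))) * sqrt (norm (dual_sq r))
      + sqrt (norm (dual_sq s)) * sqrt (norm (dual_sq (r - s)))"
    using assms by (intro add_mono CS dual_carrier_diff)
  finally show ?thesis by (simp add: algebra_simps)
qed

lemma dual_limit_functional:
  assumes s: "\<And>n. s n \<in> dual_carrier" and lim: "\<And>x. (\<lambda>n. s n x) \<longlonglongrightarrow> l x"
    and bound: "\<And>n. sqrt (norm (dual_sq (s n))) \<le> B"
  shows "l \<in> dual_carrier"
proof -
  have f: "functional (s n)" for n using s by (simp add: dual_carrier_functional)
  have "l (x \<oplus> y) = l x + l y" if "x \<in> carrier M" "y \<in> carrier M" for x y
    using lim[of "x \<oplus> y"] tendsto_add[OF lim[of x] lim[of y]] functional_add[OF f that]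
    by (simp add: LIMSEQ_unique)
  moreover have "l (c \<odot> x) = cscale c (l x)" if "x \<in> carrier M" for c x
    using lim[of "c \<odot> x"] bounded_linear.tendsto[OF bounded_linear_cscale lim[of x], of c]
      functional_smult[OF f that] by (simp add: LIMSEQ_unique)
  moreover have "l (a \<triangleright> x) = a * l x" if "x \<in> carrier M" for a x
    using lim[of "a \<triangleright> x"] tendsto_mult_left[OF lim[of x], of a] functional_lact[OF f that]
    by (simp add: LIMSEQ_unique)
  moreover have "norm (l x) \<le> B * hnorm M x" if x: "x \<in> carrier M" for x
  proof (rule LIMSEQ_le_const2[OF tendsto_norm[OF lim]])
    have "norm (s n x) \<le> B * hnorm M x" for n
      by (rule order.trans[OF norm_functional_le_dual_sq[OF s x] mult_right_mono[OF bound]]) simp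
    then show "\<exists>N. \<forall>n\<ge>N. norm (s n x) \<le> B * hnorm M x" by blast
  qed
  moreover have "l x = 0" if "x \<notin> carrier M" for x
    using lim[of x] s that by (simp add: dual_carrier_def LIMSEQ_const_iff)
  ultimately show ?thesis
    unfolding dual_carrier_def bounded_module_functional_def by blast
qed

text \<open>A Cauchy sequence converges pointwise to a functional l. Norm convergence to l follows
  since each value of the gap is continuous under pointwise limits.\<close>

lemma mcomplete_dual:
  "Metric_space.mcomplete (carrier dual_module)
    (hdist (dual_module :: ('a, ('m \<Rightarrow> 'a) + 'l) hilbert_mod))"
proof -
  interpret D: Metric_space "carrier dual_module" "hdist (dual_module :: ('a, ('m \<Rightarrow> 'a) + 'l) hilbert_mod)"
    by (rule dual.Metric_space)
  show ?thesis
    unfolding D.mcomplete_def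
  proof (intro allI impI)
    fix \<sigma> :: "nat \<Rightarrow> ('m \<Rightarrow> 'a) + 'l"
    assume \<sigma>: "D.MCauchy \<sigma>"
    define s where "s n = projl (\<sigma> n)" for n
    have "\<sigma> n \<in> carrier dual_module" for n using \<sigma> by (auto simp: D.MCauchy_def)
    then have s: "s n \<in> dual_carrier" and \<sigma>s: "\<sigma> n = Inl (s n)" for n
      by (auto simp: s_def dual_module_simps) (metis sum.sel(1))+
    define \<delta> where "\<delta> n m = sqrt (norm (dual_sq (s n - s m)))" for n m
    have \<delta>: "\<exists>N. \<forall>n\<ge>N. \<forall>m\<ge>N. \<delta> n m < e" if "e > 0" for e
      using \<sigma> that unfolding D.MCauchy_def by (simp add: \<sigma>s hdist_dual[OF s s] \<delta>_def)
    have pw: "norm (s n x - s m x) \<le> \<delta> n m * hnorm M x" if "x \<in> carrier M" for n m x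
      using norm_functional_le_dual_sq[OF dual_carrier_diff[OF s s] that] by (simp add: \<delta>_def)
    have "convergent (\<lambda>n. s n x)" for x
    proof (cases "x \<in> carrier M")
      case True
      have "Cauchy (\<lambda>n. s n x)"
        unfolding Cauchy_iff
      proof (intro allI impI)
        fix e :: real assume e: "e > 0"
        define h where "h = hnorm M x + 1"
        have h: "h > 0" "hnorm M x \<le> h" by (simp_all add: h_def add_nonneg_pos)
        obtain N where N: "\<forall>n\<ge>N. \<forall>m\<ge>N. \<delta> n m < e / h" using \<delta>[of "e / h"] e h by auto
        have "norm (s n x - s m x) < e" if "n \<ge> N" "m \<ge> N" for n m
        proof -
          have "\<delta> n m \<ge> 0" by (simp add: \<delta>_def)
          then have "norm (s n x - s m x) \<le> \<delta> n m * h"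
            using pw[OF True, of n m] h by (meson mult_left_mono order_trans)
          also have "\<dots> < e / h * h" using N that h by (intro mult_strict_right_mono) auto
          finally show ?thesis using h by simp
        qed
        then show "\<exists>N. \<forall>n\<ge>N. \<forall>m\<ge>N. norm (s n x - s m x) < e" by blast
      qed
      then show ?thesis by (rule Cauchy_convergent)
    next
      case False
      then have "s n x = 0" for n using s by (simp add: dual_carrier_def)
      then show ?thesis by (simp add: convergent_const)
    qed
    then obtain l where l: "(\<lambda>n. s n x) \<longlonglongrightarrow> l x" for x
      unfolding convergent_def by metis
    obtain N0 where N0: "\<forall>n\<ge>N0. \<forall>m\<ge>N0. \<delta> n m < 1" using \<delta>[of 1] by auto
    define B where "B = 1 + sqrt (norm (dual_sq (s N0)))"
    have tri: "sqrt (norm (dual_sq r)) \<le> sqrt (norm (dual_sq (r - q))) + sqrt (norm (dual_sq q))"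
      if "r \<in> dual_carrier" "q \<in> dual_carrier" for r q
    proof -
      have "Inl (r - q) \<in> carrier (dual_module :: ('a, ('m \<Rightarrow> 'a) + 'l) hilbert_mod)"
        "Inl q \<in> carrier (dual_module :: ('a, ('m \<Rightarrow> 'a) + 'l) hilbert_mod)"
        using that by (simp_all add: dual_module_simps dual_carrier_diff)
      from dual.hnorm_triangle[OF this] show ?thesis
        using that by (simp add: dual_module_simps hnorm_dual dual_carrier_diff)
    qed
    have B: "sqrt (norm (dual_sq (s n))) \<le> B" if "n \<ge> N0" for n
      using tri[OF s s, of n N0] N0[rule_format, OF that order_refl] unfolding B_def \<delta>_def by linarith
    have lD: "l \<in> dual_carrier"
    proof (rule dual_limit_functional)
      show "(\<lambda>n. s (n + N0) x) \<longlonglongrightarrow> l x" for x using l by (rule LIMSEQ_ignore_initial_segment)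
      show "sqrt (norm (dual_sq (s (n + N0)))) \<le> B" for n using B by simp
    qed (rule s)
    have dist: "sqrt (norm (dual_sq (s n - l))) \<le> e"
      if N: "\<forall>n\<ge>N. \<forall>m\<ge>N. \<delta> n m < e" "n \<ge> N" for n N e
    proof -
      \<comment> \<open>For fixed n these squares are Cauchy in m by
        \<open>norm_dual_sq_diff_le\<close>, so they have a norm limit q.\<close>
      define Q where "Q m = dual_sq (s n - s m)" for m
      have e: "e > 0"
      proof -
        have "0 \<le> \<delta> N N" by (simp add: \<delta>_def)
        then show ?thesis using N(1) by (meson le_less_trans order_refl)
      qed
      have Qe: "sqrt (norm (Q m)) < e" if "m \<ge> N" for m using N that by (simp add: Q_def \<delta>_def)
      have "Cauchy Q"
        unfolding Cauchy_iff
      proof (intro allI impI)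
        fix \<epsilon> :: real assume \<epsilon>: "\<epsilon> > 0"
        then have "\<epsilon> / (2 * e) > 0" using e by simp
        then obtain N' where N': "\<forall>n\<ge>N'. \<forall>m\<ge>N'. \<delta> n m < \<epsilon> / (2 * e)" using \<delta> by blast
        have "norm (Q m - Q k) < \<epsilon>" if "m \<ge> max N N'" "k \<ge> max N N'" for m k
        proof -
          have "norm (Q m - Q k) \<le> sqrt (norm (dual_sq ((s n - s m) - (s n - s k))))
              * (sqrt (norm (Q m)) + sqrt (norm (Q k)))"
            unfolding Q_def by (intro norm_dual_sq_diff_le dual_carrier_diff s)
          also have "(s n - s m) - (s n - s k) = s k - s m" by simp
          also have "sqrt (norm (dual_sq (s k - s m))) * (sqrt (norm (Q m)) + sqrt (norm (Q k)))
              \<le> \<delta> k m * (2 * e)"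
            using Qe[of m] Qe[of k] that unfolding \<delta>_def by (intro mult_left_mono) auto
          also have "\<dots> < \<epsilon> / (2 * e) * (2 * e)"
            using N' that e by (intro mult_strict_right_mono) auto
          finally show ?thesis using e by simp
        qed
        then show "\<exists>K. \<forall>m\<ge>K. \<forall>k\<ge>K. norm (Q m - Q k) < \<epsilon>" by blast
      qed
      then obtain q where q: "Q \<longlonglongrightarrow> q" using Cauchy_convergent convergent_def by blast
      have fQ: "functional (s n - s m)" for m
        using s by (simp add: dual_carrier_functional)
      have "(\<lambda>m. cstar (Q m)) \<longlonglongrightarrow> cstar q" by (rule bounded_linear.tendsto[OF bounded_linear_cstar q])
      then have "Q \<longlonglongrightarrow> cstar q" using fQ by (simp add: Q_def[abs_def])
      then have saq: "self_adjoint q" using q LIMSEQ_unique by (auto simp: self_adjoint_def)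
      have fl: "functional (s n - l)" using s lD by (simp add: dual_carrier_functional)
      \<comment> \<open>Lower semicontinuity: every gap of s n - l is a limit of gaps lying below Q
        m, hence lies below q.\<close>
      have "cstar_le (dual_sq (s n - l)) q"
      proof (rule dual_sq_le[OF fl saq])
        fix x assume x: "x \<in> carrier M"
        show "cstar_le (gap (s n - l) x) q"
        proof (rule cstar_le_limit)
          show "cstar_le (gap (s n - s m) x) (Q m)" for m
            unfolding Q_def by (rule gap_le_dual_sq[OF fQ x])
          show "(\<lambda>m. gap (s n - s m) x) \<longlonglongrightarrow> gap (s n - l) x"
            unfolding gap_def minus_apply fun_diff_def
            by (intro tendsto_intros bounded_linear.tendsto[OF bounded_linear_cstar] l)
        qed (rule q)
      qed
      then have "norm (dual_sq (s n - l)) \<le> norm q"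
        using fl by (intro norm_le_if_order_le positive_dual_sq) (auto simp: cstar_le_def)
      moreover have "norm q \<le> e\<^sup>2"
      proof (rule LIMSEQ_le_const2[OF tendsto_norm[OF q]])
        have "norm (Q m) \<le> e\<^sup>2" if "m \<ge> N" for m
          using Qe[OF that] e by (metis less_eq_real_def real_sqrt_le_iff real_sqrt_unique)
        then show "\<exists>N. \<forall>m\<ge>N. norm (Q m) \<le> e\<^sup>2" by blast
      qed
      ultimately show ?thesis using e by (intro real_le_lsqrt) auto
    qed
    have "limitin D.mtopology \<sigma> (Inl l) sequentially"
      unfolding D.limitin_metric
    proof (intro conjI allI impI)
      show "Inl l \<in> carrier dual_module" using lD by (simp add: dual_module_simps)
      fix e :: real assume e: "e > 0"
      then obtain N where N: "\<forall>n\<ge>N. \<forall>m\<ge>N. \<delta> n m < e / 2" using \<delta>[of "e / 2"] by auto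
      have "\<sigma> n \<in> carrier dual_module \<and> hdist dual_module (\<sigma> n) (Inl l) < e" if "n \<ge> N" for n
        using dist[OF N that] e s[of n] by (simp add: \<sigma>s hdist_dual[OF s lD]) (auto simp: dual_module_simps)
      then show "\<forall>\<^sub>F n in sequentially. \<sigma> n \<in> carrier dual_module \<and> hdist dual_module (\<sigma> n) (Inl l) < e"
        unfolding eventually_sequentially by blast
    qed
    then show "\<exists>u. limitin D.mtopology \<sigma> u sequentially" by blast
  qed
qed

lemma hilbert_module_dual: "hilbert_module (dual_module :: ('a, ('m \<Rightarrow> 'a) + 'l) hilbert_mod)"
  by (intro hilbert_module.intro hilbert_module_axioms.intro dual.module_axioms mcomplete_dual)
    (auto simp: dual.lact_add_left dual.lact_add_right dual.lact_mult dual.lact_cscale dual.lact_smult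
      dual.ip_simps dual.ip_positive intro: dual.ip_cstar dual.ip_definite)

end

section \<open>Self-duality and injectivity\<close>

lemma monotone_complete_bimoduleI:
  fixes M :: "('a::cstar_algebra, 'm) hilbert_mod"
  assumes "pre_hilbert_module M" "monotone_complete TYPE('a)" "star_representation M \<rho>"
  shows "monotone_complete_bimodule M \<rho>"
  using assms by (intro monotone_complete_bimodule.intro monotone_complete_module.intro
      monotone_complete_module_axioms.intro monotone_complete_bimodule_axioms.intro)

text \<open>Makes the dual of K, with its right action and inner product, available for the
  extension argument.\<close>

lemma sub_monotone_complete_bimodule:
  fixes L :: "('a::cstar_algebra, 'l) hilbert_mod" and \<rho> :: "'l \<Rightarrow> 'b::cstar_algebra \<Rightarrow> 'l"
  assumes mc: "monotone_complete TYPE('a)" and L: "hilbert_bimodule L \<rho>" and K: "hilbert_subbimodule K L \<rho>"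
  shows "monotone_complete_bimodule (L\<lparr>carrier := K\<rparr>) \<rho>"
proof -
  interpret L: hilbert_module L using L by (simp add: hilbert_bimodule_def)
  have sub: "submodule K complex_field L" using K by (simp add: hilbert_subbimodule_def)
  have KL: "x \<in> carrier L" if "x \<in> K" for x using L.submoduleE(1)[OF sub] that by auto
  have la: "a \<triangleright>\<^bsub>L\<^esub> x \<in> K" if "x \<in> K" for a x using K that by (simp add: hilbert_subbimodule_def)
  have ra: "\<rho> x b \<in> K" if "x \<in> K" for b x using K that by (simp add: hilbert_subbimodule_def)
  interpret M: Module.module complex_field "L\<lparr>carrier := K\<rparr>"
    by (rule submodule.submodule_is_module[OF sub L.module_axioms])
  have pre: "pre_hilbert_module (L\<lparr>carrier := K\<rparr>)"
    by unfold_locales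
      (simp_all add: la KL L.lact_add_left L.lact_add_right L.lact_mult L.lact_cscale L.lact_smult L.ip_add
        L.ip_smult L.ip_lact L.ip_positive L.ip_definite L.ip_cstar[symmetric])
  have rep: "star_representation L \<rho>" using L by (simp add: hilbert_bimodule_def)
  have "star_representation (L\<lparr>carrier := K\<rparr>) \<rho>"
    unfolding star_representation_def
  proof (intro conjI allI ballI)
    fix b
    have "adjointable L (\<lambda>x. \<rho> x b)" using rep by (simp add: star_representation_def)
    then have bmm: "bounded_module_map L L (\<lambda>x. \<rho> x b)" by (simp add: adjointable_def)
    then have "\<exists>C. \<forall>x\<in>K. hnorm L (\<rho> x b) \<le> C * hnorm L x"
      unfolding bounded_module_map_def using KL by blast
    with bmm have "bounded_module_map (L\<lparr>carrier := K\<rparr>) (L\<lparr>carrier := K\<rparr>) (\<lambda>x. \<rho> x b)"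
      unfolding bounded_module_map_def by (simp add: KL ra hnorm_def)
    moreover have "\<forall>x\<in>K. \<forall>y\<in>K. ip L (\<rho> x b) y = ip L x (\<rho> y (cstar b))"
      using rep by (simp add: star_representation_def KL)
    ultimately show "adjointable (L\<lparr>carrier := K\<rparr>) (\<lambda>x. \<rho> x b)"
      unfolding adjointable_def by (auto simp: ra intro!: bexI[of _ "\<lambda>x. \<rho> x (cstar b)"])
  qed (use rep KL in \<open>auto simp: star_representation_def\<close>)
  with pre mc show ?thesis
    by (simp add: monotone_complete_bimoduleI)
qed

text \<open>Composing with \<open>\<langle>\<phi>(\<cdot>), m\<rangle>\<close> and restricting \<open>\<langle>\<cdot>, x\<rangle>\<close> both produce elements of the dual of \<open>K\<close>;
  their inner product determines the value of the extension at \<open>x\<close> because \<open>M\<close> is self-dual.\<close>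

lemma injective_if_self_dual:
  fixes M :: "('a::cstar_algebra, 'm) hilbert_mod" and \<sigma> :: "'m \<Rightarrow> 'b::cstar_algebra \<Rightarrow> 'm"
  assumes mc: "monotone_complete TYPE('a)" and M: "hilbert_module M" and rep: "star_representation M \<sigma>"
    and sd: "self_dual M"
  shows "injective_bimodule TYPE('l) M \<sigma>"
  unfolding injective_bimodule_def
proof (intro allI impI, elim conjE)
  fix L :: "('a, 'l) hilbert_mod" and \<rho> :: "'l \<Rightarrow> 'b \<Rightarrow> 'l" and K \<phi>
  assume L: "hilbert_bimodule L \<rho>" and K: "hilbert_subbimodule K L \<rho>"
    and \<phi>: "bounded_bimodule_map (L\<lparr>carrier := K\<rparr>) \<rho> M \<sigma> \<phi>"
  define N where "N = L\<lparr>carrier := K\<rparr>"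
  have N_simps [simp]: "carrier N = K" "add N = add L" "smult N = smult L" "lact N = lact L"
    "ip N = ip L" "hnorm N = hnorm L"
    by (auto simp: N_def hnorm_def fun_eq_iff)
  interpret N: monotone_complete_bimodule N \<rho>
    unfolding N_def by (rule sub_monotone_complete_bimodule[OF mc L K])
  interpret L: pre_hilbert_module L
    using L by (simp add: hilbert_bimodule_def hilbert_module.pre_hilbert_module)
  interpret M: pre_hilbert_module M by (rule hilbert_module.pre_hilbert_module[OF M])
  interpret MM: monotone_complete_bimodule M \<sigma>
    using M.pre_hilbert_module_axioms mc rep
    by (simp add: monotone_complete_bimoduleI)
  have "star_representation L \<rho>" using L by (simp add: hilbert_bimodule_def)
  interpret LL: monotone_complete_bimodule L \<rho>
    using L.pre_hilbert_module_axioms mc \<open>star_representation L \<rho>\<close>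
    by (simp add: monotone_complete_bimoduleI)
  have KL [simp]: "k \<in> carrier L" if "k \<in> K" for k
    using K L.submoduleE(1) that by (auto simp: hilbert_subbimodule_def)
  have \<phi>N: "bounded_module_map N M \<phi>" using \<phi> by (simp add: bounded_bimodule_map_def N_def)
  have \<phi>c [simp]: "\<phi> k \<in> carrier M" if "k \<in> K" for k
    using \<phi>N that by (auto simp: bounded_module_map_def)
  have Kract [simp]: "\<rho> k b \<in> K" if "k \<in> K" for k b
    using N.ract_closed[of k b] that by simp
  have \<phi>add: "\<phi> (j \<oplus>\<^bsub>L\<^esub> k) = \<phi> j \<oplus>\<^bsub>M\<^esub> \<phi> k" if "j \<in> K" "k \<in> K" for j k
    using \<phi>N that by (simp add: bounded_module_map_def)
  have \<phi>lin: "\<phi> (c \<odot>\<^bsub>L\<^esub> k) = c \<odot>\<^bsub>M\<^esub> \<phi> k" "\<phi> (a \<triangleright>\<^bsub>L\<^esub> k) = a \<triangleright>\<^bsub>M\<^esub> \<phi> k"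
    "\<phi> (\<rho> k b) = \<sigma> (\<phi> k) b" if "k \<in> K" for k c a b
    using \<phi>N \<phi> that by (auto simp: bounded_module_map_def bounded_bimodule_map_def)
  obtain C where C: "C > 0" "\<And>k. k \<in> K \<Longrightarrow> hnorm M (\<phi> k) \<le> C * hnorm L k"
    using bounded_module_map_bound[OF \<phi>N] by auto
  define f where "f m k = ip M (\<phi> k) m" for m k
  define g where "g x k = ip L k x" for x k
  have f: "N.functional (f m)" if m: "m \<in> carrier M" for m
  proof -
    have "norm (f m k) \<le> (C * hnorm M m) * hnorm N k" if "k \<in> K" for k
    proof -
      have "norm (f m k) \<le> hnorm M (\<phi> k) * hnorm M m" using m that by (simp add: f_def M.Cauchy_Schwarz)
      also have "\<dots> \<le> (C * hnorm L k) * hnorm M m" using C(2)[OF that] by (intro mult_right_mono) auto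
      finally show ?thesis by (simp add: algebra_simps)
    qed
    then have "\<exists>C. \<forall>k\<in>K. norm (f m k) \<le> C * hnorm N k" by blast
    then show ?thesis
      using m unfolding bounded_module_functional_def by (simp add: f_def \<phi>add \<phi>lin M.ip_simps)
  qed
  have g: "N.functional (g x)" if x: "x \<in> carrier L" for x
  proof -
    have "\<exists>C. \<forall>k\<in>K. norm (g x k) \<le> C * hnorm L k"
      using L.inner_functional[OF x] KL unfolding bounded_module_functional_def g_def by blast
    then show ?thesis
      using L.inner_functional[OF x] unfolding bounded_module_functional_def by (simp add: g_def)
  qed
  have sq_f: "cstar_le (N.dual_sq (f m)) (C\<^sup>2 *\<^sub>R ip M m m)" if m: "m \<in> carrier M" for m
  proof (rule N.dual_sq_le[OF f[OF m]])
    show "self_adjoint (C\<^sup>2 *\<^sub>R ip M m m)" using m by (simp add: self_adjoint_def cstar_scaleR)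
    fix k assume "k \<in> carrier N"
    then have k: "k \<in> K" by simp
    \<comment> \<open>The weights 1/C on \<phi>(k) and C on m preserve the cross terms while
      splitting off the square of \<open>?d\<close>; the remainder is the order bound for
      \<phi>.\<close>
    define t where "t = inverse C"
    have t: "t > 0" "C * t = 1" using C by (simp_all add: t_def)
    let ?d = "complex_of_real t \<odot>\<^bsub>M\<^esub> \<phi> k \<ominus>\<^bsub>M\<^esub> complex_of_real C \<odot>\<^bsub>M\<^esub> m"
    have "C\<^sup>2 *\<^sub>R ip M m m - N.gap (f m) k = ip M ?d ?d + (ip L k k - (t * t) *\<^sub>R ip M (\<phi> k) (\<phi> k))"
      using k m t M.ip_cstar[of "\<phi> k" m]
      by (simp add: N.gap_def f_def M.ip_simps cscale_simps algebra_simps power2_eq_square flip: scaleR_eq_cscale)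
    moreover have "positive (ip M ?d ?d)" using k m by (simp add: M.ip_positive)
    moreover have "positive (ip L k k - (t * t) *\<^sub>R ip M (\<phi> k) (\<phi> k))"
    proof -
      have "cstar_le (ip M (\<phi> k) (\<phi> k)) (C\<^sup>2 *\<^sub>R ip N k k)"
        by (rule module_map_order_bound[OF N.pre_hilbert_module_axioms M.pre_hilbert_module_axioms \<phi>N])
          (use C k in auto)
      from cstar_le_scaleR[OF this, of "t * t"]
      have "cstar_le ((t * t) *\<^sub>R ip M (\<phi> k) (\<phi> k)) ((C * t)\<^sup>2 *\<^sub>R ip L k k)"
        by (simp add: power2_eq_square algebra_simps)
      then show ?thesis by (simp add: t cstar_le_def)
    qed
    ultimately show "cstar_le (N.gap (f m) k) (C\<^sup>2 *\<^sub>R ip M m m)"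
      unfolding cstar_le_def by (simp only: positive_add)
  qed
  \<comment> \<open>A Bessel inequality: restricting \<langle>\<cdot>, x\<rangle> to K cannot
    increase its square, because the deficit at k is \<langle>k - x, k - x\<rangle>.\<close>
  have sq_g: "cstar_le (N.dual_sq (g x)) (ip L x x)" if x: "x \<in> carrier L" for x
  proof (rule N.dual_sq_le[OF g[OF x]])
    show "self_adjoint (ip L x x)" using x by (simp add: self_adjoint_def)
    fix k assume "k \<in> carrier N"
    then have k: "k \<in> K" by simp
    have "ip L x x - N.gap (g x) k = ip L (k \<ominus>\<^bsub>L\<^esub> x) (k \<ominus>\<^bsub>L\<^esub> x)"
      using k x L.ip_cstar[of k x] by (simp add: N.gap_def g_def L.ip_simps)
    then show "cstar_le (N.gap (g x) k) (ip L x x)" using k x by (simp add: cstar_le_def L.ip_positive)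
  qed
  define R where "R x m = N.dual_ip (f m) (g x)" for x m
  have Rbound: "norm (R x m) \<le> (C * hnorm M m) * hnorm L x" if m: "m \<in> carrier M" and x: "x \<in> carrier L" for m x
  proof -
    let ?u = "Inl (N.on_carrier (f m)) :: ('l \<Rightarrow> 'a) + unit" and ?v = "Inl (N.on_carrier (g x)) :: ('l \<Rightarrow> 'a) + unit"
    have sq: "N.dual_sq (N.on_carrier r) = N.dual_sq r" for r by (rule N.dual_sq_cong) simp
    have u: "?u \<in> carrier N.dual_module" and v: "?v \<in> carrier N.dual_module"
      using f[OF m] g[OF x] by (auto simp: N.dual_module_simps)
    have "R x m = ip N.dual_module ?u ?v"
      unfolding R_def N.dual_module_simps by (rule N.dual_ip_cong) auto
    then have "norm (R x m) \<le> hnorm N.dual_module ?u * hnorm N.dual_module ?v"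
      using N.dual.Cauchy_Schwarz[OF u v] by simp
    moreover have "hnorm N.dual_module ?u \<le> C * hnorm M m"
    proof -
      have "norm (N.dual_sq (f m)) \<le> norm (C\<^sup>2 *\<^sub>R ip M m m)"
        using sq_f[OF m] f[OF m] by (intro norm_le_if_order_le N.positive_dual_sq) (auto simp: cstar_le_def)
      then have "(hnorm N.dual_module ?u)\<^sup>2 \<le> (C * hnorm M m)\<^sup>2"
        using f[OF m] by (simp add: N.hnorm_dual sq power_mult_distrib M.hnorm_power2)
      then show ?thesis by (rule power2_le_imp_le) (use C in simp)
    qed
    moreover have "hnorm N.dual_module ?v \<le> hnorm L x"
    proof -
      have "norm (N.dual_sq (g x)) \<le> norm (ip L x x)"
        using sq_g[OF x] g[OF x] by (intro norm_le_if_order_le N.positive_dual_sq) (auto simp: cstar_le_def)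
      then have "(hnorm N.dual_module ?v)\<^sup>2 \<le> (hnorm L x)\<^sup>2"
        using g[OF x] by (simp add: N.hnorm_dual sq L.hnorm_power2)
      then show ?thesis by (rule power2_le_imp_le) simp
    qed
    ultimately show ?thesis
      by (meson C(1) M.hnorm_nonneg N.dual.hnorm_nonneg less_imp_le mult_mono mult_nonneg_nonneg order_trans)
  qed
  have f_lin: "N.dual_ip (f (m \<oplus>\<^bsub>M\<^esub> n)) s = N.dual_ip (f m) s + N.dual_ip (f n) s"
    "N.dual_ip (f (c \<odot>\<^bsub>M\<^esub> m)) s = cscale c (N.dual_ip (f m) s)"
    "N.dual_ip (f (a \<triangleright>\<^bsub>M\<^esub> m)) s = a * N.dual_ip (f m) s"
    if "m \<in> carrier M" "n \<in> carrier M" "N.functional s" for m n s c a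
  proof -
    have "N.dual_ip (f (m \<oplus>\<^bsub>M\<^esub> n)) s = N.dual_ip (f m + f n) s"
      "N.dual_ip (f (c \<odot>\<^bsub>M\<^esub> m)) s = N.dual_ip (dual_smult c (f m)) s"
      "N.dual_ip (f (a \<triangleright>\<^bsub>M\<^esub> m)) s = N.dual_ip (dual_lact a (f m)) s"
      using that by (auto intro!: N.dual_ip_cong simp: f_def M.ip_simps dual_smult_def dual_lact_def)
    then show "N.dual_ip (f (m \<oplus>\<^bsub>M\<^esub> n)) s = N.dual_ip (f m) s + N.dual_ip (f n) s"
      "N.dual_ip (f (c \<odot>\<^bsub>M\<^esub> m)) s = cscale c (N.dual_ip (f m) s)"
      "N.dual_ip (f (a \<triangleright>\<^bsub>M\<^esub> m)) s = a * N.dual_ip (f m) s"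
      using that f by (simp_all add: N.dual_ip_add N.dual_ip_smult N.dual_ip_lact)
  qed
  have g_lin: "N.dual_ip s (g (x \<oplus>\<^bsub>L\<^esub> y)) = N.dual_ip s (g x) + N.dual_ip s (g y)"
    "N.dual_ip s (g (c \<odot>\<^bsub>L\<^esub> x)) = cscale (cnj c) (N.dual_ip s (g x))"
    "N.dual_ip s (g (a \<triangleright>\<^bsub>L\<^esub> x)) = N.dual_ip s (g x) * cstar a"
    if "x \<in> carrier L" "y \<in> carrier L" "N.functional s" for x y s c a
  proof -
    have "N.dual_ip s (g (x \<oplus>\<^bsub>L\<^esub> y)) = N.dual_ip s (g x + g y)"
      "N.dual_ip s (g (c \<odot>\<^bsub>L\<^esub> x)) = N.dual_ip s (dual_smult c (g x))"
      "N.dual_ip s (g (a \<triangleright>\<^bsub>L\<^esub> x)) = N.dual_ip s (dual_lact a (g x))"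
      using that by (auto intro!: N.dual_ip_cong simp: g_def L.ip_simps dual_smult_def dual_lact_def)
    moreover have "N.dual_ip s (dual_lact a (g x)) = N.dual_ip s (g x) * cstar a"
      using that g N.dual_ip_cstar[of "dual_lact a (g x)" s] N.dual_ip_cstar[of "g x" s]
      by (simp add: N.dual_ip_lact cstar_mult)
    ultimately show "N.dual_ip s (g (x \<oplus>\<^bsub>L\<^esub> y)) = N.dual_ip s (g x) + N.dual_ip s (g y)"
      "N.dual_ip s (g (c \<odot>\<^bsub>L\<^esub> x)) = cscale (cnj c) (N.dual_ip s (g x))"
      "N.dual_ip s (g (a \<triangleright>\<^bsub>L\<^esub> x)) = N.dual_ip s (g x) * cstar a"
      using that g by (simp_all add: N.dual_ip_add_right N.dual_ip_smult_right)
  qed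
  have "bounded_module_functional M (R x)" if x: "x \<in> carrier L" for x
  proof -
    have D: "\<exists>D. \<forall>m\<in>carrier M. norm (R x m) \<le> D * hnorm M m"
      by (rule exI[of _ "C * hnorm L x"]) (use Rbound x in \<open>auto simp: algebra_simps\<close>)
    then show ?thesis
      unfolding bounded_module_functional_def
    proof (intro conjI ballI allI D)
    qed (simp_all add: R_def f_lin g[OF x])
  qed
  then have "\<forall>x\<in>carrier L. \<exists>y\<in>carrier M. \<forall>m\<in>carrier M. R x m = ip M m y"
    using sd by (simp add: self_dual_def)
  then obtain \<psi> where \<psi>: "\<And>x. x \<in> carrier L \<Longrightarrow> \<psi> x \<in> carrier M"
    "\<And>x m. x \<in> carrier L \<Longrightarrow> m \<in> carrier M \<Longrightarrow> ip M m (\<psi> x) = R x m"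
    by metis
  have "bounded_bimodule_map L \<rho> M \<sigma> \<psi>"
    unfolding bounded_bimodule_map_def bounded_module_map_def
  proof (intro conjI ballI allI exI[of _ C])
    show "\<psi> \<in> carrier L \<rightarrow> carrier M" using \<psi>(1) by auto
  next
    fix x y assume "x \<in> carrier L" "y \<in> carrier L"
    then show "\<psi> (x \<oplus>\<^bsub>L\<^esub> y) = \<psi> x \<oplus>\<^bsub>M\<^esub> \<psi> y"
      by (intro M.eq_if_ip_eq) (auto simp: \<psi> M.ip_simps R_def g_lin f)
  next
    fix c x assume "x \<in> carrier L"
    then show "\<psi> (c \<odot>\<^bsub>L\<^esub> x) = c \<odot>\<^bsub>M\<^esub> \<psi> x"
      by (intro M.eq_if_ip_eq) (auto simp: \<psi> M.ip_simps R_def g_lin f)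
  next
    fix a x assume "x \<in> carrier L"
    then show "\<psi> (a \<triangleright>\<^bsub>L\<^esub> x) = a \<triangleright>\<^bsub>M\<^esub> \<psi> x"
      by (intro M.eq_if_ip_eq) (auto simp: \<psi> M.ip_simps R_def g_lin f)
  next
    fix x assume x: "x \<in> carrier L"
    \<comment> \<open>Take m = \<psi>(x) in the bound for R and cancel one factor.\<close>
    have "(hnorm M (\<psi> x))\<^sup>2 \<le> (C * hnorm M (\<psi> x)) * hnorm L x"
      using Rbound[OF \<psi>(1)[OF x] x] \<psi>[OF x] x by (simp add: M.hnorm_power2)
    then have "hnorm M (\<psi> x) * hnorm M (\<psi> x) \<le> (C * hnorm L x) * hnorm M (\<psi> x)"
      by (simp add: power2_eq_square algebra_simps)
    then show "hnorm M (\<psi> x) \<le> C * hnorm L x"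
      using C by (cases "hnorm M (\<psi> x) = 0") (auto simp: mult_le_cancel_right less_le)
  next
    fix b x assume x: "x \<in> carrier L"
    show "\<psi> (\<rho> x b) = \<sigma> (\<psi> x) b"
    proof (rule M.eq_if_ip_eq)
      fix m assume m: "m \<in> carrier M"
      let ?u = "Inl (N.on_carrier (f m)) :: ('l \<Rightarrow> 'a) + unit" and ?v = "Inl (N.on_carrier (g x)) :: ('l \<Rightarrow> 'a) + unit"
      have u: "?u \<in> carrier N.dual_module" and v: "?v \<in> carrier N.dual_module"
        using f[OF m] g[OF x] by (auto simp: N.dual_module_simps)
      \<comment> \<open>The functional of x b is that of x acted on by b, and the action of
        \<open>cstar b\<close> on f(m) is f of its action on m. Adjointness in the dual of K moves b
        across.\<close>
      have "R (\<rho> x b) m = ip N.dual_module ?u (N.dual_ract ?v b)"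
        unfolding R_def N.dual_ract_Inl N.dual_module_simps
        using x by (intro N.dual_ip_cong) (auto simp: g_def LL.ip_ract cstar_cstar)
      also have "\<dots> = ip N.dual_module (N.dual_ract ?u (cstar b)) ?v"
        using N.ip_dual_ract[OF u v, of "cstar b"] by (simp add: cstar_cstar)
      also have "\<dots> = R x (\<sigma> m (cstar b))"
        unfolding R_def N.dual_ract_Inl N.dual_module_simps
        using m by (intro N.dual_ip_cong) (auto simp: f_def \<phi>lin MM.ip_ract cstar_cstar)
      also have "\<dots> = ip M (\<sigma> m (cstar b)) (\<psi> x)" using x m by (simp add: \<psi>)
      also have "\<dots> = ip M m (\<sigma> (\<psi> x) b)" using MM.ip_ract[OF m \<psi>(1)[OF x], of "cstar b"] by (simp add: cstar_cstar)
      finally show "ip M m (\<psi> (\<rho> x b)) = ip M m (\<sigma> (\<psi> x) b)" using x m by (simp add: \<psi>)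
    qed (use x \<psi> in auto)
  qed
  moreover have "\<psi> k = \<phi> k" if k: "k \<in> K" for k
  proof (rule M.eq_if_ip_eq)
    fix m assume m: "m \<in> carrier M"
    \<comment> \<open>For k in K, the functional g(k) is the image of k in the dual of K, so pairing
      with it is evaluation at k.\<close>
    have "ip M m (\<psi> k) = N.dual_ip (f m) (\<lambda>j. ip N j k)"
      using k m by (simp add: \<psi> R_def g_def[abs_def])
    also have "\<dots> = cstar (f m k)"
      using N.dual_ip_inner_left[OF f[OF m], of k] N.dual_ip_cstar[OF N.inner_functional f[OF m], of k] k
      by simp
    finally show "ip M m (\<psi> k) = ip M m (\<phi> k)"
      using k m M.ip_cstar[of "\<phi> k" m] by (simp add: f_def)
  qed (use k \<psi> in auto)
  ultimately show "\<exists>\<psi>. bounded_bimodule_map L \<rho> M \<sigma> \<psi> \<and> (\<forall>x\<in>K. \<psi> x = \<phi> x)" by blast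
qed

text \<open>An extension \<open>\<psi>\<close> of the inverse of the embedding of \<open>M\<close> into its dual is a retraction; its
  deviation from the identity vanishes on \<open>M\<close>, hence everywhere.\<close>

lemma self_dual_if_injective:
  fixes M :: "('a::cstar_algebra, 'm) hilbert_mod" and \<rho> :: "'m \<Rightarrow> 'b::cstar_algebra \<Rightarrow> 'm"
  assumes mc: "monotone_complete TYPE('a)" and M: "hilbert_module M" and rep: "star_representation M \<rho>"
    and inj: "injective_bimodule TYPE(('m \<Rightarrow> 'a) + 'l) M \<rho>"
  shows "self_dual M"
proof -
  interpret H: hilbert_module M by (rule M)
  interpret M: monotone_complete_bimodule M \<rho>
    using H.pre_hilbert_module mc rep
    by (simp add: monotone_complete_bimoduleI)
  define D :: "('a, ('m \<Rightarrow> 'a) + 'l) hilbert_mod" where "D = M.dual_module"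
  interpret D: pre_hilbert_module D unfolding D_def by (rule M.dual.pre_hilbert_module_axioms)
  define \<iota> :: "'m \<Rightarrow> ('m \<Rightarrow> 'a) + 'l" where "\<iota> = M.canonical"
  have \<iota>c [simp]: "\<iota> y \<in> carrier D" if "y \<in> carrier M" for y using that by (simp add: \<iota>_def D_def)
  have \<iota>add: "\<iota> (x \<oplus>\<^bsub>M\<^esub> y) = \<iota> x \<oplus>\<^bsub>D\<^esub> \<iota> y" if "x \<in> carrier M" "y \<in> carrier M" for x y
    using that by (simp add: \<iota>_def D_def M.canonical_add)
  have \<iota>lin: "\<iota> (c \<odot>\<^bsub>M\<^esub> y) = c \<odot>\<^bsub>D\<^esub> \<iota> y" "\<iota> (a \<triangleright>\<^bsub>M\<^esub> y) = a \<triangleright>\<^bsub>D\<^esub> \<iota> y"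
    "\<iota> (\<rho> y b) = M.dual_ract (\<iota> y) b"
    if "y \<in> carrier M" for y c a b
    using that by (simp_all add: \<iota>_def D_def M.canonical_smult M.canonical_lact
        M.dual_ract_canonical)
  have \<iota>ip: "ip D (\<iota> x) (\<iota> y) = ip M x y" if "x \<in> carrier M" "y \<in> carrier M" for x y
    using that by (simp add: \<iota>_def D_def M.ip_canonical_canonical)
  have \<iota>norm: "hnorm D (\<iota> y) = hnorm M y" if "y \<in> carrier M" for y
    using that by (simp add: \<iota>_def D_def M.hnorm_canonical)
  have \<iota>inj: "x = y" if "x \<in> carrier M" "y \<in> carrier M" "\<iota> x = \<iota> y" for x y
    using that M.canonical_inj by (simp add: \<iota>_def)
  have \<iota>minus: "\<iota> (\<ominus>\<^bsub>M\<^esub> y) = \<ominus>\<^bsub>D\<^esub> \<iota> y" if "y \<in> carrier M" for y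
  proof (rule D.minus_equality[symmetric])
    have "\<iota> \<zero>\<^bsub>M\<^esub> = \<zero>\<^bsub>D\<^esub>" using \<iota>ip[of "\<zero>\<^bsub>M\<^esub>" "\<zero>\<^bsub>M\<^esub>"] by (intro D.ip_definite) auto
    then show "\<iota> (\<ominus>\<^bsub>M\<^esub> y) \<oplus>\<^bsub>D\<^esub> \<iota> y = \<zero>\<^bsub>D\<^esub>"
      using that by (simp add: H.l_neg flip: \<iota>add)
  qed (use that in auto)
  have \<iota>diff: "\<iota> x \<ominus>\<^bsub>D\<^esub> \<iota> y = \<iota> (x \<ominus>\<^bsub>M\<^esub> y)" if "x \<in> carrier M" "y \<in> carrier M" for x y
    using that by (simp add: a_minus_def \<iota>add \<iota>minus)
  define K where "K = \<iota> ` carrier M"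
  have KD: "K \<subseteq> carrier D" by (auto simp: K_def)
  interpret MS: Metric_space "carrier M" "hdist M" by (rule M.Metric_space)
  interpret DS: Metric_space "carrier D" "hdist D" by (rule D.Metric_space)
  have hd: "hdist D (\<iota> x) (\<iota> y) = hdist M x y" if "x \<in> carrier M" "y \<in> carrier M" for x y
    using that by (simp add: hdist_def \<iota>diff \<iota>norm)
  \<comment> \<open>The embedding is isometric and M is complete, so limits of sequences in the
    image stay in it.\<close>
  have "closedin DS.mtopology K"
    unfolding DS.metric_closedin_iff_sequentially_closed
  proof (intro conjI allI impI KD)
    fix \<tau> u
    assume "range \<tau> \<subseteq> K \<and> limitin DS.mtopology \<tau> u sequentially"
    then have \<tau>: "range \<tau> \<subseteq> K" and lim: "limitin DS.mtopology \<tau> u sequentially" by auto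
    from \<tau> have "\<forall>n. \<exists>y\<in>carrier M. \<tau> n = \<iota> y" by (auto simp: K_def)
    then obtain y where y: "\<And>n. y n \<in> carrier M" "\<And>n. \<tau> n = \<iota> (y n)" by metis
    have "DS.MCauchy \<tau>"
      using \<tau> KD lim by (intro DS.convergent_imp_MCauchy) auto
    then have "MS.MCauchy y"
      using y by (auto simp: DS.MCauchy_def MS.MCauchy_def hd)
    then obtain z where z: "limitin MS.mtopology y z sequentially"
      using H.complete unfolding MS.mcomplete_def by blast
    then have zM: "z \<in> carrier M" by (simp add: MS.limitin_metric)
    have "limitin DS.mtopology \<tau> (\<iota> z) sequentially"
      using z y zM by (auto simp: MS.limitin_metric DS.limitin_metric hd)
    then have "u = \<iota> z" using lim DS.limitin_metric_unique by (metis trivial_limit_sequentially)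
    then show "u \<in> K" using zM by (simp add: K_def)
  qed
  moreover have "submodule K complex_field D"
  proof (rule D.submoduleI)
    show "\<zero>\<^bsub>D\<^esub> \<in> K" unfolding K_def using \<iota>ip[of "\<zero>\<^bsub>M\<^esub>" "\<zero>\<^bsub>M\<^esub>"] D.ip_definite[of "\<iota> \<zero>\<^bsub>M\<^esub>"]
      by (metis M.ip_zero H.zero_closed \<iota>c imageI)
  qed (use KD in \<open>auto simp: K_def simp flip: \<iota>minus \<iota>add \<iota>lin\<close>)
  moreover have "a \<triangleright>\<^bsub>D\<^esub> u \<in> K" "M.dual_ract u b \<in> K" if "u \<in> K" for u a b
    using that by (auto simp: K_def simp flip: \<iota>lin)
  ultimately have sub: "hilbert_subbimodule K D M.dual_ract"
    by (simp add: hilbert_subbimodule_def)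
  define \<phi> where "\<phi> = inv_into (carrier M) \<iota>"
  have "inj_on \<iota> (carrier M)" using \<iota>inj by (auto intro: inj_onI)
  then have \<phi>: "\<phi> (\<iota> y) = y" if "y \<in> carrier M" for y using that by (simp add: \<phi>_def)
  have "bounded_bimodule_map (D\<lparr>carrier := K\<rparr>) M.dual_ract M \<rho> \<phi>"
    unfolding bounded_bimodule_map_def bounded_module_map_def
  proof (intro conjI ballI allI exI[of _ 1])
    show "hnorm M (\<phi> u) \<le> 1 * hnorm (D\<lparr>carrier := K\<rparr>) u" if "u \<in> carrier (D\<lparr>carrier := K\<rparr>)" for u
      using that \<iota>norm by (auto simp: K_def \<phi> hnorm_def)
  qed (auto simp: K_def \<phi> simp flip: \<iota>add \<iota>lin)
  moreover have "hilbert_bimodule D M.dual_ract"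
    unfolding hilbert_bimodule_def D_def using M.hilbert_module_dual M.star_representation_dual by blast
  ultimately obtain \<psi> where \<psi>: "bounded_bimodule_map D M.dual_ract M \<rho> \<psi>" "\<And>u. u \<in> K \<Longrightarrow> \<psi> u = \<phi> u"
    using inj sub unfolding injective_bimodule_def by blast
  have \<psi>m: "bounded_module_map D M \<psi>" using \<psi>(1) by (simp add: bounded_bimodule_map_def)
  have \<psi>c [simp]: "\<psi> u \<in> carrier M" if "u \<in> carrier D" for u using \<psi>m that by (auto simp: bounded_module_map_def)
  have \<psi>\<iota>: "\<psi> (\<iota> y) = y" if "y \<in> carrier M" for y using that \<psi>(2) \<phi> by (simp add: K_def)
  have \<psi>add: "\<psi> (u \<oplus>\<^bsub>D\<^esub> v) = \<psi> u \<oplus>\<^bsub>M\<^esub> \<psi> v" if "u \<in> carrier D" "v \<in> carrier D" for u v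
    using that \<psi>m by (simp add: bounded_module_map_def)
  have \<psi>lin: "\<psi> (c \<odot>\<^bsub>D\<^esub> v) = c \<odot>\<^bsub>M\<^esub> \<psi> v" "\<psi> (a \<triangleright>\<^bsub>D\<^esub> v) = a \<triangleright>\<^bsub>M\<^esub> \<psi> v"
    if "v \<in> carrier D" for v c a
    using that \<psi>m by (auto simp: bounded_module_map_def)
  obtain C where C: "C > 0" "\<And>u. u \<in> carrier D \<Longrightarrow> hnorm M (\<psi> u) \<le> C * hnorm D u"
    using bounded_module_map_bound[OF \<psi>m] by metis
  have fixed: "\<iota> (\<psi> u) = u" if u: "u \<in> carrier D" for u
  proof -
    have "ip D (u \<ominus>\<^bsub>D\<^esub> \<iota> (\<psi> u)) w = 0" if w: "w \<in> carrier D" for w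
    proof -
      \<comment> \<open>Pairing the deviation with a fixed w reduces the claim to scalar
        functionals, for which vanishing on the image of M is decisive.\<close>
      define F where "F u = ip D u w - ip D (\<iota> (\<psi> u)) w" for u
      have "bounded_module_functional D F"
        unfolding bounded_module_functional_def
      proof (intro conjI ballI allI exI[of _ "hnorm D w + C * hnorm D w"])
        fix u assume u: "u \<in> carrier D"
        have "norm (F u) \<le> norm (ip D u w) + norm (ip D (\<iota> (\<psi> u)) w)"
          unfolding F_def by (rule norm_triangle_ineq4)
        also have "\<dots> \<le> hnorm D u * hnorm D w + (C * hnorm D u) * hnorm D w"
          using u w D.Cauchy_Schwarz[of "\<iota> (\<psi> u)" w] mult_right_mono[OF C(2)[OF u], of "hnorm D w"]
          by (intro add_mono D.Cauchy_Schwarz) (auto simp: \<iota>norm)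
        finally show "norm (F u) \<le> (hnorm D w + C * hnorm D w) * hnorm D u"
          by (simp add: algebra_simps)
      qed (use w in \<open>auto simp: F_def \<psi>add \<psi>lin \<iota>add \<iota>lin D.ip_simps cscale_diff_right right_diff_distrib\<close>)
      moreover have "F (\<iota> y) = 0" if "y \<in> carrier M" for y using that by (simp add: F_def \<psi>\<iota>)
      ultimately have "F u = 0"
        using M.functional_zero_if_vanishes_on_canonical[of F u] u by (simp add: D_def \<iota>_def)
      then show ?thesis using u w by (simp add: F_def D.ip_diff)
    qed
    then have "ip D (u \<ominus>\<^bsub>D\<^esub> \<iota> (\<psi> u)) (u \<ominus>\<^bsub>D\<^esub> \<iota> (\<psi> u)) = 0" using u by simp
    then have "u \<ominus>\<^bsub>D\<^esub> \<iota> (\<psi> u) = \<zero>\<^bsub>D\<^esub>" using u by (intro D.ip_definite) auto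
    then show ?thesis using u by (simp add: D.diff_eq_zero_iff)
  qed
  show ?thesis
    unfolding self_dual_def
  proof (intro allI impI)
    fix r assume r: "bounded_module_functional M r"
    define u where "u = (Inl (M.on_carrier r) :: ('m \<Rightarrow> 'a) + 'l)"
    have u: "u \<in> carrier D" using r by (auto simp: u_def D_def M.dual_module_simps)
    \<comment> \<open>The functional u is fixed by the retraction, so it is the image of \<psi>(u),
      which therefore represents r.\<close>
    have "M.on_carrier r = M.on_carrier (\<lambda>x. ip M x (\<psi> u))"
      using fixed[OF u] by (simp add: u_def \<iota>_def M.canonical_def)
    then have "r x = ip M x (\<psi> u)" if "x \<in> carrier M" for x
      using that by (metis M.on_carrier_apply)
    then show "\<exists>y\<in>carrier M. \<forall>x\<in>carrier M. r x = ip M x y" using u by (intro bexI[of _ "\<psi> u"]) auto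
  qed
qed

theorem theorem3p9:
  fixes M :: "('a::cstar_algebra, 'm) hilbert_mod"
    and \<rho> :: "'m \<Rightarrow> 'b::cstar_algebra \<Rightarrow> 'm"
  assumes "monotone_complete TYPE('a)"
    and "hilbert_module M"
    and "star_representation M \<rho>"
  shows "injective_bimodule TYPE(('m \<Rightarrow> 'a) + 'l) M \<rho> \<longleftrightarrow> self_dual M"
  using injective_if_self_dual[OF assms] self_dual_if_injective[OF assms] by blast

end
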